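(* Let $1<p<\infty$ and let $\Omega$ be a bounded open subset of $\mathbb{R}^{m+k}$ on which the first eigenfunction $\phi_1$ of $-\Delta_{\gamma,p}$ is positive, and let $\lambda_1$ be the corresponding first eigenvalue. Then, for all complex-valued $f\in C^{\infty}_{0}(\Omega)$, $$\int_{\Omega}|\nabla_{\gamma}f|^{p}\,dz=\lambda_1\int_{\Omega}|f|^{p}\,dz+\int_{\Omega}C_p\left(\nabla_\gamma f,\phi_{1}\nabla_{\gamma}\left(\frac{f}{\phi_{1}}\right)\right)dz.$$
   Context: Baouendi–Grushin setting: $m,k\ge 1$ are integers, $\gamma\geq0$ is a real number, points are $z=(x,y)\in\mathbb{R}^{m}\times\mathbb{R}^{k}=\mathbb{R}^{m+k}$, $|\cdot|$ is the Euclidean norm and $dz$ is Lebesgue measure. The gradient is $\nabla_{\gamma}=(X_1,\dots,X_m,Y_1,\dots,Y_k)=(\nabla_x,|x|^{\gamma}\nabla_y)$ with $X_i=\partial/\partial x_i$, $Y_j=|x|^\gamma\partial/\partial y_j$, and for a vector-valued $F=(F_1,\ldots,F_{m+k})$ the divergence is $\nabla_\gamma\cdot F=\sum_{i=1}^m X_iF_i+\sum_{j=1}^k Y_jF_{m+j}$. The $p$-Grushin operator is $\Delta_{\gamma,p}\phi=\nabla_{\gamma}\cdot(|\nabla_{\gamma}\phi|^{p-2}\nabla_{\gamma}\phi)$. $\lambda_1$ and $\phi_1$ denote the first eigenvalue and first eigenfunction of the Dirichlet operator $-\Delta_{\gamma,p}$ on $\Omega$, so that (in the weak sense, with zero Dirichlet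 boundary condition) $-\Delta_{\gamma,p}\phi_1=\lambda_1|\phi_1|^{p-2}\phi_1$ in $\Omega$. $C_0^\infty(\Omega)$ is the space of smooth functions compactly supported in $\Omega$. For $1<p<\infty$ and $\xi,\eta\in\mathbb{C}^{N}$, $$C_p(\xi,\eta):=|\xi|^p-|\xi-\eta|^p-p|\xi-\eta|^{p-2}\,\mathrm{Re}\big((\xi-\eta)\cdot\overline{\eta}\big)\ \ (\geq0),$$ the last term being read as $0$ when $\xi=\eta$. *)

theory Defs
  imports "HOL-Analysis.Analysis"
begin

text \<open>
  Points of $R^{m+k}$ are pairs \<open>z = (x, y)\<close> of type \<open>(real^'m) \<times> (real^'k)\<close>, whose norm is
  the Euclidean one. Gradients of functions with values in \<open>'b\<close> (real or complex numbers)
  are pairs of type \<open>('b^'m) \<times> ('b^'k)\<close>. Dimensions of index types are at least 1.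
\<close>

section \<open>Test functions\<close>

definition partial_deriv ::
    "'a::euclidean_space \<Rightarrow> ('a \<Rightarrow> 'b::euclidean_space) \<Rightarrow> 'a \<Rightarrow> 'b" where
  "partial_deriv e u z = vector_derivative (\<lambda>t. u (z + t *\<^sub>R e)) (at 0)"

primrec C_k :: "nat \<Rightarrow> ('a::euclidean_space \<Rightarrow> 'b::euclidean_space) \<Rightarrow> bool" where
  "C_k 0 u \<longleftrightarrow> continuous_on UNIV u"
| "C_k (Suc n) u \<longleftrightarrow>
     (\<forall>z. u differentiable (at z)) \<and> (\<forall>e\<in>Basis. C_k n (partial_deriv e u))"

text \<open>Functions in $C_0^\infty(\Omega)$ are represented by their extension by zero to the whole space.\<close>

definition C0_infinity ::
    "'a::euclidean_space set \<Rightarrow> ('a \<Rightarrow> 'b::euclidean_space) set" where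
  "C0_infinity \<Omega> = {u. (\<forall>n. C_k n u) \<and>
     compact (closure {z. u z \<noteq> 0}) \<and> closure {z. u z \<noteq> 0} \<subseteq> \<Omega>}"

section \<open>Classical Grushin gradient\<close>

text \<open>The case distinction is needed because \<open>0 powr 0 = 0\<close>, while $|x|^0 = 1$ here.\<close>

definition grushin_weight :: "real \<Rightarrow> (real^'m) \<times> (real^'k) \<Rightarrow> real" where
  "grushin_weight \<gamma> z = (if \<gamma> = 0 then 1 else norm (fst z) powr \<gamma>)"

definition grushin_X ::
    "'m \<Rightarrow> ((real^'m) \<times> (real^'k) \<Rightarrow> 'b::euclidean_space) \<Rightarrow> (real^'m) \<times> (real^'k) \<Rightarrow> 'b" where
  "grushin_X i u z = partial_deriv (axis i 1, 0) u z"

definition grushin_Y ::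
    "real \<Rightarrow> 'k \<Rightarrow> ((real^'m) \<times> (real^'k) \<Rightarrow> 'b::euclidean_space) \<Rightarrow> (real^'m) \<times> (real^'k) \<Rightarrow> 'b" where
  "grushin_Y \<gamma> j u z = grushin_weight \<gamma> z *\<^sub>R partial_deriv (0, axis j 1) u z"

definition grushin_grad ::
    "real \<Rightarrow> ((real^'m) \<times> (real^'k) \<Rightarrow> 'b::euclidean_space) \<Rightarrow> (real^'m) \<times> (real^'k) \<Rightarrow> ('b^'m) \<times> ('b^'k)" where
  "grushin_grad \<gamma> u z = ((\<chi> i. grushin_X i u z), (\<chi> j. grushin_Y \<gamma> j u z))"

section \<open>Weak gradient and weak divergence\<close>

definition locally_integrable_on ::
    "'a::euclidean_space set \<Rightarrow> ('a \<Rightarrow> 'b::euclidean_space) \<Rightarrow> bool" where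
  "locally_integrable_on \<Omega> u \<longleftrightarrow>
     (\<forall>K. compact K \<and> K \<subseteq> \<Omega> \<longrightarrow> set_integrable lebesgue K u)"

text \<open>
  The formal adjoints of $X_i$ and $Y_j$ are $-X_i$ and $-Y_j$, since the weight $|x|^\gamma$
  does not depend on $y$.
\<close>

definition weak_grushin_grad ::
    "real \<Rightarrow> ((real^'m) \<times> (real^'k)) set \<Rightarrow> ((real^'m) \<times> (real^'k) \<Rightarrow> 'b::euclidean_space) \<Rightarrow>
     ((real^'m) \<times> (real^'k) \<Rightarrow> ('b^'m) \<times> ('b^'k)) \<Rightarrow> bool" where
  "weak_grushin_grad \<gamma> \<Omega> u G \<longleftrightarrow>
     locally_integrable_on \<Omega> u \<and> locally_integrable_on \<Omega> G \<and>
     (\<forall>\<psi> :: (real^'m) \<times> (real^'k) \<Rightarrow> real. \<psi> \<in> C0_infinity \<Omega> \<longrightarrow>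
        (\<forall>i. (LINT z:\<Omega>|lebesgue. grushin_X i \<psi> z *\<^sub>R u z)
              = - (LINT z:\<Omega>|lebesgue. \<psi> z *\<^sub>R (fst (G z) $ i))) \<and>
        (\<forall>j. (LINT z:\<Omega>|lebesgue. grushin_Y \<gamma> j \<psi> z *\<^sub>R u z)
              = - (LINT z:\<Omega>|lebesgue. \<psi> z *\<^sub>R (snd (G z) $ j))))"

definition weak_grushin_div ::
    "real \<Rightarrow> ((real^'m) \<times> (real^'k)) set \<Rightarrow> ((real^'m) \<times> (real^'k) \<Rightarrow> (real^'m) \<times> (real^'k)) \<Rightarrow>
     ((real^'m) \<times> (real^'k) \<Rightarrow> real) \<Rightarrow> bool" where
  "weak_grushin_div \<gamma> \<Omega> F h \<longleftrightarrow>
     locally_integrable_on \<Omega> F \<and> locally_integrable_on \<Omega> h \<and>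
     (\<forall>\<psi> \<in> C0_infinity \<Omega>.
        (LINT z:\<Omega>|lebesgue. F z \<bullet> grushin_grad \<gamma> \<psi> z) = - (LINT z:\<Omega>|lebesgue. h z * \<psi> z))"

text \<open>
  An eigenfunction is only a Sobolev function, positive almost everywhere, so its quotients
  $u = f/\phi$ are not known to be locally integrable without a Harnack inequality, so the plain weak gradient is too narrow
  a notion for them. The localized extension is used: \<open>G\<close> is the gradient of \<open>u\<close> if, up to
  a null set, \<open>\<Omega>\<close> is a countable union of measurable sets on each of which \<open>u\<close> and \<open>G\<close> coincide
  with a weakly differentiable function and its weak gradient. Since weak gradients of two
  functions agree almost everywhere where the functions agree, \<open>G\<close> is unique up to null sets,
  and it is the weak gradient of \<open>u\<close> whenever \<open>u\<close> has one (take all pieces to be \<open>\<Omega>\<close>).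
\<close>

definition has_grushin_grad ::
    "real \<Rightarrow> ((real^'m) \<times> (real^'k)) set \<Rightarrow> ((real^'m) \<times> (real^'k) \<Rightarrow> 'b::euclidean_space) \<Rightarrow>
     ((real^'m) \<times> (real^'k) \<Rightarrow> ('b^'m) \<times> ('b^'k)) \<Rightarrow> bool" where
  "has_grushin_grad \<gamma> \<Omega> u G \<longleftrightarrow>
     (\<exists>(A :: nat \<Rightarrow> ((real^'m) \<times> (real^'k)) set) v V.
        (\<forall>n. A n \<in> sets lebesgue \<and> A n \<subseteq> \<Omega>) \<and>
        (AE z in lebesgue. z \<in> \<Omega> \<longrightarrow> (\<exists>n. z \<in> A n)) \<and>
        (\<forall>n. weak_grushin_grad \<gamma> \<Omega> (v n) (V n) \<and>
             (AE z in lebesgue. z \<in> A n \<longrightarrow> u z = v n z \<and> G z = V n z)))"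

section \<open>Dirichlet eigenvalues of the p-Grushin operator\<close>

text \<open>
  \<open>u\<close> belongs to the closure of $C_0^\infty(\Omega)$ in the norm
  $(\int |u|^p + \int |\nabla_\gamma u|^p)^{1/p}$, and \<open>G\<close> is its weak gradient.
\<close>

definition grushin_W0 ::
    "real \<Rightarrow> real \<Rightarrow> ((real^'m) \<times> (real^'k)) set \<Rightarrow> ((real^'m) \<times> (real^'k) \<Rightarrow> real) \<Rightarrow>
     ((real^'m) \<times> (real^'k) \<Rightarrow> (real^'m) \<times> (real^'k)) \<Rightarrow> bool" where
  "grushin_W0 \<gamma> p \<Omega> u G \<longleftrightarrow>
     weak_grushin_grad \<gamma> \<Omega> u G \<and>
     set_integrable lebesgue \<Omega> (\<lambda>z. \<bar>u z\<bar> powr p) \<and>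
     set_integrable lebesgue \<Omega> (\<lambda>z. norm (G z) powr p) \<and>
     (\<exists>\<psi>. (\<forall>n::nat. \<psi> n \<in> C0_infinity \<Omega>) \<and>
        (\<lambda>n. LINT z:\<Omega>|lebesgue. \<bar>u z - \<psi> n z\<bar> powr p) \<longlonglongrightarrow> 0 \<and>
        (\<lambda>n. LINT z:\<Omega>|lebesgue. norm (G z - grushin_grad \<gamma> (\<psi> n) z) powr p) \<longlonglongrightarrow> 0)"

text \<open>
  \<open>u\<close> is a nontrivial weak solution of
  $\nabla_\gamma\cdot(|\nabla_\gamma u|^{p-2}\nabla_\gamma u) = -\mu|u|^{p-2}u$ with zero boundary
  values. Since \<open>0 powr a = 0\<close>, the factors with exponent \<open>p - 2\<close> give the value zero where
  \<open>u\<close> or its gradient vanishes, also for \<open>p \<le> 2\<close>.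
\<close>

definition dirichlet_eigenfunction ::
    "real \<Rightarrow> real \<Rightarrow> ((real^'m) \<times> (real^'k)) set \<Rightarrow> real \<Rightarrow> ((real^'m) \<times> (real^'k) \<Rightarrow> real) \<Rightarrow> bool" where
  "dirichlet_eigenfunction \<gamma> p \<Omega> \<mu> u \<longleftrightarrow>
     \<not> (AE z in lebesgue. z \<in> \<Omega> \<longrightarrow> u z = 0) \<and>
     (\<exists>G. grushin_W0 \<gamma> p \<Omega> u G \<and>
        weak_grushin_div \<gamma> \<Omega>
          (\<lambda>z. (norm (G z) powr (p - 2)) *\<^sub>R G z)
          (\<lambda>z. - (\<mu> * (\<bar>u z\<bar> powr (p - 2) * u z))))"

definition first_dirichlet_eigenfunction ::
    "real \<Rightarrow> real \<Rightarrow> ((real^'m) \<times> (real^'k)) set \<Rightarrow> real \<Rightarrow> ((real^'m) \<times> (real^'k) \<Rightarrow> real) \<Rightarrow> bool" where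
  "first_dirichlet_eigenfunction \<gamma> p \<Omega> \<mu> u \<longleftrightarrow>
     dirichlet_eigenfunction \<gamma> p \<Omega> \<mu> u \<and>
     (\<forall>\<nu> v. dirichlet_eigenfunction \<gamma> p \<Omega> \<nu> v \<longrightarrow> \<mu> \<le> \<nu>)"

section \<open>The remainder functional\<close>

definition bilinear_dot :: "(complex^'m) \<times> (complex^'k) \<Rightarrow> (complex^'m) \<times> (complex^'k) \<Rightarrow> complex" where
  "bilinear_dot \<xi> \<eta> = (\<Sum>i\<in>UNIV. fst \<xi> $ i * fst \<eta> $ i) + (\<Sum>j\<in>UNIV. snd \<xi> $ j * snd \<eta> $ j)"

definition conj_vec :: "(complex^'m) \<times> (complex^'k) \<Rightarrow> (complex^'m) \<times> (complex^'k)" where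
  "conj_vec \<eta> = ((\<chi> i. cnj (fst \<eta> $ i)), (\<chi> j. cnj (snd \<eta> $ j)))"

definition C_p :: "real \<Rightarrow> (complex^'m) \<times> (complex^'k) \<Rightarrow> (complex^'m) \<times> (complex^'k) \<Rightarrow> real" where
  "C_p p \<xi> \<eta> = norm \<xi> powr p - norm (\<xi> - \<eta>) powr p
     - p * norm (\<xi> - \<eta>) powr (p - 2) * Re (bilinear_dot (\<xi> - \<eta>) (conj_vec \<eta>))"

end

theory Submission
  imports Defs
begin

text \<open>
  Write \<open>\<xi> = \<nabla>\<^sub>\<gamma> f\<close>, let \<open>G\<close> be the weak gradient of \<open>\<phi> = \<phi>1\<close>, and put \<open>\<zeta> = (f / \<phi>) G\<close>. The quotient
  rule gives \<open>\<phi> \<nabla>\<^sub>\<gamma>(f / \<phi>) = \<xi> - \<zeta>\<close>, and expanding the remainder yields the pointwise identity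
  \<open>C_p(\<xi>, \<xi> - \<zeta>) = |\<xi>|\<^sup>p - Q\<close> with \<open>Q = p |\<zeta>|\<^bsup>p-2\<^esup> Re(\<zeta> \<cdot> cnj \<xi>) - (p - 1) |\<zeta>|\<^sup>p\<close> (\<open>C_p_expand\<close>). Formally
  \<open>Q = |G|\<^bsup>p-2\<^esup> G \<cdot> \<nabla>\<^sub>\<gamma>(|f|\<^sup>p / \<phi>\<^bsup>p-1\<^esup>)\<close>, so that the eigenvalue equation tested with
  \<open>|f|\<^sup>p / \<phi>\<^bsup>p-1\<^esup>\<close> gives \<open>\<integral> Q = \<lambda> \<integral> |f|\<^sup>p\<close>, which is the claim: it is Picone's identity.

  Two things have to be justified, because \<open>\<phi>\<close> is only a Sobolev function that is positive almost
  everywhere. First, \<open>f / \<phi>\<close> must have a gradient in the localized sense, and that gradient must be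
  determined almost everywhere. Existence follows from a chain rule: on \<open>{\<phi> \<ge> 1/n}\<close> the quotient
  agrees with \<open>h(\<phi>) f\<close>, where \<open>h\<close> is a bounded \<open>C\<^sup>1\<close> function equal to the reciprocal there; since
  \<open>\<phi>\<close> is a limit of test functions, the chain rule passes to the limit
  (\<open>weak_grad_compose_times\<close>, \<open>quotient_has_grushin_grad\<close>). Uniqueness is the fact that the
  weak derivative of a function vanishes almost everywhere on the zero set of the function
  (\<open>weak_derivative_zero_on_zero_set\<close>). It is proved for one direction at a time: the weight
  \<open>|x|\<^sup>\<gamma>\<close> does not depend on \<open>y\<close>, so \<open>|x|\<^sup>\<gamma> u\<close> has an ordinary weak derivative along each \<open>y\<close>-axis
  and no division by the degenerate weight occurs.

  Second, \<open>|f|\<^sup>p / \<phi>\<^bsup>p-1\<^esup>\<close> is not a test function. It is replaced by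
  \<open>((|f|\<^sup>2 + \<delta>\<^sup>2)\<^bsup>p/2\<^esup> - \<delta>\<^sup>p) (sqrt(\<psi>\<^sup>2 + \<delta>\<^sup>2) + \<epsilon>)\<^bsup>1-p\<^esup>\<close> with test functions \<open>\<psi>\<close> that converge to \<open>\<phi>\<close>
  while \<open>\<delta> \<rightarrow> 0\<close>; this is smooth with compact support. In the limit the equation holds with \<open>\<phi> + \<epsilon>\<close> in
  place of \<open>\<phi>\<close> in the denominators (\<open>regularised_picone_equation\<close>). The terms of this equation are
  those of \<open>Q\<close> multiplied by powers of \<open>r = \<phi> / (\<phi> + \<epsilon>)\<close>, and Young's inequality bounds
  \<open>\<integral> (r |\<zeta>|)\<^sup>p\<close> independently of \<open>\<epsilon>\<close>. Hence \<open>|\<zeta>|\<^sup>p\<close> is integrable by monotone convergence, and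
  dominated convergence removes \<open>\<epsilon>\<close> (\<open>picone_equation\<close>).
\<close>

section \<open>Smooth functions\<close>

lemma partial_deriv_eq:
  assumes "(u has_derivative D) (at z)"
  shows "partial_deriv e u z = D e"
proof -
  have "((\<lambda>t. u (z + t *\<^sub>R e)) has_derivative (\<lambda>t. D (t *\<^sub>R e))) (at 0)"
    by (rule has_derivative_compose[where g=u and f="\<lambda>t. z + t *\<^sub>R e"])
       (use assms in \<open>auto intro!: derivative_eq_intros\<close>)
  moreover have "(\<lambda>t. D (t *\<^sub>R e)) = (\<lambda>t. t *\<^sub>R D e)"
    using has_derivative_linear[OF assms] by (simp add: linear_scale)
  ultimately show ?thesis
    unfolding partial_deriv_def by (intro vector_derivative_at) (simp add: has_vector_derivative_def)
qed

lemma partial_deriv_compose_real: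
  assumes "u differentiable (at z)" "(h has_real_derivative d) (at (u z))"
  shows "(\<lambda>z. h (u z)) differentiable (at z)" "partial_deriv e (\<lambda>z. h (u z)) z = d * partial_deriv e u z"
proof -
  obtain D where D: "(u has_derivative D) (at z)"
    using assms(1) unfolding differentiable_def by blast
  have *: "((\<lambda>z. h (u z)) has_derivative (\<lambda>v. d * D v)) (at z)"
    using has_derivative_compose[OF D assms(2)[unfolded has_field_derivative_def]] .
  show "(\<lambda>z. h (u z)) differentiable (at z)" using * unfolding differentiable_def by blast
  show "partial_deriv e (\<lambda>z. h (u z)) z = d * partial_deriv e u z"
    using partial_deriv_eq[OF *] partial_deriv_eq[OF D] by simp
qed

lemma partial_deriv_scaleR:
  assumes "q differentiable (at z)" "f differentiable (at z)"
  shows "(\<lambda>z. q z *\<^sub>R f z) differentiable (at z)"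
    "partial_deriv e (\<lambda>z. q z *\<^sub>R f z) z = q z *\<^sub>R partial_deriv e f z + partial_deriv e q z *\<^sub>R f z"
proof -
  obtain D D' where D: "(q has_derivative D) (at z)" "(f has_derivative D') (at z)"
    using assms unfolding differentiable_def by blast
  note * = has_derivative_scaleR[OF D]
  show "(\<lambda>z. q z *\<^sub>R f z) differentiable (at z)" using * unfolding differentiable_def by blast
  show "partial_deriv e (\<lambda>z. q z *\<^sub>R f z) z = q z *\<^sub>R partial_deriv e f z + partial_deriv e q z *\<^sub>R f z"
    using partial_deriv_eq[OF *] partial_deriv_eq[OF D(1)] partial_deriv_eq[OF D(2)] by simp
qed

text \<open>
  Smoothness by coinduction: a class of differentiable functions that is closed under partial
  derivatives consists of smooth functions.
\<close>

lemma C_k_of_closed_class: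
  assumes "\<And>u. u \<in> S \<Longrightarrow> (\<forall>z. u differentiable (at z)) \<and> (\<forall>e\<in>Basis. partial_deriv e u \<in> S)"
    and "u \<in> S"
  shows "C_k n u"
  using assms(2)
proof (induction n arbitrary: u)
  case 0
  then show ?case
    using assms(1) by (simp add: continuous_at_imp_continuous_on differentiable_imp_continuous_within)
qed (use assms(1) in simp)

text \<open>
  The powers of \<open>1 / t\<close> are included so that the family is closed under differentiation.
\<close>

definition flat_exp :: "nat \<Rightarrow> real \<Rightarrow> real" where
  "flat_exp n t = (if t > 0 then exp (- (1 / t)) / t ^ n else 0)"

lemma flat_exp_has_derivative:
  "(flat_exp n has_real_derivative (flat_exp (n + 2) t - real n * flat_exp (n + 1) t)) (at t)"
proof -
  consider "t > 0" | "t < 0" | "t = 0" by linarith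
  then show ?thesis
  proof cases
    case 1
    have "((\<lambda>t. exp (- (1 / t)) / t ^ n) has_real_derivative
        (flat_exp (n + 2) t - real n * flat_exp (n + 1) t)) (at t)"
      using 1 unfolding flat_exp_def
      apply (cases n)
       apply (auto intro!: derivative_eq_intros simp: field_simps power2_eq_square)
      subgoal for k by (cases k) auto
      done
    then show ?thesis
      by (rule has_field_derivative_transform_within_open[where S="{0<..}"])
        (use 1 in \<open>auto simp: flat_exp_def\<close>)
  next
    case 2
    have "((\<lambda>t. 0) has_real_derivative (flat_exp (n + 2) t - real n * flat_exp (n + 1) t)) (at t)"
      using 2 by (simp add: flat_exp_def)
    then show ?thesis
      by (rule has_field_derivative_transform_within_open[where S="{..<0}"])
        (use 2 in \<open>auto simp: flat_exp_def\<close>)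
  next
    case 3
    have "((\<lambda>y. (flat_exp n y - flat_exp n 0) / (y - 0)) \<longlongrightarrow> 0) (at 0)"
    proof (rule filterlim_split_at)
      show "((\<lambda>y. (flat_exp n y - flat_exp n 0) / (y - 0)) \<longlongrightarrow> 0) (at_left 0)"
        by (rule tendsto_eventually, rule eventually_at_leftI[of "-1"]) (auto simp: flat_exp_def)
      have "((\<lambda>y::real. exp (- (1 / y)) / y ^ n / y) \<longlongrightarrow> 0) (at_right 0)"
        unfolding filterlim_at_right_to_top
        by (rule Lim_transform_eventually[OF tendsto_power_div_exp_0[of "Suc n"]])
          (auto intro!: eventually_mono[OF eventually_gt_at_top[of 0]] simp: field_simps exp_minus)
      then show "((\<lambda>y. (flat_exp n y - flat_exp n 0) / (y - 0)) \<longlongrightarrow> 0) (at_right 0)"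
        by (rule Lim_transform_eventually)
          (rule eventually_at_rightI[of 0 1], auto simp: flat_exp_def)
    qed
    then show ?thesis
      using 3 by (simp add: has_field_derivative_iff flat_exp_def)
  qed
qed

text \<open>
  Every constructor has a partial derivative that is again built from the constructors, which makes
  this class closed under differentiation. It turns out to be exactly the class of smooth real
  functions, so its rules serve as closure properties of smoothness.
\<close>

inductive_set smooth_class :: "('a::euclidean_space \<Rightarrow> real) set" where
  smooth_base: "(\<And>n. C_k n u) \<Longrightarrow> u \<in> smooth_class"
| smooth_const: "(\<lambda>z. c) \<in> smooth_class"
| smooth_coord: "(\<lambda>z. z \<bullet> b) \<in> smooth_class"
| smooth_add: "u \<in> smooth_class \<Longrightarrow> v \<in> smooth_class \<Longrightarrow> (\<lambda>z. u z + v z) \<in> smooth_class"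
| smooth_mult: "u \<in> smooth_class \<Longrightarrow> v \<in> smooth_class \<Longrightarrow> (\<lambda>z. u z * v z) \<in> smooth_class"
| smooth_powr: "u \<in> smooth_class \<Longrightarrow> (\<And>z. 0 < u z) \<Longrightarrow> (\<lambda>z. u z powr a) \<in> smooth_class"
| smooth_flat_exp: "u \<in> smooth_class \<Longrightarrow> (\<lambda>z. flat_exp n (u z)) \<in> smooth_class"

lemma smooth_class_closed:
  "u \<in> smooth_class \<Longrightarrow> (\<forall>z. u differentiable (at z)) \<and> (\<forall>e\<in>Basis. partial_deriv e u \<in> smooth_class)"
proof (induction rule: smooth_class.induct)
  case (smooth_base u)
  have "\<forall>z. u differentiable (at z)" using smooth_base[of 1] by simp
  moreover have "C_k n (partial_deriv e u)" if "e \<in> Basis" for e n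
    using smooth_base[of "Suc n"] that by simp
  ultimately show ?case by (auto intro: smooth_class.smooth_base)
next
  case (smooth_const c)
  have "partial_deriv e (\<lambda>z. c) = (\<lambda>z. 0)" for e :: 'a
    by (rule ext, rule partial_deriv_eq) auto
  then show ?case by (auto intro: smooth_class.intros)
next
  case (smooth_coord b)
  have *: "((\<lambda>z. z \<bullet> b) has_derivative (\<lambda>h. h \<bullet> b)) (at z)" for z
    by (auto intro!: derivative_eq_intros)
  then have "partial_deriv e (\<lambda>z. z \<bullet> b) = (\<lambda>z. e \<bullet> b)" for e :: 'a
    by (auto intro!: partial_deriv_eq)
  then show ?case using * by (auto intro: smooth_class.intros simp: differentiable_def)
next
  case (smooth_add u v)
  have *: "(\<lambda>z. u z + v z) differentiable (at z)
    \<and> partial_deriv e (\<lambda>z. u z + v z) z = partial_deriv e u z + partial_deriv e v z" for e z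
  proof -
    obtain D D' where "(u has_derivative D) (at z)" "(v has_derivative D') (at z)"
      using smooth_add.IH unfolding differentiable_def by blast
    from has_derivative_add[OF this] partial_deriv_eq[OF this(1)] partial_deriv_eq[OF this(2)] 
    show ?thesis by (auto simp: differentiable_def dest: partial_deriv_eq)
  qed
  then have "partial_deriv e (\<lambda>z. u z + v z) = (\<lambda>z. partial_deriv e u z + partial_deriv e v z)" for e
    by auto
  then show ?case using smooth_add * by (auto intro: smooth_class.intros)
next
  case (smooth_mult u v)
  have *: "(\<lambda>z. u z * v z) differentiable (at z)"
    "partial_deriv e (\<lambda>z. u z * v z) z = u z * partial_deriv e v z + partial_deriv e u z * v z" for e z
    using partial_deriv_scaleR[where q=u and f=v] smooth_mult.IH by auto
  then have "partial_deriv e (\<lambda>z. u z * v z)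
      = (\<lambda>z. u z * partial_deriv e v z + partial_deriv e u z * v z)" for e
    by auto
  then show ?case using smooth_mult * by (auto intro!: smooth_class.smooth_add smooth_class.smooth_mult)
next
  case (smooth_powr u a)
  have u: "u differentiable (at z)" for z using smooth_powr.IH by blast
  note * = partial_deriv_compose_real[OF u has_real_derivative_powr[OF smooth_powr(2)], where r1=a]
  have "partial_deriv e (\<lambda>z. u z powr a) = (\<lambda>z. (a * u z powr (a - 1)) * partial_deriv e u z)" for e
    by (rule ext) (rule *(2))
  then show ?case using smooth_powr *(1)
    by (auto intro!: smooth_class.smooth_mult smooth_class.smooth_const smooth_class.smooth_powr)
next
  case (smooth_flat_exp u n)
  have u: "u differentiable (at z)" for z using smooth_flat_exp.IH by blast
  note * = partial_deriv_compose_real[OF u flat_exp_has_derivative, where n1=n]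
  have "partial_deriv e (\<lambda>z. flat_exp n (u z))
      = (\<lambda>z. (flat_exp (n + 2) (u z) + (- real n) * flat_exp (n + 1) (u z)) * partial_deriv e u z)" for e
    by (rule ext) (simp add: *(2))
  moreover have "(\<lambda>z. (flat_exp (n + 2) (u z) + (- real n) * flat_exp (n + 1) (u z)) * partial_deriv e u z)
      \<in> smooth_class" if "e \<in> Basis" for e
    by (intro smooth_class.smooth_add smooth_class.smooth_mult smooth_class.smooth_const
        smooth_class.smooth_flat_exp smooth_flat_exp(1)) (use that smooth_flat_exp.IH in blast)
  ultimately show ?case using *(1) by simp
qed

lemma smooth_class_iff: "u \<in> smooth_class \<longleftrightarrow> (\<forall>n. C_k n u)"
  using C_k_of_closed_class[of smooth_class u] smooth_class_closed smooth_base by blast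

lemma C_k_translate: "C_k n u \<Longrightarrow> C_k n (\<lambda>z. u (z + a))"
proof (induction n arbitrary: u)
  case 0
  then show ?case
    by (auto intro!: continuous_on_compose2[of UNIV u] continuous_intros)
next
  case (Suc n)
  have *: "(\<lambda>z. u (z + a)) differentiable (at z)
      \<and> partial_deriv e (\<lambda>z. u (z + a)) z = partial_deriv e u (z + a)" for e z
  proof -
    obtain D where D: "(u has_derivative D) (at (z + a))"
      using Suc.prems unfolding C_k.simps differentiable_def by blast
    have "((\<lambda>z. u (z + a)) has_derivative D) (at z)"
      by (rule has_derivative_compose[where f="\<lambda>z. z + a" and g=u, OF _ D])
        (auto intro!: derivative_eq_intros)
    with partial_deriv_eq[OF D] partial_deriv_eq[OF this] show ?thesis
      by (auto simp: differentiable_def)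
  qed
  then have "partial_deriv e (\<lambda>z. u (z + a)) = (\<lambda>z. partial_deriv e u (z + a))" for e by auto
  then show ?case using Suc * by auto
qed

lemma C_k_bounded_linear:
  assumes "bounded_linear L"
  shows "C_k n u \<Longrightarrow> C_k n (\<lambda>z. L (u z))"
proof (induction n arbitrary: u)
  case 0
  then show ?case
    by (auto intro!: bounded_linear.continuous_on[OF assms])
next
  case (Suc n)
  have *: "(\<lambda>z. L (u z)) differentiable (at z)
      \<and> partial_deriv e (\<lambda>z. L (u z)) z = L (partial_deriv e u z)" for e z
  proof -
    obtain D where D: "(u has_derivative D) (at z)"
      using Suc.prems unfolding C_k.simps differentiable_def by blast
    from bounded_linear.has_derivative[OF assms D] show ?thesis
      using partial_deriv_eq[OF D] partial_deriv_eq[OF bounded_linear.has_derivative[OF assms D]]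
      by (auto simp: differentiable_def)
  qed
  then have "partial_deriv e (\<lambda>z. L (u z)) = (\<lambda>z. L (partial_deriv e u z))" for e by auto
  then show ?case using Suc * by auto
qed

section \<open>Differentiation under the integral and integration by parts\<close>

lemma partial_deriv_has_vector_derivative:
  assumes "u differentiable (at z)"
  shows "((\<lambda>t. u (z + t *\<^sub>R e)) has_vector_derivative partial_deriv e u z) (at 0)"
proof -
  obtain D where D: "(u has_derivative D) (at z)"
    using assms unfolding differentiable_def by blast
  then have "(u has_derivative D) (at (z + 0 *\<^sub>R e))" by simp
  then have "((\<lambda>t. u (z + t *\<^sub>R e)) has_derivative (\<lambda>t. D (t *\<^sub>R e))) (at 0)"
    by (intro has_derivative_compose[where g=u and f="\<lambda>t. z + t *\<^sub>R e"])
       (auto intro!: derivative_eq_intros)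
  then show ?thesis
    using linear_scale[OF has_derivative_linear[OF D]] partial_deriv_eq[OF D]
    by (simp add: has_vector_derivative_def)
qed

lemma has_vector_derivative_iff_quotient:
  "(f has_vector_derivative d) (at s) \<longleftrightarrow> ((\<lambda>h. (f (s + h) - f s) /\<^sub>R h) \<longlongrightarrow> d) (at 0)"
proof -
  have "norm (f (s + h) - f s - h *\<^sub>R d) / norm h = norm ((f (s + h) - f s) /\<^sub>R h - d)" if "h \<noteq> 0" for h
  proof -
    have "f (s + h) - f s - h *\<^sub>R d = h *\<^sub>R ((f (s + h) - f s) /\<^sub>R h - d)"
      using that by (simp add: algebra_simps)
    then show ?thesis using that by (metis norm_scaleR nonzero_mult_div_cancel_left norm_eq_zero real_norm_def)
  qed
  then have "((\<lambda>h. norm (f (s + h) - f s - h *\<^sub>R d) / norm h) \<longlongrightarrow> 0) (at 0)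
      \<longleftrightarrow> ((\<lambda>h. norm ((f (s + h) - f s) /\<^sub>R h - d)) \<longlongrightarrow> 0) (at 0)"
    by (intro tendsto_cong) (auto simp: eventually_at_filter)
  then show ?thesis
    unfolding has_vector_derivative_def has_derivative_at tendsto_norm_zero_iff
    by (simp add: LIM_zero_iff bounded_linear_scaleR_left)
qed

text \<open>
  The mean value inequality along the line through \<open>z\<close> in direction \<open>e\<close>.
\<close>

lemma directional_increment_bound:
  fixes w dw :: "'a::euclidean_space \<Rightarrow> 'b::euclidean_space"
  assumes deriv: "\<And>z. ((\<lambda>t. w (z + t *\<^sub>R e)) has_vector_derivative dw z) (at 0)"
    and bound: "\<And>z. norm (dw z) \<le> B"
  shows "norm (w (z + t *\<^sub>R e) - w (z + s *\<^sub>R e)) \<le> B * \<bar>t - s\<bar>"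
proof -
  have line: "((\<lambda>t. w (z + t *\<^sub>R e)) has_vector_derivative dw (z + s *\<^sub>R e)) (at s)" for s
  proof -
    have "((\<lambda>t. w ((z + s *\<^sub>R e) + (t - s) *\<^sub>R e)) has_vector_derivative 1 *\<^sub>R dw (z + s *\<^sub>R e)) (at s)"
      by (rule vector_diff_chain_at[unfolded o_def, where f="\<lambda>t. t - s" and g="\<lambda>t. w ((z + s *\<^sub>R e) + t *\<^sub>R e)"])
        (use deriv[of "z + s *\<^sub>R e"] in \<open>auto intro!: derivative_eq_intros\<close>)
    then show ?thesis by (simp add: algebra_simps)
  qed
  have "norm (w (z + t *\<^sub>R e) - w (z + s *\<^sub>R e)) \<le> B * norm (t - s)"
    by (rule differentiable_bound[where S=UNIV and f="\<lambda>t. w (z + t *\<^sub>R e)" and f'="\<lambda>t h. h *\<^sub>R dw (z + t *\<^sub>R e)"])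
      (use line mult_left_mono[OF bound abs_ge_zero] in
        \<open>auto simp: has_vector_derivative_def mult.commute intro!: onorm_le\<close>)
  then show ?thesis by simp
qed

lemma continuous_lebesgue_measurable:
  fixes w :: "'a::euclidean_space \<Rightarrow> 'b::euclidean_space"
  shows "continuous_on UNIV w \<Longrightarrow> w \<in> borel_measurable lebesgue"
  by (intro measurable_completion) (simp add: borel_measurable_continuous_onI)

lemma integrable_scaleR_bounded:
  fixes w :: "'a::euclidean_space \<Rightarrow> 'b::euclidean_space" and U :: "'a \<Rightarrow> real"
  assumes "integrable lebesgue U" "w \<in> borel_measurable lebesgue" "\<And>z. norm (w z) \<le> B"
  shows "integrable lebesgue (\<lambda>z. U z *\<^sub>R w z)"
proof (rule Bochner_Integration.integrable_bound[where f="\<lambda>z. B * U z"])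
  show "AE z in lebesgue. norm (U z *\<^sub>R w z) \<le> norm (B * U z)"
    using order_trans[OF norm_ge_zero assms(3)] mult_left_mono[OF assms(3) abs_ge_zero]
    by (auto intro!: AE_I2 simp: mult.commute abs_mult)
qed (use assms in auto)

text \<open>
  The difference quotients of \<open>w\<close> are bounded by \<open>B\<close>, so dominated convergence applies; all derivatives fall
  on \<open>w\<close>, which allows any integrable weight \<open>U\<close>.
\<close>

lemma has_vector_derivative_integral_translate:
  fixes w dw :: "'a::euclidean_space \<Rightarrow> 'b::euclidean_space" and U :: "'a \<Rightarrow> real"
  assumes U: "integrable lebesgue U"
    and cont: "continuous_on UNIV w" "continuous_on UNIV dw"
    and deriv: "\<And>z. ((\<lambda>t. w (z + t *\<^sub>R e)) has_vector_derivative dw z) (at 0)"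
    and bound: "\<And>z. norm (w z) \<le> C" "\<And>z. norm (dw z) \<le> B"
  shows "((\<lambda>s. LINT z|lebesgue. U z *\<^sub>R w (z + s *\<^sub>R e)) has_vector_derivative
      (LINT z|lebesgue. U z *\<^sub>R dw (z + s *\<^sub>R e))) (at s)"
proof -
  have wm: "(\<lambda>z. w (z + a)) \<in> borel_measurable lebesgue" for a
    by (intro continuous_lebesgue_measurable continuous_on_compose2[OF cont(1)] continuous_intros) auto
  have dwm: "(\<lambda>z. dw (z + a)) \<in> borel_measurable lebesgue" for a
    by (intro continuous_lebesgue_measurable continuous_on_compose2[OF cont(2)] continuous_intros) auto
  have Uw: "integrable lebesgue (\<lambda>z. U z *\<^sub>R w (z + a))" for a
    by (rule integrable_scaleR_bounded[OF U wm bound(1)])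
  have B: "0 \<le> B" using order_trans[OF norm_ge_zero bound(2)] .
  let ?q = "\<lambda>h z. (w (z + (s + h) *\<^sub>R e) - w (z + s *\<^sub>R e)) /\<^sub>R h"
  have lim: "((\<lambda>h. LINT z|lebesgue. U z *\<^sub>R ?q h z) \<longlongrightarrow> (LINT z|lebesgue. U z *\<^sub>R dw (z + s *\<^sub>R e))) (at 0)"
    unfolding tendsto_at_iff_sequentially o_def
  proof (intro allI impI)
    fix X :: "nat \<Rightarrow> real"
    assume X: "\<forall>i. X i \<in> UNIV - {0}" "X \<longlonglongrightarrow> 0"
    show "(\<lambda>i. LINT z|lebesgue. U z *\<^sub>R ?q (X i) z) \<longlonglongrightarrow> (LINT z|lebesgue. U z *\<^sub>R dw (z + s *\<^sub>R e))"
    proof (rule integral_dominated_convergence[where w="\<lambda>z. B * \<bar>U z\<bar>"])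
      show "AE z in lebesgue. (\<lambda>i. U z *\<^sub>R ?q (X i) z) \<longlonglongrightarrow> U z *\<^sub>R dw (z + s *\<^sub>R e)"
      proof (intro AE_I2 tendsto_intros)
        fix z
        have "((\<lambda>h. (w (z + s *\<^sub>R e + h *\<^sub>R e) - w (z + s *\<^sub>R e)) /\<^sub>R h) \<longlongrightarrow> dw (z + s *\<^sub>R e)) (at 0)"
          using deriv[of "z + s *\<^sub>R e"] unfolding has_vector_derivative_iff_quotient by simp
        then show "(\<lambda>i. ?q (X i) z) \<longlonglongrightarrow> dw (z + s *\<^sub>R e)"
          using X unfolding tendsto_at_iff_sequentially o_def
          by (auto simp: algebra_simps)
      qed
      show "AE z in lebesgue. norm (U z *\<^sub>R ?q (X i) z) \<le> B * \<bar>U z\<bar>" for i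
      proof (rule AE_I2)
        fix z
        have "norm (w (z + (s + X i) *\<^sub>R e) - w (z + s *\<^sub>R e)) \<le> B * \<bar>X i\<bar>"
          using directional_increment_bound[OF deriv bound(2), of z "s + X i" s] by simp
        moreover have "X i \<noteq> 0" using X(1) by auto
        moreover have "norm (D /\<^sub>R x) \<le> B" if "norm D \<le> B * \<bar>x\<bar>" "x \<noteq> 0" for D :: 'b and x
          using that by (simp add: divide_simps)
        ultimately have "norm (?q (X i) z) \<le> B" by blast
        moreover have "norm (u *\<^sub>R D) \<le> B * \<bar>u\<bar>" if "norm D \<le> B" for D :: 'b and u
          using mult_left_mono[OF that abs_ge_zero[of u]] by (simp add: mult.commute)
        ultimately show "norm (U z *\<^sub>R ?q (X i) z) \<le> B * \<bar>U z\<bar>" by blast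
      qed
      show "(\<lambda>z. U z *\<^sub>R ?q (X i) z) \<in> borel_measurable lebesgue" for i
        using U wm[of "(s + X i) *\<^sub>R e"] wm[of "s *\<^sub>R e"] by measurable
      show "(\<lambda>z. U z *\<^sub>R dw (z + s *\<^sub>R e)) \<in> borel_measurable lebesgue"
        using U dwm[of "s *\<^sub>R e"] by measurable
      show "integrable lebesgue (\<lambda>z. B * \<bar>U z\<bar>)" using U by auto
    qed
  qed
  have eq: "(LINT z|lebesgue. U z *\<^sub>R ?q h z)
      = ((LINT z|lebesgue. U z *\<^sub>R w (z + (s + h) *\<^sub>R e)) - (LINT z|lebesgue. U z *\<^sub>R w (z + s *\<^sub>R e))) /\<^sub>R h" for h
  proof -
    have "(LINT z|lebesgue. U z *\<^sub>R ?q h z)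
      = (LINT z|lebesgue. (U z *\<^sub>R w (z + (s + h) *\<^sub>R e) - U z *\<^sub>R w (z + s *\<^sub>R e)) /\<^sub>R h)"
      by (rule Bochner_Integration.integral_cong) (auto simp: scaleR_right_diff_distrib mult.commute)
    also have "\<dots> = ((LINT z|lebesgue. U z *\<^sub>R w (z + (s + h) *\<^sub>R e)) - (LINT z|lebesgue. U z *\<^sub>R w (z + s *\<^sub>R e))) /\<^sub>R h"
      using Uw[of "(s + h) *\<^sub>R e"] Uw[of "s *\<^sub>R e"] by (simp add: Bochner_Integration.integral_diff)
    finally show ?thesis .
  qed
  show ?thesis
    using lim unfolding eq has_vector_derivative_iff_quotient .
qed

lemma lebesgue_integral_translate:
  fixes w :: "'a::euclidean_space \<Rightarrow> 'b::euclidean_space"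
  assumes m: "w \<in> borel_measurable borel"
  shows "(LINT z|lebesgue. w (z + a)) = (LINT z|lebesgue. w z)"
proof -
  have "(LINT z|lborel. w z) = (LINT z|distr lborel borel ((+) a). w z)"
    by (simp add: lborel_distr_plus)
  also have "\<dots> = (LINT z|lborel. w (a + z))"
    by (rule integral_distr) (use m in auto)
  finally show ?thesis
    using m by (simp add: integral_completion add.commute)
qed

lemma compact_support_derivative_zero:
  fixes w dw :: "'a::euclidean_space \<Rightarrow> 'b::euclidean_space"
  assumes "\<And>z. ((\<lambda>t. w (z + t *\<^sub>R e)) has_vector_derivative dw z) (at 0)"
    and "closed K" "\<And>z. z \<notin> K \<Longrightarrow> w z = 0" "z \<notin> K"
  shows "dw z = 0"
proof -
  have "open ((\<lambda>t. z + t *\<^sub>R e) -` (- K))"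
    using assms(2) by (intro open_vimage continuous_intros) auto
  then have "((\<lambda>t. 0) has_vector_derivative dw z) (at 0)"
    using assms
    by (intro has_vector_derivative_transform_within_open[OF assms(1)]) auto
  moreover have "((\<lambda>t::real. 0) has_vector_derivative (0::'b)) (at 0)" by simp
  ultimately show ?thesis by (rule vector_derivative_unique_at)
qed

lemma bounded_of_compact_support:
  fixes w :: "'a::euclidean_space \<Rightarrow> 'b::euclidean_space"
  assumes "continuous_on UNIV w" "compact K" "\<And>z. z \<notin> K \<Longrightarrow> w z = 0"
  obtains B where "\<And>z. norm (w z) \<le> B" "0 \<le> B"
proof -
  have "bounded (w ` K)"
    using assms by (intro compact_imp_bounded compact_continuous_image) (auto intro: continuous_on_subset)
  then obtain B where "\<forall>z\<in>K. norm (w z) \<le> B" by (auto simp: bounded_iff)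
  then have "norm (w z) \<le> max B 0" for z using assms(3)[of z] by (cases "z \<in> K") auto
  then show ?thesis using that[of "max B 0"] by auto
qed

lemma integrable_of_compact_support:
  fixes w :: "'a::euclidean_space \<Rightarrow> 'b::euclidean_space"
  assumes "continuous_on UNIV w" "compact K" "\<And>z. z \<notin> K \<Longrightarrow> w z = 0"
  shows "integrable lebesgue w"
proof -
  obtain B where B: "\<And>z. norm (w z) \<le> B" using bounded_of_compact_support[OF assms] by blast
  have "K \<in> lmeasurable" using assms(2) by (rule lmeasurable_compact)
  then have "integrable lebesgue (indicator K :: 'a \<Rightarrow> real)"
    by (simp add: lmeasurable_iff_integrable)
  from integrable_scaleR_bounded[OF this continuous_lebesgue_measurable[OF assms(1)] B]
  show ?thesis
    by (rule Bochner_Integration.integrable_cong[THEN iffD1, rotated 2])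
       (use assms(3) in \<open>auto simp: indicator_def\<close>)
qed

text \<open>
  By translation invariance the integral of \<open>w(z + s e)\<close> does not depend on \<open>s\<close>; its derivative in \<open>s\<close>
  is the integral of the directional derivative.
\<close>

lemma integral_directional_derivative_zero:
  fixes w dw :: "'a::euclidean_space \<Rightarrow> 'b::euclidean_space"
  assumes cont: "continuous_on UNIV w" "continuous_on UNIV dw"
    and deriv: "\<And>z. ((\<lambda>t. w (z + t *\<^sub>R e)) has_vector_derivative dw z) (at 0)"
    and K: "compact K" "\<And>z. z \<notin> K \<Longrightarrow> w z = 0"
  shows "(LINT z|lebesgue. dw z) = 0"
proof -
  have dw0: "dw z = 0" if "z \<notin> K" for z
    using compact_support_derivative_zero[OF deriv compact_imp_closed[OF K(1)] K(2) that] by auto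
  obtain B C where B: "\<And>z. norm (dw z) \<le> B" and C: "\<And>z. norm (w z) \<le> C"
    using bounded_of_compact_support[OF cont(1) K] bounded_of_compact_support[OF cont(2) K(1) dw0] by metis
  obtain r where r: "\<And>z. z \<in> K \<Longrightarrow> norm z \<le> r"
    using compact_imp_bounded[OF K(1)] by (auto simp: bounded_iff)
  define U where "U = (indicator (cball 0 (r + norm e)) :: 'a \<Rightarrow> real)"
  have U: "integrable lebesgue U"
    unfolding U_def using lmeasurable_cball by (simp add: lmeasurable_iff_integrable)
  have Uw: "U z *\<^sub>R w (z + s *\<^sub>R e) = w (z + s *\<^sub>R e)" if "\<bar>s\<bar> < 1" for s z
  proof (cases "z + s *\<^sub>R e \<in> K")
    case True
    have "norm z \<le> norm (z + s *\<^sub>R e) + norm (s *\<^sub>R e)"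
      using norm_triangle_ineq4[of "z + s *\<^sub>R e" "s *\<^sub>R e"] by simp
    also have "\<dots> \<le> r + norm e"
      using r[OF True] mult_right_mono[of "\<bar>s\<bar>" 1 "norm e"] that by simp
    finally show ?thesis by (simp add: U_def)
  qed (simp add: K(2))
  have Udw: "U z *\<^sub>R dw z = dw z" for z
    using r[of z] dw0[of z] by (cases "z \<in> K") (auto simp: U_def indicator_def intro: add_increasing2)
  have 1: "((\<lambda>s. LINT z|lebesgue. U z *\<^sub>R w (z + s *\<^sub>R e)) has_vector_derivative (LINT z|lebesgue. dw z)) (at 0)"
    using has_vector_derivative_integral_translate[OF U cont deriv C B, of 0] by (simp add: Udw)
  have 2: "(LINT z|lebesgue. U z *\<^sub>R w (z + s *\<^sub>R e)) = (LINT z|lebesgue. w z)" if "s \<in> {-1<..<1}" for s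
    using that by (simp add: Uw abs_less_iff lebesgue_integral_translate[OF borel_measurable_continuous_onI[OF cont(1)]])
  have "((\<lambda>s::real. LINT z|lebesgue. w z) has_vector_derivative (LINT z|lebesgue. dw z)) (at 0)"
    by (rule has_vector_derivative_transform_within_open[OF 1, where S="{-1<..<1}"]) (auto simp: 2)
  moreover have "((\<lambda>s::real. LINT z|lebesgue. w z) has_vector_derivative 0) (at 0)" by simp
  ultimately show ?thesis by (rule vector_derivative_unique_at)
qed

section \<open>Test functions and smooth cut-offs\<close>

lemma C0_infinityI:
  assumes "\<And>n. C_k n u" "compact K" "K \<subseteq> \<Omega>" "\<And>z. z \<notin> K \<Longrightarrow> u z = 0"
  shows "u \<in> C0_infinity \<Omega>"
proof -
  have "closure {z. u z \<noteq> 0} \<subseteq> K"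
    using assms by (intro closure_minimal compact_imp_closed) auto
  moreover from this have "compact (closure {z. u z \<noteq> 0})"
    using compact_Int_closed[OF assms(2) closed_closure[of "{z. u z \<noteq> 0}"]]
    by (simp only: Int_absorb1)
  ultimately show ?thesis
    using assms(1,3) by (auto simp: C0_infinity_def)
qed

lemma C0_infinityE:
  assumes "u \<in> C0_infinity \<Omega>"
  obtains K where "compact K" "K \<subseteq> \<Omega>" "\<And>z. z \<notin> K \<Longrightarrow> u z = 0" "\<And>n. C_k n u"
proof
  show "compact (closure {z. u z \<noteq> 0})" "closure {z. u z \<noteq> 0} \<subseteq> \<Omega>"
    using assms by (auto simp: C0_infinity_def)
  show "u z = 0" if "z \<notin> closure {z. u z \<noteq> 0}" for z
    using that closure_subset[of "{z. u z \<noteq> 0}"] by auto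
  show "C_k n u" for n using assms by (auto simp: C0_infinity_def)
qed

lemma smooth_sum:
  "finite I \<Longrightarrow> (\<And>i. i \<in> I \<Longrightarrow> u i \<in> smooth_class) \<Longrightarrow> (\<lambda>z. \<Sum>i\<in>I. u i z) \<in> smooth_class"
  by (induction I rule: finite_induct) (auto intro: smooth_const smooth_add)

lemma smooth_norm_diff_squared: "(\<lambda>z. (norm (z - a))\<^sup>2) \<in> smooth_class"
proof -
  have "(\<lambda>z. (norm (z - a))\<^sup>2) = (\<lambda>z. \<Sum>b\<in>Basis. (z \<bullet> b + - (a \<bullet> b)) * (z \<bullet> b + - (a \<bullet> b)))"
    by (rule ext, unfold power2_norm_eq_inner, subst euclidean_inner, simp add: inner_diff_left)
  moreover have "(\<lambda>z. \<Sum>b\<in>Basis. (z \<bullet> b + - (a \<bullet> b)) * (z \<bullet> b + - (a \<bullet> b))) \<in> smooth_class"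
    by (intro smooth_sum smooth_mult smooth_add smooth_coord smooth_const) auto
  ultimately show ?thesis by simp
qed

lemma flat_exp_0_bounds: "0 \<le> flat_exp 0 t" "flat_exp 0 t \<le> 1" "0 < flat_exp 0 t \<longleftrightarrow> 0 < t"
  by (auto simp: flat_exp_def)

text \<open>
  A finite sum of radial bumps centred on \<open>K\<close>: by compactness finitely many balls of radius \<open>d\<close> suffice.
\<close>

lemma smooth_bump_near_compact:
  fixes K :: "'a::euclidean_space set"
  assumes "compact K" "0 < d"
  obtains S where "S \<in> smooth_class" "\<And>z. 0 \<le> S z" "\<And>z. z \<in> K \<Longrightarrow> 0 < S z"
    "\<And>z. S z \<noteq> 0 \<Longrightarrow> \<exists>x\<in>K. dist x z < d"
proof -
  have "K \<subseteq> (\<Union>a\<in>K. ball a d)" using assms(2) by auto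
  then obtain C where C: "C \<subseteq> K" "finite C" "K \<subseteq> (\<Union>a\<in>C. ball a d)"
    using compactE_image[OF assms(1), of K "\<lambda>a. ball a d"] by blast
  define bump where "bump a z = flat_exp 0 (d\<^sup>2 + (-1) * (norm (z - a))\<^sup>2)" for a z :: 'a
  have pos: "0 < bump a z \<longleftrightarrow> dist a z < d" for a z
  proof -
    have "0 < bump a z \<longleftrightarrow> (norm (z - a))\<^sup>2 < d\<^sup>2"
      by (simp only: bump_def flat_exp_0_bounds(3)) auto
    also have "\<dots> \<longleftrightarrow> norm (z - a) < d"
      using assms(2) power_mono_iff[of d "norm (z - a)" 2] by (simp flip: not_le)
    finally show ?thesis by (simp add: dist_norm norm_minus_commute)
  qed
  have nonneg: "0 \<le> bump a z" for a z by (simp add: bump_def flat_exp_0_bounds)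
  show ?thesis
  proof (rule that[of "\<lambda>z. \<Sum>a\<in>C. bump a z"])
    show "(\<lambda>z. \<Sum>a\<in>C. bump a z) \<in> smooth_class"
      unfolding bump_def
      by (intro smooth_sum[OF C(2)] smooth_flat_exp smooth_add smooth_mult smooth_const
          smooth_norm_diff_squared)
    show "0 \<le> (\<Sum>a\<in>C. bump a z)" for z by (simp add: sum_nonneg nonneg)
    show "0 < (\<Sum>a\<in>C. bump a z)" if zK: "z \<in> K" for z
    proof -
      obtain a where "a \<in> C" "dist a z < d" using C(3) zK by auto
      then show ?thesis using C(2) pos nonneg by (intro sum_pos2[of C a]) auto
    qed
    show "\<exists>x\<in>K. dist x z < d" if nz: "(\<Sum>a\<in>C. bump a z) \<noteq> 0" for z
    proof -
      obtain a where "a \<in> C" "bump a z \<noteq> 0" using nz by (meson sum.neutral)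
      then show ?thesis using pos[of a z] nonneg[of a z] C(1) by (intro bexI[of _ a]) auto
    qed
  qed
qed

text \<open>
  The map \<open>t \<mapsto> exp(-1/(c t))\<close> sends the values of a bump, which are bounded below by a positive constant on
  \<open>K\<close>, arbitrarily close to 1 when \<open>c\<close> is large, and it keeps the value 0. Shrinking the neighbourhood at the
  same time gives pointwise convergence to the indicator everywhere, also on the boundary of \<open>K\<close>.
\<close>

lemma smooth_cutoff_sequence:
  fixes K :: "'a::euclidean_space set"
  assumes K: "compact K" and d: "0 < d"
  obtains \<psi> :: "nat \<Rightarrow> 'a \<Rightarrow> real"
  where "\<And>n. \<psi> n \<in> smooth_class" "\<And>n z. 0 \<le> \<psi> n z" "\<And>n z. \<psi> n z \<le> 1"
    "\<And>n z. \<psi> n z \<noteq> 0 \<Longrightarrow> \<exists>x\<in>K. dist x z < d"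
    "\<And>z. (\<lambda>n. \<psi> n z) \<longlonglongrightarrow> indicator K z"
proof -
  have "\<exists>u. u \<in> smooth_class \<and> (\<forall>z. 0 \<le> u z \<and> u z \<le> 1) \<and> (\<forall>z. u z \<noteq> 0 \<longrightarrow> (\<exists>x\<in>K. dist x z < d / real (Suc n)))
      \<and> (\<forall>z\<in>K. 1 - 1 / real (Suc n) \<le> u z)" for n
  proof -
    have "0 < d / real (Suc n)" using d by simp
    from smooth_bump_near_compact[OF K this]
    obtain S where S: "S \<in> smooth_class" "\<And>z. 0 \<le> S z" "\<And>z. z \<in> K \<Longrightarrow> 0 < S z"
      "\<And>z. S z \<noteq> 0 \<Longrightarrow> \<exists>x\<in>K. dist x z < d / real (Suc n)" by metis
    have "\<exists>m>0. \<forall>z\<in>K. m \<le> S z"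
    proof (cases "K = {}")
      case True
      then show ?thesis by (auto intro!: exI[of _ 1])
    next
      case False
      have "continuous_on K S"
        using smooth_class_closed[OF S(1)]
        by (auto intro!: continuous_at_imp_continuous_on differentiable_imp_continuous_within)
      then obtain x where "x \<in> K" "\<forall>z\<in>K. S x \<le> S z"
        using continuous_attains_inf[OF K False] by blast
      then show ?thesis using S(3) by auto
    qed
    then obtain m where m: "0 < m" "\<And>z. z \<in> K \<Longrightarrow> m \<le> S z" by blast
    define u where "u z = flat_exp 0 (real (Suc n) / m * S z)" for z
    have "u \<in> smooth_class"
      unfolding u_def by (intro smooth_flat_exp smooth_mult smooth_const S(1))
    moreover have "S z \<noteq> 0" if "u z \<noteq> 0" for z
      using that by (auto simp: u_def flat_exp_def)
    moreover have "1 - 1 / real (Suc n) \<le> u z" if "z \<in> K" for z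
    proof -
      have "m / S z \<le> 1" using m(2)[OF that] S(3)[OF that] by simp
      then have "m / (real (Suc n) * S z) \<le> 1 / real (Suc n)"
        using divide_right_mono[of "m / S z" 1 "real (Suc n)"]
        by (simp only: divide_divide_eq_left mult.commute of_nat_0_le_iff)
      moreover have "1 + (- (m / (real (Suc n) * S z))) \<le> exp (- (m / (real (Suc n) * S z)))"
        by (rule exp_ge_add_one_self)
      ultimately have "1 - 1 / real (Suc n) \<le> exp (- (m / (real (Suc n) * S z)))" by linarith
      then show ?thesis using m S(3)[OF that] by (simp add: u_def flat_exp_def)
    qed
    ultimately show ?thesis using S(4) by (intro exI[of _ u]) (auto simp: u_def flat_exp_0_bounds)
  qed
  then obtain \<psi> where \<psi>: "\<And>n. \<psi> n \<in> smooth_class" "\<And>n z. 0 \<le> \<psi> n z \<and> \<psi> n z \<le> 1"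
     "\<And>n z. \<psi> n z \<noteq> 0 \<Longrightarrow> \<exists>x\<in>K. dist x z < d / real (Suc n)"
     "\<And>n z. z \<in> K \<Longrightarrow> 1 - 1 / real (Suc n) \<le> \<psi> n z"
    by metis
  have inv: "(\<lambda>n. d / real (Suc n)) \<longlonglongrightarrow> 0"
    using tendsto_mult_right_zero[OF LIMSEQ_inverse_real_of_nat, of d] by (simp add: divide_inverse)
  show ?thesis
  proof (rule that[of \<psi>])
    show "\<exists>x\<in>K. dist x z < d" if nz: "\<psi> n z \<noteq> 0" for n z
    proof -
      have "d / real (Suc n) \<le> d" using d by (simp add: field_simps)
      with \<psi>(3)[OF nz] show ?thesis using less_le_trans by blast
    qed
    show "(\<lambda>n. \<psi> n z) \<longlonglongrightarrow> indicator K z" for z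
    proof (cases "z \<in> K")
      case True
      have "(\<lambda>n. 1 - 1 / real (Suc n)) \<longlonglongrightarrow> 1"
        using tendsto_diff[OF tendsto_const[of 1] LIMSEQ_inverse_real_of_nat] by (simp add: divide_inverse)
      from tendsto_sandwich[OF _ _ this tendsto_const[of 1]] have "(\<lambda>n. \<psi> n z) \<longlonglongrightarrow> 1"
        using \<psi> True by (simp add: always_eventually)
      with True show ?thesis by simp
    next
      case False
      have "open (- K)" using K compact_imp_closed by blast
      then obtain \<epsilon> where \<epsilon>: "0 < \<epsilon>" "ball z \<epsilon> \<subseteq> - K"
        using False by (auto simp: open_contains_ball)
      have "\<forall>\<^sub>F n in sequentially. d / real (Suc n) < \<epsilon>"
        using order_tendstoD(2)[OF inv \<epsilon>(1)] .
      then have "\<forall>\<^sub>F n in sequentially. \<psi> n z = 0"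
      proof eventually_elim
        case (elim n)
        show ?case
        proof (rule ccontr)
          assume "\<psi> n z \<noteq> 0"
          then obtain x where "x \<in> K" "dist x z < \<epsilon>" using \<psi>(3) elim less_trans by meson
          then show False using subsetD[OF \<epsilon>(2), of x] by (simp add: dist_commute)
        qed
      qed
      then show ?thesis using False by (simp add: tendsto_eventually)
    qed
  qed (use \<psi> in auto)
qed

text \<open>
  Inner regularity of Lebesgue measure.
\<close>

lemma null_set_of_compact_null:
  assumes S: "S \<in> sets lebesgue"
    and K: "\<And>K. compact K \<Longrightarrow> K \<subseteq> S \<Longrightarrow> emeasure lebesgue K = 0"
  shows "S \<in> null_sets lebesgue"
proof -
  have "emeasure lebesgue S \<le> 0 + ennreal e" if e: "0 < e" for e
  proof -
    obtain T where T: "closed T" "T \<subseteq> S" "S - T \<in> lmeasurable" "emeasure lebesgue (S - T) < ennreal e"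
      using sets_lebesgue_inner_closed[OF S e] by blast
    have Tn: "T \<inter> cball 0 (real n) \<in> null_sets lebesgue" for n
    proof -
      have "compact (T \<inter> cball 0 (real n))" using T(1) by (simp add: closed_Int_compact)
      then show ?thesis using K T(2) by (auto simp: null_sets_def intro: lmeasurable_compact fmeasurableD)
    qed
    have "T = (\<Union>n. T \<inter> cball 0 (real n))"
      using real_arch_simple by (auto simp: dist_norm)
    then have "T \<in> null_sets lebesgue" using null_sets_UN[of "\<lambda>n. T \<inter> cball 0 (real n)", OF Tn] by simp
    then have "emeasure lebesgue ((S - T) \<union> T) = emeasure lebesgue (S - T)"
      using T(3) by (intro emeasure_Un_null_set) (auto dest: fmeasurableD)
    moreover have "(S - T) \<union> T = S" using T(2) by auto
    ultimately have "emeasure lebesgue S = emeasure lebesgue (S - T)" by simp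
    then show ?thesis using T(4) by simp
  qed
  then have "emeasure lebesgue S \<le> 0" using ennreal_le_epsilon[of 0 "emeasure lebesgue S"] by blast
  then show ?thesis using S by (simp add: null_sets_def)
qed

section \<open>Weak derivatives vanish on zero sets\<close>

definition weak_directional_derivative ::
    "'a::euclidean_space \<Rightarrow> 'a set \<Rightarrow> ('a \<Rightarrow> real) \<Rightarrow> ('a \<Rightarrow> real) \<Rightarrow> bool" where
  "weak_directional_derivative e \<Omega> u g \<longleftrightarrow>
     locally_integrable_on \<Omega> u \<and> locally_integrable_on \<Omega> g \<and>
     (\<forall>\<psi>\<in>C0_infinity \<Omega>. (LINT z:\<Omega>|lebesgue. partial_deriv e \<psi> z * u z)
        = - (LINT z:\<Omega>|lebesgue. \<psi> z * g z))"

lemma C_k_continuous: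
  assumes "\<And>n. C_k n u"
  shows "continuous_on UNIV u" "\<And>e. e \<in> Basis \<Longrightarrow> continuous_on UNIV (partial_deriv e u)"
    "\<And>z. u differentiable (at z)"
  using assms[of 0] assms[of "Suc 0"] by auto

lemma set_integral_restrict:
  assumes "\<And>z. z \<notin> K \<Longrightarrow> w z = 0" "K \<subseteq> \<Omega>"
  shows "(LINT z:\<Omega>|M. w z) = (LINT z|M. w z)"
  unfolding set_lebesgue_integral_def
  by (rule Bochner_Integration.integral_cong) (use assms in \<open>auto simp: indicator_def\<close>)

lemma partial_deriv_zero_outside:
  assumes diff: "\<And>z. w differentiable (at z)" and K: "closed K" "\<And>z. z \<notin> K \<Longrightarrow> w z = 0" "z \<notin> K"
  shows "partial_deriv e w z = 0"
  by (rule compact_support_derivative_zero[where w=w and dw="partial_deriv e w" and e=e and K=K])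
    (use partial_deriv_has_vector_derivative[OF diff] K in auto)

text \<open>
  The function \<open>s \<mapsto> \<integral> u(z) \<psi>(z - s e) dz\<close> is differentiable, and its derivative is
  \<open>\<integral> g(z) \<psi>(z - s e) dz\<close> because every translate of \<open>\<psi>\<close> is a test function. The mean value theorem
  takes the place of an integral over \<open>s\<close> and so avoids measurability questions in \<open>(s, z)\<close>.
\<close>

lemma weak_derivative_translated_cutoff:
  fixes e :: "'a::euclidean_space"
  assumes wd: "weak_directional_derivative e \<Omega> u g" and e: "e \<in> Basis"
    and N: "compact N" "N \<subseteq> \<Omega>"
    and \<psi>: "\<psi> \<in> smooth_class" "\<And>s z. \<lbrakk>0 \<le> s; s \<le> t; \<psi> (z - s *\<^sub>R e) \<noteq> 0\<rbrakk> \<Longrightarrow> z \<in> N"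
    and t: "0 < t"
  obtains s where "0 < s" "s < t"
    "(LINT z|lebesgue. (indicator N z * u z) * \<psi> (z - t *\<^sub>R e)) - (LINT z|lebesgue. (indicator N z * u z) * \<psi> z)
       = t * (LINT z|lebesgue. (indicator N z * g z) * \<psi> (z - s *\<^sub>R e))"
proof -
  have sm: "\<And>n. C_k n \<psi>" using \<psi>(1) by (simp add: smooth_class_iff)
  note cont = C_k_continuous[OF sm]
  define dw where "dw z = - partial_deriv e \<psi> z" for z
  have deriv: "((\<lambda>h. \<psi> (z + h *\<^sub>R (- e))) has_vector_derivative dw z) (at 0)" for z
  proof -
    have "((\<lambda>h. \<psi> (z + h *\<^sub>R e)) has_vector_derivative partial_deriv e \<psi> z) (at (- 0))"
      using partial_deriv_has_vector_derivative[OF cont(3)] by simp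
    from vector_diff_chain_at[OF has_vector_derivative_minus[OF has_vector_derivative_id] this]
    show ?thesis by (simp add: dw_def o_def)
  qed
  have U: "integrable lebesgue (\<lambda>z. indicator N z * u z)" "integrable lebesgue (\<lambda>z. indicator N z * g z)"
    using wd N unfolding weak_directional_derivative_def locally_integrable_on_def set_integrable_def by auto
  have supp: "\<psi> z = 0" if "z \<notin> N" for z
    using \<psi>(2)[of 0 z] t that by auto
  have supp_d: "dw z = 0" if "z \<notin> N" for z
    using partial_deriv_zero_outside[OF cont(3) compact_imp_closed[OF N(1)] supp that] by (simp add: dw_def)
  have cdw: "continuous_on UNIV dw"
    unfolding dw_def using cont(2)[OF e] by (intro continuous_intros)
  obtain B C where B: "\<And>z. norm (dw z) \<le> B" and C: "\<And>z. norm (\<psi> z) \<le> C"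
    using bounded_of_compact_support[OF cont(1) N(1) supp] bounded_of_compact_support[OF cdw N(1) supp_d] by metis
  define \<Phi> where "\<Phi> s = (LINT z|lebesgue. (indicator N z * u z) * \<psi> (z - s *\<^sub>R e))" for s
  have D: "(\<Phi> has_real_derivative (LINT z|lebesgue. (indicator N z * u z) * dw (z - s *\<^sub>R e))) (at s)" for s
    using has_vector_derivative_integral_translate[OF U(1) cont(1) cdw deriv C B, of s]
    unfolding \<Phi>_def by (simp add: has_real_derivative_iff_has_vector_derivative)
  have eq: "(LINT z|lebesgue. (indicator N z * u z) * dw (z - s *\<^sub>R e))
      = (LINT z|lebesgue. (indicator N z * g z) * \<psi> (z - s *\<^sub>R e))" if s: "0 \<le> s" "s \<le> t" for s
  proof -
    define \<eta> where "\<eta> z = \<psi> (z - s *\<^sub>R e)" for z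
    have \<eta>k: "C_k n \<eta>" for n
      using C_k_translate[OF sm, of n "- s *\<^sub>R e"] by (simp add: \<eta>_def[abs_def])
    have \<eta>0: "\<eta> z = 0" if "z \<notin> N" for z
      using \<psi>(2)[OF s] that by (auto simp: \<eta>_def)
    have "\<eta> \<in> C0_infinity \<Omega>" by (rule C0_infinityI[OF \<eta>k N \<eta>0])
    with wd have 0: "(LINT z:\<Omega>|lebesgue. partial_deriv e \<eta> z * u z) = - (LINT z:\<Omega>|lebesgue. \<eta> z * g z)"
      by (auto simp: weak_directional_derivative_def)
    have p\<eta>: "partial_deriv e \<eta> z = - dw (z - s *\<^sub>R e)" for z
      by (simp add: dw_def \<eta>_def partial_deriv_def algebra_simps)
    have p0: "partial_deriv e \<eta> z = 0" if "z \<notin> N" for z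
      using partial_deriv_zero_outside[OF C_k_continuous(3)[OF \<eta>k] compact_imp_closed[OF N(1)]] \<eta>0 that by blast
    have "(LINT z:\<Omega>|lebesgue. partial_deriv e \<eta> z * u z) = (LINT z|lebesgue. partial_deriv e \<eta> z * u z)"
      by (rule set_integral_restrict[OF _ N(2)]) (simp add: p0)
    also have "\<dots> = (LINT z|lebesgue. - ((indicator N z * u z) * dw (z - s *\<^sub>R e)))"
      by (rule Bochner_Integration.integral_cong) (use p0 in \<open>auto simp: indicator_def p\<eta>\<close>)
    finally have 1: "(LINT z:\<Omega>|lebesgue. partial_deriv e \<eta> z * u z)
        = - (LINT z|lebesgue. (indicator N z * u z) * dw (z - s *\<^sub>R e))" by simp
    have "(LINT z:\<Omega>|lebesgue. \<eta> z * g z) = (LINT z|lebesgue. \<eta> z * g z)"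
      by (rule set_integral_restrict[OF _ N(2)]) (simp add: \<eta>0)
    also have "\<dots> = (LINT z|lebesgue. (indicator N z * g z) * \<psi> (z - s *\<^sub>R e))"
      by (rule Bochner_Integration.integral_cong) (use \<eta>0 in \<open>auto simp: indicator_def \<eta>_def\<close>)
    finally have 2: "(LINT z:\<Omega>|lebesgue. \<eta> z * g z) = (LINT z|lebesgue. (indicator N z * g z) * \<psi> (z - s *\<^sub>R e))" .
    from 0 1 2 show ?thesis by simp
  qed
  from MVT2[OF t D] obtain s where s: "0 < s" "s < t" and
    "\<Phi> t - \<Phi> 0 = (t - 0) * (LINT z|lebesgue. (indicator N z * u z) * dw (z - s *\<^sub>R e))" by blast
  then show ?thesis using eq[of s] that[of s] by (simp add: \<Phi>_def)
qed

lemma lmeasurable_imp_integrable_indicator: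
  "S \<in> lmeasurable \<Longrightarrow> integrable lebesgue (indicator S :: _ \<Rightarrow> real)"
  by (simp add: lmeasurable_iff_integrable)

text \<open>
  The part of \<open>K - t e\<close> outside the closed set \<open>K\<close> has small measure by dominated convergence, and
  \<open>K - t e\<close> has the same measure as \<open>K\<close>.
\<close>

lemma measure_compact_Int_translate:
  fixes K :: "'a::euclidean_space set"
  assumes K: "compact K" and t: "t \<longlonglongrightarrow> 0"
  shows "(\<lambda>n. LINT z|lebesgue. indicator K z * indicator K (z + t n *\<^sub>R e)) \<longlonglongrightarrow> (LINT z|lebesgue. indicator K z :: real)"
proof -
  have bdd: "bounded (range t)" using convergent_imp_bounded[OF t] .
  then obtain T where T: "\<And>n. \<bar>t n\<bar> \<le> T" by (auto simp: bounded_iff)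
  obtain r where r: "\<And>z. z \<in> K \<Longrightarrow> norm z \<le> r"
    using compact_imp_bounded[OF K] by (auto simp: bounded_iff)
  define R where "R = r + T * norm e"
  have big: "z \<in> cball 0 R" if "z + t n *\<^sub>R e \<in> K" for z n
  proof -
    have "norm z \<le> norm (z + t n *\<^sub>R e) + norm (t n *\<^sub>R e)"
      using norm_triangle_ineq4[of "z + t n *\<^sub>R e" "t n *\<^sub>R e"] by simp
    also have "\<dots> \<le> R"
      using r[OF that] mult_right_mono[OF T, of "norm e" n] by (simp add: R_def)
    finally show ?thesis by simp
  qed
  have Kb: "(indicator K :: 'a \<Rightarrow> real) \<in> borel_measurable borel"
    using compact_imp_closed[OF K] by (intro borel_measurable_indicator) auto
  have "(\<lambda>z. indicator K (z + t n *\<^sub>R e) :: real) \<in> borel_measurable borel" for n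
    by (rule measurable_compose[OF _ Kb]) measurable
  then have Kt: "(\<lambda>z. indicator K (z + t n *\<^sub>R e) :: real) \<in> borel_measurable lebesgue" for n
    by (intro measurable_completion) simp
  have Kl: "(indicator K :: 'a \<Rightarrow> real) \<in> borel_measurable lebesgue"
    using Kb by (intro measurable_completion) simp
  have R: "integrable lebesgue (indicator (cball 0 R) :: 'a \<Rightarrow> real)"
    by (intro lmeasurable_imp_integrable_indicator lmeasurable_cball)
  have Kint: "integrable lebesgue (\<lambda>z. indicator K (z + t n *\<^sub>R e) :: real)" for n
    by (rule Bochner_Integration.integrable_bound[OF R Kt]) (use big in \<open>auto simp: indicator_def\<close>)
  have Km: "(\<lambda>z. (1 - indicator K z) * indicator K (z + t n *\<^sub>R e) :: real) \<in> borel_measurable lebesgue" for n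
    using Kl Kt[of n] by measurable
  have Kint2: "integrable lebesgue (\<lambda>z. (1 - indicator K z) * indicator K (z + t n *\<^sub>R e) :: real)" for n
    by (rule Bochner_Integration.integrable_bound[OF Kint[of n] Km]) (auto simp: indicator_def)
  have "(\<lambda>n. LINT z|lebesgue. (1 - indicator K z) * indicator K (z + t n *\<^sub>R e)) \<longlonglongrightarrow> (LINT z|(lebesgue :: 'a measure). (0::real))"
  proof (rule integral_dominated_convergence[OF _ _ R])
    show "AE z in lebesgue. norm ((1 - indicator K z) * indicator K (z + t n *\<^sub>R e) :: real) \<le> indicator (cball 0 R) z" for n
      using big by (auto simp: indicator_def)
    show "AE z in lebesgue. (\<lambda>n. (1 - indicator K z) * indicator K (z + t n *\<^sub>R e) :: real) \<longlonglongrightarrow> 0"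
    proof (rule AE_I2)
      fix z :: 'a
      show "(\<lambda>n. (1 - indicator K z) * indicator K (z + t n *\<^sub>R e) :: real) \<longlonglongrightarrow> 0"
      proof (cases "z \<in> K")
        case False
        have "(\<lambda>n. z + t n *\<^sub>R e) \<longlonglongrightarrow> z + 0 *\<^sub>R e" by (intro tendsto_intros t)
        then have "\<forall>\<^sub>F n in sequentially. z + t n *\<^sub>R e \<in> - K"
          using compact_imp_closed[OF K] False by (intro topological_tendstoD) auto
        then have "\<forall>\<^sub>F n in sequentially. (1 - indicator K z) * indicator K (z + t n *\<^sub>R e) = (0 :: real)"
          by eventually_elim simp
        then show ?thesis by (rule tendsto_eventually)
      qed simp
    qed
  qed (use Km in auto)
  then have "(\<lambda>n. (LINT z|lebesgue. indicator K z :: real)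
      - (LINT z|lebesgue. (1 - indicator K z) * indicator K (z + t n *\<^sub>R e))) \<longlonglongrightarrow> (LINT z|lebesgue. indicator K z) - 0"
    by (intro tendsto_intros) simp
  moreover have "(LINT z|lebesgue. indicator K z :: real) - (LINT z|lebesgue. (1 - indicator K z) * indicator K (z + t n *\<^sub>R e))
      = (LINT z|lebesgue. indicator K z * indicator K (z + t n *\<^sub>R e))" for n
  proof -
    have "(LINT z|lebesgue. indicator K z * indicator K (z + t n *\<^sub>R e) :: real)
      = (LINT z|lebesgue. indicator K (z + t n *\<^sub>R e) - (1 - indicator K z) * indicator K (z + t n *\<^sub>R e))"
      by (rule Bochner_Integration.integral_cong) (auto simp: algebra_simps)
    also have "\<dots> = (LINT z|lebesgue. indicator K (z + t n *\<^sub>R e)) - (LINT z|lebesgue. (1 - indicator K z) * indicator K (z + t n *\<^sub>R e))"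
      by (rule Bochner_Integration.integral_diff[OF Kint Kint2])
    finally show ?thesis using lebesgue_integral_translate[OF Kb, of "t n *\<^sub>R e"] by simp
  qed
  ultimately show ?thesis by simp
qed

text \<open>
  Let \<open>K\<^sub>t = K \<inter> (K - t e)\<close>. Both \<open>K\<^sub>t\<close> and \<open>K\<^sub>t + t e\<close> lie in \<open>K\<close>, where \<open>u\<close> vanishes, so a cut-off
  \<open>\<psi>\<close> close to the indicator of \<open>K\<^sub>t\<close> makes the increment of \<open>s \<mapsto> \<integral> u(z) \<psi>(z - s e) dz\<close> over \<open>[0, t]\<close>
  as small as desired, in particular smaller than \<open>t\<^sup>2\<close>. Hence \<open>|\<integral> g(z) \<psi>(z - s e) dz| \<le> t\<close> for some
  \<open>s\<close> between 0 and \<open>t\<close>. As \<open>t \<rightarrow> 0\<close> these translated cut-offs converge to the indicator of \<open>K\<close> in the mean: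
  they vanish outside shrinking neighbourhoods of \<open>K\<close>, and their integrals converge to the measure of \<open>K\<close>.
\<close>

lemma weak_derivative_integral_zero:
  fixes e :: "'a::euclidean_space"
  assumes wd: "weak_directional_derivative e \<Omega> u g" and e: "e \<in> Basis"
    and "open \<Omega>" and K: "compact K" "K \<subseteq> \<Omega>" and u0: "\<And>z. z \<in> K \<Longrightarrow> u z = 0"
  shows "(LINT z|lebesgue. indicator K z * g z) = 0"
proof -
  obtain d where d: "0 < d" "(\<Union>x\<in>K. cball x d) \<subseteq> \<Omega>"
    using compact_subset_open_imp_cball_epsilon_subset[OF K(1) \<open>open \<Omega>\<close> K(2)] by blast
  define N where "N = (\<Union>x\<in>K. cball x d)"
  have N: "compact N" "N \<subseteq> \<Omega>"
    unfolding N_def using d compact_minkowski_sum_cball[OF K(1)] by auto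
  \<comment> \<open>The cut-offs reach at most \<open>t n\<close> beyond \<open>K\<close> and are moved by at most \<open>t n\<close>, so they stay in \<open>N\<close>.\<close>
  define t where "t n = d / (2 * real (Suc n))" for n
  have t: "0 < t n" "2 * t n \<le> d" for n using d(1) by (auto simp: t_def field_simps)
  have t0: "t \<longlonglongrightarrow> 0"
  proof -
    have "t = (\<lambda>n. d / 2 * inverse (real (Suc n)))"
      by (rule ext) (simp only: t_def divide_inverse inverse_mult_distrib mult.assoc)
    then show ?thesis using tendsto_mult_right_zero[OF LIMSEQ_inverse_real_of_nat, of "d / 2"] by simp
  qed
  have ne: "norm e = 1" using e by simp
  have U: "integrable lebesgue (\<lambda>z. indicator N z * u z)" and G: "integrable lebesgue (\<lambda>z. indicator N z * g z)"
    using wd N unfolding weak_directional_derivative_def locally_integrable_on_def set_integrable_def by auto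
  have Nint: "integrable lebesgue (indicator N :: 'a \<Rightarrow> real)"
    using N(1) by (intro lmeasurable_imp_integrable_indicator lmeasurable_compact)
  have Kint: "integrable lebesgue (indicator K :: 'a \<Rightarrow> real)"
    using K(1) by (intro lmeasurable_imp_integrable_indicator lmeasurable_compact)
  define Kt where "Kt n = K \<inter> {z. z + t n *\<^sub>R e \<in> K}" for n
  define good where "good n h \<longleftrightarrow> h \<in> borel_measurable lebesgue \<and> (\<forall>z. 0 \<le> h z \<and> h z \<le> 1)
      \<and> (\<forall>z. h z \<noteq> 0 \<longrightarrow> z \<in> N \<and> (\<exists>x\<in>K. dist x z \<le> 2 * t n))
      \<and> \<bar>LINT z|lebesgue. (indicator N z * g z) * h z\<bar> \<le> t n
      \<and> \<bar>(LINT z|lebesgue. h z) - (LINT z|lebesgue. indicator K z * indicator K (z + t n *\<^sub>R e))\<bar> \<le> t n" for n and h :: "'a \<Rightarrow> real"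
  have "\<exists>h. good n h" for n
  proof -
    have "closed {z. z + t n *\<^sub>R e \<in> K}"
      using closed_vimage[OF compact_imp_closed[OF K(1)], of "\<lambda>z. z + t n *\<^sub>R e"]
      by (simp add: vimage_def continuous_intros)
    then have Ktc: "compact (Kt n)" using K(1) by (simp add: Kt_def compact_Int_closed)
    obtain \<psi> :: "nat \<Rightarrow> 'a \<Rightarrow> real" where \<psi>: "\<And>k. \<psi> k \<in> smooth_class" "\<And>k z. 0 \<le> \<psi> k z" "\<And>k z. \<psi> k z \<le> 1"
      "\<And>k z. \<psi> k z \<noteq> 0 \<Longrightarrow> \<exists>x\<in>Kt n. dist x z < t n"
      "\<And>z. (\<lambda>k. \<psi> k z) \<longlonglongrightarrow> indicator (Kt n) z"
      using smooth_cutoff_sequence[OF Ktc t(1)] by blast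
    have near: "\<exists>x\<in>K. dist x z \<le> 2 * t n" if as: "0 \<le> s" "s \<le> t n" "\<psi> k (z - s *\<^sub>R e) \<noteq> 0" for k s z
    proof -
      obtain x where x: "x \<in> Kt n" "dist x (z - s *\<^sub>R e) < t n" using \<psi>(4)[OF as(3)] by blast
      have "dist x z \<le> dist x (z - s *\<^sub>R e) + dist (z - s *\<^sub>R e) z" by (rule dist_triangle)
      also have "dist (z - s *\<^sub>R e) z = s" using that(1) ne by (simp add: dist_norm)
      finally show ?thesis using x that(2) by (intro bexI[of _ x]) (auto simp: Kt_def)
    qed
    have inN: "z \<in> N" if "0 \<le> s" "s \<le> t n" "\<psi> k (z - s *\<^sub>R e) \<noteq> 0" for k s z
      using near[OF that] t(2)[of n] by (force simp: N_def)
    have c\<psi>: "continuous_on UNIV (\<psi> k)" for k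
      using C_k_continuous(1) \<psi>(1) smooth_class_iff by blast
    have b\<psi>: "\<psi> k \<in> borel_measurable borel" for k
      using c\<psi> by (rule borel_measurable_continuous_onI)
    have "(\<lambda>z. \<psi> k (z - a)) \<in> borel_measurable borel" for k a
      by (rule measurable_compose[OF _ b\<psi>]) measurable
    then have m\<psi>: "(\<lambda>z. \<psi> k (z - a)) \<in> borel_measurable lebesgue" for k a
      by (intro measurable_completion) simp
    have uK: "indicator N z * u z * indicator (Kt n) (z - a *\<^sub>R e) = 0" if "a = 0 \<or> a = t n" for z a
      using that u0 by (auto simp: Kt_def indicator_def)
    have lim_u: "(\<lambda>k. LINT z|lebesgue. (indicator N z * u z) * \<psi> k (z - a *\<^sub>R e)) \<longlonglongrightarrow> 0" if a: "a = 0 \<or> a = t n" for a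
    proof -
      have "(\<lambda>k. LINT z|lebesgue. (indicator N z * u z) * \<psi> k (z - a *\<^sub>R e)) \<longlonglongrightarrow> (LINT z|(lebesgue :: 'a measure). (0::real))"
      proof (rule integral_dominated_convergence[where w="\<lambda>z. \<bar>indicator N z * u z\<bar>"])
        show "AE z in lebesgue. (\<lambda>k. (indicator N z * u z) * \<psi> k (z - a *\<^sub>R e)) \<longlonglongrightarrow> 0"
          using tendsto_mult_left[OF \<psi>(5)] uK[OF a] by (intro AE_I2) metis
        show "AE z in lebesgue. norm ((indicator N z * u z) * \<psi> k (z - a *\<^sub>R e)) \<le> \<bar>indicator N z * u z\<bar>" for k
          using \<psi>(2,3) by (auto simp: abs_mult intro!: mult_left_le)
        show "(\<lambda>z. (indicator N z * u z) * \<psi> k (z - a *\<^sub>R e)) \<in> borel_measurable lebesgue" for k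
          using U m\<psi>[of k "a *\<^sub>R e"] by measurable
      qed (use U in auto)
      then show ?thesis by simp
    qed
    have "(\<lambda>k. LINT z|lebesgue. \<psi> k z) \<longlonglongrightarrow> (LINT z|lebesgue. indicator (Kt n) z)"
    proof (rule integral_dominated_convergence[OF _ _ Nint])
      show "AE z in lebesgue. norm (\<psi> k z) \<le> indicator N z" for k
      proof (rule AE_I2)
        fix z
        show "norm (\<psi> k z) \<le> indicator N z"
          using inN[of 0 k z] \<psi>(2,3)[of k z] t(1)[of n] by (cases "\<psi> k z = 0") auto
      qed
      show "indicat_real (Kt n) \<in> borel_measurable lebesgue"
        using Ktc lmeasurable_compact by (intro borel_measurable_indicator fmeasurableD)
    qed (use m\<psi>[of _ 0] \<psi>(5) in auto)
    then have lim_m: "(\<lambda>k. (LINT z|lebesgue. \<psi> k z) - (LINT z|lebesgue. indicator (Kt n) z)) \<longlonglongrightarrow> 0"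
      by (rule LIM_zero)
    have "(\<lambda>k. (LINT z|lebesgue. (indicator N z * u z) * \<psi> k (z - t n *\<^sub>R e))
         - (LINT z|lebesgue. (indicator N z * u z) * \<psi> k (z - 0 *\<^sub>R e))) \<longlonglongrightarrow> 0 - 0"
      by (intro tendsto_diff lim_u) auto
    then have "\<forall>\<^sub>F k in sequentially. \<bar>(LINT z|lebesgue. (indicator N z * u z) * \<psi> k (z - t n *\<^sub>R e))
         - (LINT z|lebesgue. (indicator N z * u z) * \<psi> k z)\<bar> < t n * t n"
      using t(1)[of n] by (auto dest!: tendstoD[where e="t n * t n"] simp: dist_real_def)
    moreover have "\<forall>\<^sub>F k in sequentially. \<bar>(LINT z|lebesgue. \<psi> k z) - (LINT z|lebesgue. indicator (Kt n) z)\<bar> < t n"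
      using tendstoD[OF lim_m t(1)[of n]] by (simp add: dist_real_def)
    ultimately obtain k where k:
      "\<bar>(LINT z|lebesgue. (indicator N z * u z) * \<psi> k (z - t n *\<^sub>R e))
         - (LINT z|lebesgue. (indicator N z * u z) * \<psi> k z)\<bar> < t n * t n"
      "\<bar>(LINT z|lebesgue. \<psi> k z) - (LINT z|lebesgue. indicator (Kt n) z)\<bar> < t n"
      using eventually_happens[OF eventually_conj] by fastforce
    obtain s where s: "0 < s" "s < t n"
      "(LINT z|lebesgue. (indicator N z * u z) * \<psi> k (z - t n *\<^sub>R e)) - (LINT z|lebesgue. (indicator N z * u z) * \<psi> k z)
       = t n * (LINT z|lebesgue. (indicator N z * g z) * \<psi> k (z - s *\<^sub>R e))"
      by (rule weak_derivative_translated_cutoff[OF wd e N \<psi>(1)[of k] _ t(1)[of n]]) (use inN[of _ k] in blast)+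
    show ?thesis
      unfolding good_def
    proof (intro exI[of _ "\<lambda>z. \<psi> k (z - s *\<^sub>R e)"] conjI allI impI)
      show "(\<lambda>z. \<psi> k (z - s *\<^sub>R e)) \<in> borel_measurable lebesgue" by (rule m\<psi>)
      show "z \<in> N" "\<exists>x\<in>K. dist x z \<le> 2 * t n" if "\<psi> k (z - s *\<^sub>R e) \<noteq> 0" for z
        using inN[OF _ _ that] near[OF _ _ that] s by auto
      have "t n * \<bar>LINT z|lebesgue. (indicator N z * g z) * \<psi> k (z - s *\<^sub>R e)\<bar> \<le> t n * t n"
        using k(1) s(3) t(1)[of n] by (simp add: abs_mult)
      then show "\<bar>LINT z|lebesgue. (indicator N z * g z) * \<psi> k (z - s *\<^sub>R e)\<bar> \<le> t n"
        using t(1)[of n] by simp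
      have "(LINT z|lebesgue. \<psi> k (z - s *\<^sub>R e)) = (LINT z|lebesgue. \<psi> k z)"
        using lebesgue_integral_translate[OF b\<psi>, of k "- s *\<^sub>R e"] by simp
      moreover have "(LINT z|lebesgue. indicator (Kt n) z :: real)
          = (LINT z|lebesgue. indicator K z * indicator K (z + t n *\<^sub>R e))"
        by (rule Bochner_Integration.integral_cong) (auto simp: Kt_def indicator_def)
      ultimately show "\<bar>(LINT z|lebesgue. \<psi> k (z - s *\<^sub>R e))
          - (LINT z|lebesgue. indicator K z * indicator K (z + t n *\<^sub>R e))\<bar> \<le> t n"
        using k(2) by simp
    qed (use \<psi>(2,3) in auto)
  qed
  then obtain h where "\<And>n. good n (h n)" by metis
  then have h: "\<And>n. h n \<in> borel_measurable lebesgue"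
    "\<And>n z. 0 \<le> h n z" "\<And>n z. h n z \<le> 1" "\<And>n z. h n z \<noteq> 0 \<Longrightarrow> z \<in> N"
    "\<And>n z. h n z \<noteq> 0 \<Longrightarrow> \<exists>x\<in>K. dist x z \<le> 2 * t n"
    "\<And>n. \<bar>LINT z|lebesgue. (indicator N z * g z) * h n z\<bar> \<le> t n"
    "\<And>n. \<bar>(LINT z|lebesgue. h n z) - (LINT z|lebesgue. indicator K z * indicator K (z + t n *\<^sub>R e))\<bar> \<le> t n"
    unfolding good_def by blast+
  have hN: "h n z \<le> indicator N z" for n z
    using h(3)[of n z] h(4)[of n z] by (cases "h n z = 0") auto
  have hint: "integrable lebesgue (h n)" for n
    by (rule Bochner_Integration.integrable_bound[OF Nint h(1)]) (use hN h(2) in auto)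
  have hout: "(\<lambda>n. h n z) \<longlonglongrightarrow> 0" if "z \<notin> K" for z
  proof -
    have "open (- K)" using K(1) compact_imp_closed by blast
    then obtain r where r: "0 < r" "ball z r \<subseteq> - K"
      using \<open>z \<notin> K\<close> by (auto simp: open_contains_ball)
    have "(\<lambda>n. 2 * t n) \<longlonglongrightarrow> 0" using tendsto_mult_right_zero[OF t0] by simp
    then have "\<forall>\<^sub>F n in sequentially. 2 * t n < r" using r(1) by (rule order_tendstoD)
    then have "\<forall>\<^sub>F n in sequentially. h n z = 0"
    proof eventually_elim
      case (elim n)
      show ?case
      proof (rule ccontr)
        assume "h n z \<noteq> 0"
        then obtain x where "x \<in> K" "dist x z \<le> 2 * t n" using h(5) by blast
        then show False using subsetD[OF r(2), of x] elim by (simp add: dist_commute)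
      qed
    qed
    then show ?thesis by (rule tendsto_eventually)
  qed
  have Km: "(indicator K :: 'a \<Rightarrow> real) \<in> borel_measurable lebesgue" using Kint by auto
  have off_m: "(\<lambda>z. (1 - indicator K z) * h n z) \<in> borel_measurable lebesgue" for n
    using Km h(1)[of n] by measurable
  have off_int: "integrable lebesgue (\<lambda>z. (1 - indicator K z) * h n z)" for n
    by (rule Bochner_Integration.integrable_bound[OF hint off_m]) (auto simp: indicator_def)
  have "(\<lambda>n. LINT z|lebesgue. (1 - indicator K z) * h n z) \<longlonglongrightarrow> (LINT z|(lebesgue :: 'a measure). (0::real))"
  proof (rule integral_dominated_convergence[OF _ off_m Nint])
    show "AE z in lebesgue. (\<lambda>n. (1 - indicator K z) * h n z) \<longlonglongrightarrow> 0"
      using hout by (intro AE_I2) (auto simp: indicator_def)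
    show "AE z in lebesgue. norm ((1 - indicator K z) * h n z) \<le> indicator N z" for n
      using hN h(2) by (intro AE_I2) (auto simp: indicator_def[of K])
  qed auto
  then have off: "(\<lambda>n. LINT z|lebesgue. (1 - indicator K z) * h n z) \<longlonglongrightarrow> 0" by simp
  have "(\<lambda>n. (LINT z|lebesgue. h n z) - (LINT z|lebesgue. indicator K z * indicator K (z + t n *\<^sub>R e))) \<longlonglongrightarrow> 0"
    by (rule Lim_null_comparison[OF always_eventually t0]) (use h(7) in auto)
  from tendsto_add[OF this measure_compact_Int_translate[OF K(1) t0, of e]]
  have mass: "(\<lambda>n. LINT z|lebesgue. h n z) \<longlonglongrightarrow> (LINT z|lebesgue. indicator K z)" by simp
  \<comment> \<open>Since \<open>0 \<le> h n \<le> 1\<close>, the deviation is \<open>h n\<close> off \<open>K\<close> and \<open>1 - h n\<close> on \<open>K\<close>.\<close>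
  have split: "(LINT z|lebesgue. norm (h n z - indicator K z))
     = 2 * (LINT z|lebesgue. (1 - indicator K z) * h n z) + ((LINT z|lebesgue. indicator K z) - (LINT z|lebesgue. h n z))" for n
  proof -
    have "(LINT z|lebesgue. norm (h n z - indicator K z))
      = (LINT z|lebesgue. 2 * ((1 - indicator K z) * h n z) + (indicator K z - h n z))"
      by (rule Bochner_Integration.integral_cong) (use h(2,3) in \<open>auto simp: indicator_def\<close>)
    then show ?thesis using off_int hint Kint by simp
  qed
  have "(\<lambda>n. LINT z|lebesgue. norm (h n z - indicator K z)) \<longlonglongrightarrow>
      2 * 0 + ((LINT z|lebesgue. indicator K z) - (LINT z|lebesgue. indicator K z))"
    unfolding split by (intro tendsto_intros off mass)
  then have "(\<lambda>n. LINT z|lebesgue. norm (h n z - indicator K z)) \<longlonglongrightarrow> 0" by simp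
  from tendsto_L1_AE_subseq[OF Bochner_Integration.integrable_diff[OF hint Kint] this]
  obtain r where r: "strict_mono r" "AE z in lebesgue. (\<lambda>n. h (r n) z - indicator K z) \<longlonglongrightarrow> 0" by blast
  have "(\<lambda>n. LINT z|lebesgue. (indicator N z * g z) * h (r n) z) \<longlonglongrightarrow> (LINT z|lebesgue. (indicator N z * g z) * indicator K z)"
  proof (rule integral_dominated_convergence[where w="\<lambda>z. \<bar>indicator N z * g z\<bar>"])
    show "AE z in lebesgue. (\<lambda>n. (indicator N z * g z) * h (r n) z) \<longlonglongrightarrow> (indicator N z * g z) * indicator K z"
      using r(2) by eventually_elim (intro tendsto_intros, auto dest: LIM_zero_cancel)
    show "AE z in lebesgue. norm ((indicator N z * g z) * h (r n) z) \<le> \<bar>indicator N z * g z\<bar>" for n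
      using h(2,3) by (auto simp: abs_mult intro!: mult_left_le)
    show "(\<lambda>z. (indicator N z * g z) * h (r n) z) \<in> borel_measurable lebesgue" for n
      using G h(1)[of "r n"] by measurable
  qed (use G Km in auto)
  moreover have "(\<lambda>n. LINT z|lebesgue. (indicator N z * g z) * h (r n) z) \<longlonglongrightarrow> 0"
    using LIMSEQ_subseq_LIMSEQ[OF Lim_null_comparison[OF always_eventually t0, of "\<lambda>n. LINT z|lebesgue. (indicator N z * g z) * h n z"] r(1)]
      h(6) by (auto simp: o_def)
  ultimately have "(LINT z|lebesgue. (indicator N z * g z) * indicator K z) = 0"
    by (rule LIMSEQ_unique)
  moreover have "K \<subseteq> N" using d(1) by (force simp: N_def)
  then have "(LINT z|lebesgue. (indicator N z * g z) * indicator K z) = (LINT z|lebesgue. indicator K z * g z)"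
    by (intro Bochner_Integration.integral_cong) (auto simp: indicator_def)
  ultimately show ?thesis by simp
qed

lemma locally_integrable_measurable:
  fixes u :: "'a::euclidean_space \<Rightarrow> 'b::euclidean_space"
  assumes "locally_integrable_on \<Omega> u" "open \<Omega>"
  shows "(\<lambda>z. indicator \<Omega> z *\<^sub>R u z) \<in> borel_measurable lebesgue"
proof -
  obtain C where C: "\<And>n. compact (C n)" "\<And>n. C n \<subseteq> \<Omega>" "\<Union> (range C) = \<Omega>" "\<And>n::nat. C n \<subseteq> C (Suc n)"
    using open_Union_compact_subsets[OF assms(2)] by (metis interior_subset subset_trans)
  have "(\<lambda>z. indicator (C n) z *\<^sub>R u z) \<in> borel_measurable lebesgue" for n
    using assms(1) C(1,2)[of n] borel_measurable_integrable
    unfolding locally_integrable_on_def set_integrable_def by fast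
  then show ?thesis
  proof (rule borel_measurable_LIMSEQ_metric)
    fix z
    show "(\<lambda>n. indicator (C n) z *\<^sub>R u z) \<longlonglongrightarrow> indicator \<Omega> z *\<^sub>R u z"
      using LIMSEQ_indicator_incseq[of C z] C(3,4)
      by (intro tendsto_intros) (auto simp: incseq_SucI)
  qed
qed

text \<open>
  On a compact subset of \<open>{u = 0, g > 0}\<close> the integral of the positive function \<open>g\<close> is zero, so the
  subset is null; inner regularity extends this to the whole set. The same holds for \<open>{u = 0, g < 0}\<close>.
\<close>

proposition weak_derivative_zero_on_zero_set:
  fixes e :: "'a::euclidean_space"
  assumes wd: "weak_directional_derivative e \<Omega> u g" and e: "e \<in> Basis"
    and \<Omega>: "open \<Omega>" and E: "E \<in> sets lebesgue" "E \<subseteq> \<Omega>" and u0: "AE z in lebesgue. z \<in> E \<longrightarrow> u z = 0"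
  shows "AE z in lebesgue. z \<in> E \<longrightarrow> g z = 0"
proof -
  have um: "(\<lambda>z. indicator \<Omega> z *\<^sub>R u z) \<in> borel_measurable lebesgue"
    and gm: "(\<lambda>z. indicator \<Omega> z *\<^sub>R g z) \<in> borel_measurable lebesgue"
    using wd \<Omega> locally_integrable_measurable unfolding weak_directional_derivative_def by blast+
  define S where "S \<sigma> = {z \<in> E. indicator \<Omega> z *\<^sub>R u z = 0 \<and> 0 < \<sigma> * (indicator \<Omega> z *\<^sub>R g z)}" for \<sigma> :: real
  have null: "S \<sigma> \<in> null_sets lebesgue" for \<sigma>
  proof (rule null_set_of_compact_null)
    have "{z \<in> space lebesgue. z \<in> E \<and> indicator \<Omega> z *\<^sub>R u z = 0 \<and> 0 < \<sigma> * (indicator \<Omega> z *\<^sub>R g z)} \<in> sets lebesgue"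
      using E(1) um gm by measurable
    then show "S \<sigma> \<in> sets lebesgue" by (simp add: S_def)
    fix K assume K: "compact K" "K \<subseteq> S \<sigma>"
    have K\<Omega>: "K \<subseteq> \<Omega>" using K(2) E(2) by (auto simp: S_def)
    have "(LINT z|lebesgue. indicator K z * g z) = 0"
      by (rule weak_derivative_integral_zero[OF wd e \<Omega> K(1) K\<Omega>])
        (use K K\<Omega> in \<open>auto simp: S_def indicator_def split: if_splits\<close>)
    then have 0: "(LINT z|lebesgue. \<sigma> * (indicator K z * g z)) = 0" by simp
    have gK: "integrable lebesgue (\<lambda>z. indicator K z * g z)"
      using wd K(1) K\<Omega> unfolding weak_directional_derivative_def locally_integrable_on_def set_integrable_def by auto
    have pos: "0 < \<sigma> * g z" if "z \<in> K" for z
      using subsetD[OF K(2) that] subsetD[OF K\<Omega> that] by (simp add: S_def)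
    have "AE z in lebesgue. \<sigma> * (indicator K z * g z) = 0"
      by (subst integral_nonneg_eq_0_iff_AE[symmetric])
        (use gK 0 pos in \<open>auto simp: indicator_def less_imp_le\<close>)
    then have "AE z in lebesgue. z \<notin> K"
      by eventually_elim (use pos in \<open>fastforce simp: indicator_def\<close>)
    then show "emeasure lebesgue K = 0"
      using K(1) AE_iff_null_sets[of K lebesgue] lmeasurable_compact[of K]
      by (auto simp: fmeasurableD null_sets_def)
  qed
  have "AE z in lebesgue. z \<notin> S 1" "AE z in lebesgue. z \<notin> S (-1)"
    using null AE_not_in by blast+
  with u0 show ?thesis
    by eventually_elim (use E(2) in \<open>force simp: S_def\<close>)
qed

section \<open>Uniqueness of weak Grushin gradients\<close>

lemma continuous_grushin_weight: "0 \<le> \<gamma> \<Longrightarrow> continuous_on UNIV (grushin_weight \<gamma>)"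
  unfolding grushin_weight_def[abs_def]
proof (cases "\<gamma> = 0")
  case False
  assume "0 \<le> \<gamma>"
  with False have "continuous_on UNIV (\<lambda>z. norm (fst z) powr \<gamma>)"
    by (intro continuous_on_powr' continuous_on_norm continuous_on_fst continuous_on_id continuous_on_const) auto
  with False show "continuous_on UNIV (\<lambda>z. if \<gamma> = 0 then 1 else norm (fst z) powr \<gamma>)" by simp
qed simp

lemma grushin_weight_shift_y: "grushin_weight \<gamma> (z + t *\<^sub>R (0, v)) = grushin_weight \<gamma> z"
  by (simp add: grushin_weight_def)

lemma coordinate_directions_Basis [simp]:
  "(axis i 1, 0) \<in> (Basis :: ((real^'m) \<times> (real^'k)) set)"
  "(0, axis j 1) \<in> (Basis :: ((real^'m) \<times> (real^'k)) set)"
  by (auto simp: Basis_prod_def axis_in_Basis_iff)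

lemma locally_integrable_test_mult:
  fixes u :: "'a::euclidean_space \<Rightarrow> 'b::euclidean_space" and \<psi> :: "'a \<Rightarrow> real"
  assumes "locally_integrable_on \<Omega> u" and K: "compact K" "K \<subseteq> \<Omega>" "\<And>z. z \<notin> K \<Longrightarrow> \<psi> z = 0"
    and cont: "continuous_on UNIV \<psi>"
  shows "set_integrable lebesgue \<Omega> (\<lambda>z. \<psi> z *\<^sub>R u z)"
proof -
  have "integrable lebesgue (\<lambda>z. indicator K z *\<^sub>R u z)"
    using assms unfolding locally_integrable_on_def set_integrable_def by blast
  obtain B where B: "\<And>z. norm (\<psi> z) \<le> B" "0 \<le> B" using bounded_of_compact_support[OF cont K(1,3)] by metis
  have "integrable lebesgue (\<lambda>z. \<psi> z *\<^sub>R (indicator K z *\<^sub>R u z))"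
  proof (rule Bochner_Integration.integrable_bound[where f="\<lambda>z. B *\<^sub>R (indicator K z *\<^sub>R u z)"])
    show "AE z in lebesgue. norm (\<psi> z *\<^sub>R (indicator K z *\<^sub>R u z)) \<le> norm (B *\<^sub>R (indicator K z *\<^sub>R u z))"
    proof (rule AE_I2)
      have "norm (a *\<^sub>R x) \<le> norm (B *\<^sub>R x)" if "norm a \<le> B" for a and x :: 'b
        using that B(2) by (simp add: mult_right_mono)
      then show "norm (\<psi> z *\<^sub>R (indicator K z *\<^sub>R u z)) \<le> norm (B *\<^sub>R (indicator K z *\<^sub>R u z))" for z
        using B(1) by blast
    qed
    show "integrable lebesgue (\<lambda>z. B *\<^sub>R (indicator K z *\<^sub>R u z))" by (rule integrable_scaleR_right) (rule \<open>integrable lebesgue (\<lambda>z. indicator K z *\<^sub>R u z)\<close>)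
    show "(\<lambda>z. \<psi> z *\<^sub>R (indicator K z *\<^sub>R u z)) \<in> borel_measurable lebesgue"
      using continuous_lebesgue_measurable[OF cont] borel_measurable_integrable[OF \<open>integrable lebesgue (\<lambda>z. indicator K z *\<^sub>R u z)\<close>]
      by (rule borel_measurable_scaleR)
  qed
  moreover have "\<psi> z *\<^sub>R (indicator K z *\<^sub>R u z) = indicator \<Omega> z *\<^sub>R \<psi> z *\<^sub>R u z" for z
    using K(2,3) by (auto simp: indicator_def)
  ultimately show ?thesis by (simp only: set_integrable_def)
qed

lemma test_function_facts:
  fixes \<psi> :: "'a::euclidean_space \<Rightarrow> 'b::euclidean_space"
  assumes "\<psi> \<in> C0_infinity \<Omega>"
  obtains K where "compact K" "K \<subseteq> \<Omega>" "\<And>z. z \<notin> K \<Longrightarrow> \<psi> z = 0" "\<And>e z. z \<notin> K \<Longrightarrow> partial_deriv e \<psi> z = 0"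
    "continuous_on UNIV \<psi>" "\<And>e. e \<in> Basis \<Longrightarrow> continuous_on UNIV (partial_deriv e \<psi>)" "\<And>z. \<psi> differentiable (at z)"
proof -
  obtain K where K: "compact K" "K \<subseteq> \<Omega>" "\<And>z. z \<notin> K \<Longrightarrow> \<psi> z = 0" "\<And>n. C_k n \<psi>"
    using C0_infinityE[OF assms] by blast
  note c = C_k_continuous[OF K(4)]
  have "partial_deriv e \<psi> z = 0" if "z \<notin> K" for e z
    using partial_deriv_zero_outside[OF c(3) compact_imp_closed[OF K(1)]] K(3) that by blast
  then show ?thesis using that[OF K(1-3) _ c] by blast
qed

lemma set_integral_inner_left:
  "set_integrable M A f \<Longrightarrow> (LINT z:A|M. f z \<bullet> b) = (LINT z:A|M. f z) \<bullet> b"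
  unfolding set_lebesgue_integral_def set_integrable_def
  by (subst integral_inner_left[symmetric]) auto

lemma locally_integrable_bounded_linear:
  "bounded_linear L \<Longrightarrow> locally_integrable_on \<Omega> u \<Longrightarrow> locally_integrable_on \<Omega> (\<lambda>z. L (u z))"
  unfolding locally_integrable_on_def set_integrable_def
  using integrable_bounded_linear[of L lebesgue "\<lambda>z. indicator _ z *\<^sub>R u z"]
  by (simp add: linear_scale[OF bounded_linear.linear])

lemma locally_integrable_continuous_mult:
  assumes a: "continuous_on UNIV (a :: 'a::euclidean_space \<Rightarrow> real)" and u: "locally_integrable_on \<Omega> u"
  shows "locally_integrable_on \<Omega> (\<lambda>z. a z * u z)"
  unfolding locally_integrable_on_def
proof (intro allI impI)
  fix K assume K: "compact K \<and> K \<subseteq> \<Omega>"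
  then have uK: "integrable lebesgue (\<lambda>z. indicator K z * u z)"
    using u by (auto simp: locally_integrable_on_def set_integrable_def)
  have "bounded (a ` K)"
    using K a by (intro compact_imp_bounded compact_continuous_image) (auto intro: continuous_on_subset)
  then obtain B where B: "\<forall>z\<in>K. norm (a z) \<le> B" by (auto simp: bounded_iff)
  have "integrable lebesgue (\<lambda>z. a z * (indicator K z * u z))"
  proof (rule Bochner_Integration.integrable_bound[where f="\<lambda>z. B * (indicator K z * u z)"])
    show "AE z in lebesgue. norm (a z * (indicator K z * u z)) \<le> norm (B * (indicator K z * u z))"
    proof (rule AE_I2)
      fix z
      show "norm (a z * (indicator K z * u z)) \<le> norm (B * (indicator K z * u z))"
        using bspec[OF B, of z] mult_right_mono[of "\<bar>a z\<bar>" "\<bar>B\<bar>" "\<bar>u z\<bar>"]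
        by (cases "z \<in> K") (auto simp: abs_mult)
    qed
    show "(\<lambda>z. a z * (indicator K z * u z)) \<in> borel_measurable lebesgue"
      using continuous_lebesgue_measurable[OF a] borel_measurable_integrable[OF uK]
      by (rule borel_measurable_times)
  qed (use uK in auto)
  then show "set_integrable lebesgue K (\<lambda>z. a z * u z)"
    by (simp add: set_integrable_def mult.left_commute)
qed

text \<open>
  The weight is constant along the \<open>y\<close>-directions, so the weighted weak derivative of \<open>u\<close> is an unweighted
  weak derivative of \<open>|x|\<^sup>\<gamma> u\<close>.
\<close>

lemma weak_grushin_grad_directional:
  fixes u :: "(real^'m) \<times> (real^'k) \<Rightarrow> 'b::euclidean_space"
  assumes "weak_grushin_grad \<gamma> \<Omega> u G" and \<gamma>: "0 \<le> \<gamma>"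
  shows "weak_directional_derivative (axis i 1, 0) \<Omega> (\<lambda>z. u z \<bullet> b) (\<lambda>z. fst (G z) $ i \<bullet> b)"
    and "weak_directional_derivative (0, axis j 1) \<Omega> (\<lambda>z. grushin_weight \<gamma> z * (u z \<bullet> b)) (\<lambda>z. snd (G z) $ j \<bullet> b)"
proof -
  have u: "locally_integrable_on \<Omega> u" and G: "locally_integrable_on \<Omega> G"
    using assms by (auto simp: weak_grushin_grad_def)
  have Gi: "locally_integrable_on \<Omega> (\<lambda>z. fst (G z) $ i)" and Gj: "locally_integrable_on \<Omega> (\<lambda>z. snd (G z) $ j)"
    by (intro locally_integrable_bounded_linear[OF _ G, of "\<lambda>x. fst x $ i"]
        locally_integrable_bounded_linear[OF _ G, of "\<lambda>x. snd x $ j"]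
        bounded_linear_compose[OF bounded_linear_vec_nth] bounded_linear_fst bounded_linear_snd)+
  note lin = locally_integrable_bounded_linear[OF bounded_linear_inner_left]
  have id: "(LINT z:\<Omega>|lebesgue. grushin_X i \<psi> z * (u z \<bullet> b)) = - (LINT z:\<Omega>|lebesgue. \<psi> z * (fst (G z) $ i \<bullet> b))"
    "(LINT z:\<Omega>|lebesgue. grushin_Y \<gamma> j \<psi> z * (u z \<bullet> b)) = - (LINT z:\<Omega>|lebesgue. \<psi> z * (snd (G z) $ j \<bullet> b))"
    if \<psi>: "\<psi> \<in> C0_infinity \<Omega>" for \<psi> :: "(real^'m) \<times> (real^'k) \<Rightarrow> real"
  proof -
    obtain K where K: "compact K" "K \<subseteq> \<Omega>" "\<And>z. z \<notin> K \<Longrightarrow> \<psi> z = 0" "\<And>e z. z \<notin> K \<Longrightarrow> partial_deriv e \<psi> z = 0"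
      "continuous_on UNIV \<psi>" "\<And>e. e \<in> Basis \<Longrightarrow> continuous_on UNIV (partial_deriv e \<psi>)"
      "\<And>z. \<psi> differentiable (at z)"
      by (rule test_function_facts[OF \<psi>]) (rule that)
    have cX: "continuous_on UNIV (grushin_X i \<psi>)"
      using K(6) by (simp add: grushin_X_def[abs_def])
    have cY: "continuous_on UNIV (grushin_Y \<gamma> j \<psi>)"
      unfolding grushin_Y_def[abs_def] using K(6) continuous_grushin_weight[OF \<gamma>] by (intro continuous_intros) auto
    have 1: "set_integrable lebesgue \<Omega> (\<lambda>z. grushin_X i \<psi> z *\<^sub>R u z)"
      by (rule locally_integrable_test_mult[OF u K(1,2) _ cX]) (simp add: grushin_X_def K(4))
    have 2: "set_integrable lebesgue \<Omega> (\<lambda>z. grushin_Y \<gamma> j \<psi> z *\<^sub>R u z)"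
      by (rule locally_integrable_test_mult[OF u K(1,2) _ cY]) (simp add: grushin_Y_def K(4))
    have 3: "set_integrable lebesgue \<Omega> (\<lambda>z. \<psi> z *\<^sub>R (fst (G z) $ i))" "set_integrable lebesgue \<Omega> (\<lambda>z. \<psi> z *\<^sub>R (snd (G z) $ j))"
      by (rule locally_integrable_test_mult[OF _ K(1,2) K(3) K(5)], rule Gi Gj, simp)+
    show "(LINT z:\<Omega>|lebesgue. grushin_X i \<psi> z * (u z \<bullet> b)) = - (LINT z:\<Omega>|lebesgue. \<psi> z * (fst (G z) $ i \<bullet> b))"
      using set_integral_inner_left[OF 1, of b] set_integral_inner_left[OF 3(1), of b] assms \<psi>
      by (simp add: weak_grushin_grad_def)
    show "(LINT z:\<Omega>|lebesgue. grushin_Y \<gamma> j \<psi> z * (u z \<bullet> b)) = - (LINT z:\<Omega>|lebesgue. \<psi> z * (snd (G z) $ j \<bullet> b))"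
      using set_integral_inner_left[OF 2, of b] set_integral_inner_left[OF 3(2), of b] assms \<psi>
      by (simp add: weak_grushin_grad_def)
  qed
  show "weak_directional_derivative (axis i 1, 0) \<Omega> (\<lambda>z. u z \<bullet> b) (\<lambda>z. fst (G z) $ i \<bullet> b)"
    unfolding weak_directional_derivative_def
    using id(1) lin[OF u, of b] lin[OF Gi, of b] by (simp add: grushin_X_def)
  show "weak_directional_derivative (0, axis j 1) \<Omega> (\<lambda>z. grushin_weight \<gamma> z * (u z \<bullet> b)) (\<lambda>z. snd (G z) $ j \<bullet> b)"
    unfolding weak_directional_derivative_def
    using id(2) locally_integrable_continuous_mult[OF continuous_grushin_weight[OF \<gamma>] lin[OF u, of b]] lin[OF Gj, of b]
    by (simp add: grushin_Y_def mult.assoc mult.left_commute)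
qed

lemma weak_directional_derivative_diff:
  assumes u: "weak_directional_derivative e \<Omega> u g" and v: "weak_directional_derivative e \<Omega> v h" and e: "e \<in> Basis"
  shows "weak_directional_derivative e \<Omega> (\<lambda>z. u z - v z) (\<lambda>z. g z - h z)"
proof -
  have loc: "locally_integrable_on \<Omega> (\<lambda>z. f z - f' z)" if "locally_integrable_on \<Omega> f" "locally_integrable_on \<Omega> f'" for f f' :: "'a \<Rightarrow> real"
    using that set_integral_diff(1) unfolding locally_integrable_on_def by blast
  have "(LINT z:\<Omega>|lebesgue. partial_deriv e \<psi> z * (u z - v z)) = - (LINT z:\<Omega>|lebesgue. \<psi> z * (g z - h z))"
    if \<psi>: "\<psi> \<in> C0_infinity \<Omega>" for \<psi> :: "'a \<Rightarrow> real"
  proof -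
    obtain K where K: "compact K" "K \<subseteq> \<Omega>" "\<And>z. z \<notin> K \<Longrightarrow> \<psi> z = 0" "\<And>e z. z \<notin> K \<Longrightarrow> partial_deriv e \<psi> z = 0"
      "continuous_on UNIV \<psi>" "\<And>e. e \<in> Basis \<Longrightarrow> continuous_on UNIV (partial_deriv e \<psi>)"
      "\<And>z. \<psi> differentiable (at z)"
      by (rule test_function_facts[OF \<psi>]) (rule that)
    have d: "set_integrable lebesgue \<Omega> (\<lambda>z. partial_deriv e \<psi> z * f z)" and p: "set_integrable lebesgue \<Omega> (\<lambda>z. \<psi> z * f z)"
      if "locally_integrable_on \<Omega> f" for f :: "'a \<Rightarrow> real"
      using locally_integrable_test_mult[OF that K(1,2) _ K(6)[OF e]] K(4)
        locally_integrable_test_mult[OF that K(1,2,3,5)] by auto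
    show ?thesis
      using u v \<psi> d p unfolding weak_directional_derivative_def by (simp add: right_diff_distrib set_integral_diff)
  qed
  then show ?thesis using u v loc unfolding weak_directional_derivative_def by blast
qed

text \<open>
  The difference of the two functions vanishes on \<open>E\<close>; the vanishing of weak derivatives on zero sets applies to each of
  its real components in each coordinate direction, for the \<open>y\<close>-directions after multiplication by the weight.
\<close>

proposition weak_grushin_grad_agree:
  fixes u v :: "(real^'m) \<times> (real^'k) \<Rightarrow> 'b::euclidean_space"
  assumes u: "weak_grushin_grad \<gamma> \<Omega> u G" and v: "weak_grushin_grad \<gamma> \<Omega> v H"
    and "0 \<le> \<gamma>" "open \<Omega>" and E: "E \<in> sets lebesgue" "E \<subseteq> \<Omega>"
    and eq: "AE z in lebesgue. z \<in> E \<longrightarrow> u z = v z"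
  shows "AE z in lebesgue. z \<in> E \<longrightarrow> G z = H z"
proof -
  have X: "AE z in lebesgue. \<forall>i. \<forall>b\<in>Basis. z \<in> E \<longrightarrow> fst (G z) $ i \<bullet> b - fst (H z) $ i \<bullet> b = 0"
  proof (intro AE_all_countable[THEN iffD2] AE_ball_countable[THEN iffD2] allI ballI countable_finite finite_Basis)
    fix i and b :: 'b
    show "AE z in lebesgue. z \<in> E \<longrightarrow> fst (G z) $ i \<bullet> b - fst (H z) $ i \<bullet> b = 0"
      by (rule weak_derivative_zero_on_zero_set[OF weak_directional_derivative_diff[OF
            weak_grushin_grad_directional(1)[OF u \<open>0 \<le> \<gamma>\<close>] weak_grushin_grad_directional(1)[OF v \<open>0 \<le> \<gamma>\<close>]] _ \<open>open \<Omega>\<close> E])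
        (use eq in auto)
  qed
  have Y: "AE z in lebesgue. \<forall>j. \<forall>b\<in>Basis. z \<in> E \<longrightarrow> snd (G z) $ j \<bullet> b - snd (H z) $ j \<bullet> b = 0"
  proof (intro AE_all_countable[THEN iffD2] AE_ball_countable[THEN iffD2] allI ballI countable_finite finite_Basis)
    fix j and b :: 'b
    show "AE z in lebesgue. z \<in> E \<longrightarrow> snd (G z) $ j \<bullet> b - snd (H z) $ j \<bullet> b = 0"
      by (rule weak_derivative_zero_on_zero_set[OF weak_directional_derivative_diff[OF
            weak_grushin_grad_directional(2)[OF u \<open>0 \<le> \<gamma>\<close>] weak_grushin_grad_directional(2)[OF v \<open>0 \<le> \<gamma>\<close>]] _ \<open>open \<Omega>\<close> E])
        (use eq in auto)
  qed
  from X Y show ?thesis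
    by eventually_elim (auto simp: prod_eq_iff vec_eq_iff euclidean_eq_iff[where 'a='b])
qed

text \<open>
  The pieces \<open>A n \<inter> B k\<close> of two localizations cover \<open>\<Omega>\<close> up to a null set, and on each of them
  two weakly differentiable functions agree.
\<close>

lemma has_grushin_grad_unique:
  fixes u :: "(real^'m) \<times> (real^'k) \<Rightarrow> 'b::euclidean_space"
  assumes G: "has_grushin_grad \<gamma> \<Omega> u G" and H: "has_grushin_grad \<gamma> \<Omega> u H"
    and "0 \<le> \<gamma>" "open \<Omega>"
  shows "AE z in lebesgue. z \<in> \<Omega> \<longrightarrow> G z = H z"
proof -
  obtain A v V where "\<forall>n. A n \<in> sets lebesgue \<and> A n \<subseteq> \<Omega>" and A: "AE z in lebesgue. z \<in> \<Omega> \<longrightarrow> (\<exists>n::nat. z \<in> A n)"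
    and "\<forall>n. weak_grushin_grad \<gamma> \<Omega> (v n) (V n) \<and> (AE z in lebesgue. z \<in> A n \<longrightarrow> u z = v n z \<and> G z = V n z)"
    using G unfolding has_grushin_grad_def by (elim exE conjE) (rule that)
  then have A': "\<And>n. A n \<in> sets lebesgue" "\<And>n. A n \<subseteq> \<Omega>" "\<And>n. weak_grushin_grad \<gamma> \<Omega> (v n) (V n)"
    "\<And>n. AE z in lebesgue. z \<in> A n \<longrightarrow> u z = v n z \<and> G z = V n z" by auto
  obtain B w W where "\<forall>n. B n \<in> sets lebesgue \<and> B n \<subseteq> \<Omega>" and B: "AE z in lebesgue. z \<in> \<Omega> \<longrightarrow> (\<exists>n::nat. z \<in> B n)"
    and "\<forall>n. weak_grushin_grad \<gamma> \<Omega> (w n) (W n) \<and> (AE z in lebesgue. z \<in> B n \<longrightarrow> u z = w n z \<and> H z = W n z)"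
    using H unfolding has_grushin_grad_def by (elim exE conjE) (rule that)
  then have B': "\<And>n. B n \<in> sets lebesgue" "\<And>n. B n \<subseteq> \<Omega>" "\<And>n. weak_grushin_grad \<gamma> \<Omega> (w n) (W n)"
    "\<And>n. AE z in lebesgue. z \<in> B n \<longrightarrow> u z = w n z \<and> H z = W n z" by auto
  have "AE z in lebesgue. z \<in> A n \<inter> B k \<longrightarrow> V n z = W k z" for n k
  proof (rule weak_grushin_grad_agree[OF A'(3) B'(3) assms(3,4)])
    show "AE z in lebesgue. z \<in> A n \<inter> B k \<longrightarrow> v n z = w k z"
      using A'(4)[of n] B'(4)[of k] by eventually_elim auto
  qed (use A'(1,2) B'(1) in auto)
  then have "AE z in lebesgue. \<forall>n k. z \<in> A n \<inter> B k \<longrightarrow> V n z = W k z"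
    by (simp add: AE_all_countable)
  moreover have "AE z in lebesgue. \<forall>n. z \<in> A n \<longrightarrow> u z = v n z \<and> G z = V n z"
    "AE z in lebesgue. \<forall>n. z \<in> B n \<longrightarrow> u z = w n z \<and> H z = W n z"
    using A'(4) B'(4) by (simp_all add: AE_all_countable)
  ultimately show ?thesis using A B by eventually_elim force
qed

section \<open>Limits of continuously differentiable functions\<close>

lemma tendsto_integral_bounded_mult:
  fixes f :: "nat \<Rightarrow> 'a::euclidean_space \<Rightarrow> 'b::euclidean_space" and a :: "'a \<Rightarrow> real"
  assumes f: "\<And>k. set_integrable lebesgue \<Omega> (f k)" and g: "set_integrable lebesgue \<Omega> g"
    and a: "a \<in> borel_measurable lebesgue" "\<And>z. norm (a z) \<le> B"
    and lim: "(\<lambda>k. LINT z:\<Omega>|lebesgue. norm (f k z - g z)) \<longlonglongrightarrow> 0"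
  shows "(\<lambda>k. LINT z:\<Omega>|lebesgue. a z *\<^sub>R f k z) \<longlonglongrightarrow> (LINT z:\<Omega>|lebesgue. a z *\<^sub>R g z)"
proof (rule LIM_zero_cancel, rule Lim_null_comparison[where g="\<lambda>k. B * (LINT z:\<Omega>|lebesgue. norm (f k z - g z))"])
  have sm: "set_integrable lebesgue \<Omega> (\<lambda>z. a z *\<^sub>R h z)" if h: "set_integrable lebesgue \<Omega> h" for h :: "'a \<Rightarrow> 'b"
    unfolding set_integrable_def
  proof (rule Bochner_Integration.integrable_bound[where f="\<lambda>z. B *\<^sub>R (indicator \<Omega> z *\<^sub>R h z)"])
    show "integrable lebesgue (\<lambda>z. B *\<^sub>R (indicator \<Omega> z *\<^sub>R h z))"
      using h[unfolded set_integrable_def] by (rule integrable_scaleR_right)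
    have "(\<lambda>z. a z *\<^sub>R (indicator \<Omega> z *\<^sub>R h z)) \<in> borel_measurable lebesgue"
      by (rule borel_measurable_scaleR[OF a(1) borel_measurable_integrable[OF h[unfolded set_integrable_def]]])
    then show "(\<lambda>z. indicator \<Omega> z *\<^sub>R a z *\<^sub>R h z) \<in> borel_measurable lebesgue"
      by (simp add: mult.commute)
    have "0 \<le> B" using order_trans[OF norm_ge_zero a(2)] .
    then show "AE z in lebesgue. norm (indicator \<Omega> z *\<^sub>R a z *\<^sub>R h z) \<le> norm (B *\<^sub>R (indicator \<Omega> z *\<^sub>R h z))"
      using a(2) by (intro AE_I2) (auto simp: indicator_def mult_right_mono)
  qed
  have d: "set_integrable lebesgue \<Omega> (\<lambda>z. f k z - g z)" for k
    using f[of k] g by (rule set_integral_diff)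
  show "\<forall>\<^sub>F k in sequentially. norm ((LINT z:\<Omega>|lebesgue. a z *\<^sub>R f k z) - (LINT z:\<Omega>|lebesgue. a z *\<^sub>R g z))
      \<le> B * (LINT z:\<Omega>|lebesgue. norm (f k z - g z))"
  proof (rule always_eventually, rule allI)
    fix k
    have "(LINT z:\<Omega>|lebesgue. a z *\<^sub>R f k z) - (LINT z:\<Omega>|lebesgue. a z *\<^sub>R g z)
        = (LINT z:\<Omega>|lebesgue. a z *\<^sub>R (f k z - g z))"
      using sm[OF f] sm[OF g] by (simp add: scaleR_right_diff_distrib set_integral_diff)
    also have "norm \<dots> \<le> (LINT z:\<Omega>|lebesgue. norm (a z *\<^sub>R (f k z - g z)))"
      by (rule set_integral_norm_bound[OF sm[OF d]])
    also have "\<dots> \<le> (LINT z:\<Omega>|lebesgue. B * norm (f k z - g z))"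
    proof (rule set_integral_mono)
      show "set_integrable lebesgue \<Omega> (\<lambda>z. norm (a z *\<^sub>R (f k z - g z)))"
        by (rule set_integrable_norm[OF sm[OF d]])
      show "set_integrable lebesgue \<Omega> (\<lambda>z. B * norm (f k z - g z))"
        by (rule set_integrable_mult_right) (rule set_integrable_norm[OF d])
      show "norm (a z *\<^sub>R (f k z - g z)) \<le> B * norm (f k z - g z)" for z
        unfolding norm_scaleR using mult_right_mono[OF a(2) norm_ge_zero] by simp
    qed
    finally show "norm ((LINT z:\<Omega>|lebesgue. a z *\<^sub>R f k z) - (LINT z:\<Omega>|lebesgue. a z *\<^sub>R g z))
      \<le> B * (LINT z:\<Omega>|lebesgue. norm (f k z - g z))" by simp
  qed
  show "(\<lambda>k. B * (LINT z:\<Omega>|lebesgue. norm (f k z - g z))) \<longlonglongrightarrow> 0"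
    using tendsto_mult_right_zero[OF lim] .
qed

text \<open>
  With \<open>a = 1\<close> this is used for the \<open>x\<close>-derivatives, and with \<open>a = |x|\<^sup>\<gamma>\<close>, which need not be differentiable,
  for the \<open>y\<close>-derivatives.
\<close>

lemma integration_by_parts_weighted:
  fixes w :: "'a::euclidean_space \<Rightarrow> 'b::euclidean_space" and a \<psi> :: "'a \<Rightarrow> real"
  assumes a: "continuous_on UNIV a" "\<And>z t. a (z + t *\<^sub>R e) = a z" and e: "e \<in> Basis"
    and \<psi>: "\<psi> \<in> C0_infinity \<Omega>"
    and w: "\<And>z. w differentiable (at z)" "continuous_on UNIV (partial_deriv e w)"
  shows "(LINT z:\<Omega>|lebesgue. (a z * partial_deriv e \<psi> z) *\<^sub>R w z)
    = - (LINT z:\<Omega>|lebesgue. \<psi> z *\<^sub>R (a z *\<^sub>R partial_deriv e w z))"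
proof -
  obtain K where K: "compact K" "K \<subseteq> \<Omega>" "\<And>z. z \<notin> K \<Longrightarrow> \<psi> z = 0" "\<And>e z. z \<notin> K \<Longrightarrow> partial_deriv e \<psi> z = 0"
    "continuous_on UNIV \<psi>" "\<And>e. e \<in> Basis \<Longrightarrow> continuous_on UNIV (partial_deriv e \<psi>)"
    "\<And>z. \<psi> differentiable (at z)"
    by (rule test_function_facts[OF \<psi>]) (rule that)
  have cw: "continuous_on UNIV w"
    using w(1) by (simp add: continuous_at_imp_continuous_on differentiable_imp_continuous_within)
  let ?l = "\<lambda>z. (a z * partial_deriv e \<psi> z) *\<^sub>R w z" and ?r = "\<lambda>z. \<psi> z *\<^sub>R (a z *\<^sub>R partial_deriv e w z)"
  have cl: "continuous_on UNIV ?l" and cr: "continuous_on UNIV ?r"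
    by (intro continuous_intros a K(5) K(6)[OF e] w cw)+
  have int: "integrable lebesgue ?l" "integrable lebesgue ?r"
    by (rule integrable_of_compact_support[OF cl K(1)], simp add: K(4),
        rule integrable_of_compact_support[OF cr K(1)], simp add: K(3))
  have "(LINT z|lebesgue. ?l z + ?r z) = 0"
  proof (rule integral_directional_derivative_zero[where w="\<lambda>z. (a z * \<psi> z) *\<^sub>R w z" and e=e and K=K])
    show "continuous_on UNIV (\<lambda>z. (a z * \<psi> z) *\<^sub>R w z)" "continuous_on UNIV (\<lambda>z. ?l z + ?r z)"
      by (intro continuous_intros a K(5) cw cl cr)+
    show "((\<lambda>t. (a (z + t *\<^sub>R e) * \<psi> (z + t *\<^sub>R e)) *\<^sub>R w (z + t *\<^sub>R e)) has_vector_derivative (?l z + ?r z)) (at 0)" for z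
    proof -
      have 1: "((\<lambda>t. w (z + t *\<^sub>R e)) has_vector_derivative partial_deriv e w z) (at 0)"
        by (rule partial_deriv_has_vector_derivative[OF w(1)])
      have "((\<lambda>t. \<psi> (z + t *\<^sub>R e)) has_vector_derivative partial_deriv e \<psi> z) (at 0)"
        by (rule partial_deriv_has_vector_derivative[OF K(7)])
      then have 2: "((\<lambda>t. a z * \<psi> (z + t *\<^sub>R e)) has_real_derivative a z * partial_deriv e \<psi> z) (at 0)"
        by (auto simp: has_real_derivative_iff_has_vector_derivative[symmetric] intro!: derivative_eq_intros)
      show ?thesis
        using has_vector_derivative_scaleR[OF 2 1] by (simp add: a(2) add.commute mult.commute)
    qed
  qed (use K in auto)
  then have "(LINT z|lebesgue. ?l z) + (LINT z|lebesgue. ?r z) = 0"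
    using int by simp
  moreover have "(LINT z:\<Omega>|lebesgue. ?l z) = (LINT z|lebesgue. ?l z)" "(LINT z:\<Omega>|lebesgue. ?r z) = (LINT z|lebesgue. ?r z)"
    by (rule set_integral_restrict[OF _ K(2)], simp add: K(3,4))+
  ultimately show ?thesis by (simp add: eq_neg_iff_add_eq_0)
qed

lemma set_integrable_bounded_linear:
  "bounded_linear L \<Longrightarrow> set_integrable M A u \<Longrightarrow> set_integrable M A (\<lambda>z. L (u z))"
  unfolding set_integrable_def
  using integrable_bounded_linear[of L M "\<lambda>z. indicator A z *\<^sub>R u z"]
  by (simp add: linear_scale[OF bounded_linear.linear])

lemma bounded_linear_components:
  "bounded_linear (\<lambda>x :: ('b::real_normed_vector^'m) \<times> ('b^'k). fst x $ i)"
  "bounded_linear (\<lambda>x :: ('b::real_normed_vector^'m) \<times> ('b^'k). snd x $ j)"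
  by (intro bounded_linear_compose[OF bounded_linear_vec_nth] bounded_linear_fst bounded_linear_snd)+

lemma norm_components_le:
  fixes x :: "('b::real_normed_vector^'m) \<times> ('b^'k)"
  shows "norm (fst x $ i) \<le> norm x" "norm (snd x $ j) \<le> norm x"
  using order_trans[OF Finite_Cartesian_Product.norm_nth_le norm_fst_le[of "fst x" "snd x"]]
    order_trans[OF Finite_Cartesian_Product.norm_nth_le norm_snd_le[of "snd x" "fst x"]]
  by simp_all

text \<open>
  Weak gradients are closed under convergence in the mean of functions and gradients; this is how weak
  gradients of composite functions are found.
\<close>

proposition weak_grushin_grad_limit:
  fixes w :: "nat \<Rightarrow> (real^'m) \<times> (real^'k) \<Rightarrow> 'b::euclidean_space"
  assumes \<gamma>: "0 \<le> \<gamma>" and \<Omega>: "open \<Omega>"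
    and w: "\<And>k z. w k differentiable (at z)" "\<And>k e. e \<in> Basis \<Longrightarrow> continuous_on UNIV (partial_deriv e (w k))"
    and int: "\<And>k. set_integrable lebesgue \<Omega> (w k)" "\<And>k. set_integrable lebesgue \<Omega> (grushin_grad \<gamma> (w k))"
    and lim_int: "set_integrable lebesgue \<Omega> u" "set_integrable lebesgue \<Omega> V"
    and conv: "(\<lambda>k. LINT z:\<Omega>|lebesgue. norm (w k z - u z)) \<longlonglongrightarrow> 0"
      "(\<lambda>k. LINT z:\<Omega>|lebesgue. norm (grushin_grad \<gamma> (w k) z - V z)) \<longlonglongrightarrow> 0"
  shows "weak_grushin_grad \<gamma> \<Omega> u V"
  unfolding weak_grushin_grad_def
proof (intro conjI allI impI)
  show "locally_integrable_on \<Omega> u" "locally_integrable_on \<Omega> V"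
    using lim_int \<Omega> set_integrable_subset[of lebesgue \<Omega>] lmeasurable_compact
    unfolding locally_integrable_on_def by (blast intro: fmeasurableD)+
  fix \<psi> :: "(real^'m) \<times> (real^'k) \<Rightarrow> real" assume \<psi>: "\<psi> \<in> C0_infinity \<Omega>"
  obtain K where K: "compact K" "K \<subseteq> \<Omega>" "\<And>z. z \<notin> K \<Longrightarrow> \<psi> z = 0" "\<And>e z. z \<notin> K \<Longrightarrow> partial_deriv e \<psi> z = 0"
    "continuous_on UNIV \<psi>" "\<And>e. e \<in> Basis \<Longrightarrow> continuous_on UNIV (partial_deriv e \<psi>)"
    "\<And>z. \<psi> differentiable (at z)"
    by (rule test_function_facts[OF \<psi>]) (rule that)
  have test: "(\<lambda>k. LINT z:\<Omega>|lebesgue. a z *\<^sub>R w k z) \<longlonglongrightarrow> (LINT z:\<Omega>|lebesgue. a z *\<^sub>R u z)"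
    if a: "continuous_on UNIV a" "\<And>z. z \<notin> K \<Longrightarrow> a z = 0" for a
    using bounded_of_compact_support[OF a(1) K(1) a(2)]
      tendsto_integral_bounded_mult[OF int(1) lim_int(1) continuous_lebesgue_measurable[OF a(1)] _ conv(1)] by metis
  have comp: "(\<lambda>k. LINT z:\<Omega>|lebesgue. \<psi> z *\<^sub>R L (grushin_grad \<gamma> (w k) z)) \<longlonglongrightarrow> (LINT z:\<Omega>|lebesgue. \<psi> z *\<^sub>R L (V z))"
    if L: "bounded_linear L" "\<And>x. norm (L x) \<le> norm x" for L :: "('b^'m) \<times> ('b^'k) \<Rightarrow> 'b"
  proof -
    obtain B where B: "\<And>z. norm (\<psi> z) \<le> B" using bounded_of_compact_support[OF K(5,1,3)] by metis
    have i: "set_integrable lebesgue \<Omega> (\<lambda>z. grushin_grad \<gamma> (w k) z - V z)" for k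
      using int(2)[of k] lim_int(2) by (rule set_integral_diff)
    have "(\<lambda>k. LINT z:\<Omega>|lebesgue. norm (L (grushin_grad \<gamma> (w k) z) - L (V z))) \<longlonglongrightarrow> 0"
    proof (rule tendsto_sandwich[OF always_eventually always_eventually tendsto_const conv(2)]; rule allI)
      fix k
      have *: "norm (L (grushin_grad \<gamma> (w k) z) - L (V z)) \<le> norm (grushin_grad \<gamma> (w k) z - V z)" for z
        using L(2)[of "grushin_grad \<gamma> (w k) z - V z"] by (simp add: linear_diff[OF bounded_linear.linear[OF L(1)]])
      have "set_integrable lebesgue \<Omega> (\<lambda>z. L (grushin_grad \<gamma> (w k) z) - L (V z))"
        using set_integrable_bounded_linear[OF L(1) i] by (simp add: linear_diff[OF bounded_linear.linear[OF L(1)]])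
      then show "(LINT z:\<Omega>|lebesgue. norm (L (grushin_grad \<gamma> (w k) z) - L (V z))) \<le> (LINT z:\<Omega>|lebesgue. norm (grushin_grad \<gamma> (w k) z - V z))"
        using i[of k] * by (intro set_integral_mono set_integrable_norm) auto
      show "0 \<le> (LINT z:\<Omega>|lebesgue. norm (L (grushin_grad \<gamma> (w k) z) - L (V z)))"
        unfolding set_lebesgue_integral_def by (intro integral_nonneg_AE) auto
    qed
    then show ?thesis
      by (rule tendsto_integral_bounded_mult[OF set_integrable_bounded_linear[OF L(1) int(2)]
        set_integrable_bounded_linear[OF L(1) lim_int(2)] continuous_lebesgue_measurable[OF K(5)] B])
  qed
  {
    fix i
    have "(LINT z:\<Omega>|lebesgue. grushin_X i \<psi> z *\<^sub>R w k z) = - (LINT z:\<Omega>|lebesgue. \<psi> z *\<^sub>R (fst (grushin_grad \<gamma> (w k) z) $ i))" for k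
      using integration_by_parts_weighted[OF continuous_on_const[of _ 1] refl coordinate_directions_Basis(1) \<psi> w(1) w(2)[OF coordinate_directions_Basis(1)]]
      by (simp add: grushin_X_def grushin_grad_def)
    moreover have "(\<lambda>k. LINT z:\<Omega>|lebesgue. grushin_X i \<psi> z *\<^sub>R w k z) \<longlonglongrightarrow> (LINT z:\<Omega>|lebesgue. grushin_X i \<psi> z *\<^sub>R u z)"
      by (rule test) (use K in \<open>auto simp: grushin_X_def[abs_def]\<close>)
    moreover note tendsto_minus[OF comp[OF bounded_linear_components(1)[of i] norm_components_le(1)]]
    ultimately show "(LINT z:\<Omega>|lebesgue. grushin_X i \<psi> z *\<^sub>R u z) = - (LINT z:\<Omega>|lebesgue. \<psi> z *\<^sub>R (fst (V z) $ i))"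
      using LIMSEQ_unique by auto
  next
    fix j
    have "(LINT z:\<Omega>|lebesgue. grushin_Y \<gamma> j \<psi> z *\<^sub>R w k z) = - (LINT z:\<Omega>|lebesgue. \<psi> z *\<^sub>R (snd (grushin_grad \<gamma> (w k) z) $ j))" for k
      using integration_by_parts_weighted[OF continuous_grushin_weight[OF \<gamma>] grushin_weight_shift_y coordinate_directions_Basis(2) \<psi> w(1) w(2)[OF coordinate_directions_Basis(2)]]
      by (simp add: grushin_Y_def grushin_grad_def)
    moreover have "(\<lambda>k. LINT z:\<Omega>|lebesgue. grushin_Y \<gamma> j \<psi> z *\<^sub>R w k z) \<longlonglongrightarrow> (LINT z:\<Omega>|lebesgue. grushin_Y \<gamma> j \<psi> z *\<^sub>R u z)"
      by (rule test) (use K continuous_grushin_weight[OF \<gamma>] in \<open>auto simp: grushin_Y_def[abs_def] intro!: continuous_intros\<close>)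
    moreover note tendsto_minus[OF comp[OF bounded_linear_components(2)[of j] norm_components_le(2)]]
    ultimately show "(LINT z:\<Omega>|lebesgue. grushin_Y \<gamma> j \<psi> z *\<^sub>R u z) = - (LINT z:\<Omega>|lebesgue. \<psi> z *\<^sub>R (snd (V z) $ j))"
      using LIMSEQ_unique by auto
  }
qed

section \<open>Gradients of products and the remainder functional\<close>

text \<open>
  The quotient rule for \<open>f / \<phi>\<close> involves a complex scalar times a real vector. Complex vectors carry their real inner
  product, and with respect to it the map \<open>\<xi> \<mapsto> Re(cnj a \<xi>)\<close>, called \<open>real_pairing\<close>, is the adjoint of this product.
\<close>

definition complex_multiple :: "complex \<Rightarrow> (real^'m) \<times> (real^'k) \<Rightarrow> (complex^'m) \<times> (complex^'k)" where
  "complex_multiple a x = ((\<chi> i. (fst x $ i) *\<^sub>R a), (\<chi> j. (snd x $ j) *\<^sub>R a))"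

definition real_pairing :: "complex \<Rightarrow> (complex^'m) \<times> (complex^'k) \<Rightarrow> (real^'m) \<times> (real^'k)" where
  "real_pairing a \<xi> = ((\<chi> i. a \<bullet> fst \<xi> $ i), (\<chi> j. a \<bullet> snd \<xi> $ j))"

lemma complex_multiple_inner: "complex_multiple a x \<bullet> \<xi> = x \<bullet> real_pairing a \<xi>"
  by (simp add: complex_multiple_def real_pairing_def inner_prod_def inner_vec_def)

lemma real_pairing_complex_multiple: "real_pairing a (complex_multiple a x) = (norm a)\<^sup>2 *\<^sub>R x"
  by (simp add: complex_multiple_def real_pairing_def prod_eq_iff vec_eq_iff power2_norm_eq_inner)

lemma norm_complex_multiple: "norm (complex_multiple a x) = norm a * norm x"
proof -
  have "(norm (complex_multiple a x))\<^sup>2 = (norm a * norm x)\<^sup>2"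
    by (simp add: power2_norm_eq_inner[of "complex_multiple a x"] complex_multiple_inner
        real_pairing_complex_multiple power_mult_distrib power2_norm_eq_inner[of x])
  then show ?thesis by simp
qed

text \<open>
  Duality with \<open>complex_multiple\<close>, which multiplies norms.
\<close>

lemma norm_real_pairing_le: "norm (real_pairing a \<xi>) \<le> norm a * norm \<xi>"
proof -
  let ?r = "real_pairing a \<xi>"
  have "norm ?r * norm ?r = complex_multiple a ?r \<bullet> \<xi>"
    by (simp add: complex_multiple_inner power2_norm_eq_inner flip: power2_eq_square)
  also have "\<dots> \<le> (norm a * norm \<xi>) * norm ?r"
    using norm_cauchy_schwarz[of "complex_multiple a ?r" \<xi>] by (simp add: norm_complex_multiple mult_ac)
  finally show ?thesis
    by (cases "norm ?r = 0") (auto simp: mult_le_cancel_right)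
qed

lemma complex_multiple_linear:
  "complex_multiple (a + b) x = complex_multiple a x + complex_multiple b x"
  "complex_multiple (a - b) x = complex_multiple a x - complex_multiple b x"
  "complex_multiple a (x + y) = complex_multiple a x + complex_multiple a y"
  "complex_multiple a (x - y) = complex_multiple a x - complex_multiple a y"
  "complex_multiple (r *\<^sub>R a) x = r *\<^sub>R complex_multiple a x"
  "complex_multiple a (r *\<^sub>R x) = r *\<^sub>R complex_multiple a x"
  by (simp_all add: complex_multiple_def prod_eq_iff vec_eq_iff scaleR_left_distrib
      scaleR_right_distrib scaleR_left_diff_distrib scaleR_right_diff_distrib mult.commute)

lemma bounded_bilinear_complex_multiple:
  "bounded_bilinear (complex_multiple :: complex \<Rightarrow> (real^'m) \<times> (real^'k) \<Rightarrow> _)"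
  by standard (auto simp: complex_multiple_linear norm_complex_multiple intro!: exI[of _ 1])

lemma bounded_bilinear_real_pairing:
  "bounded_bilinear (real_pairing :: complex \<Rightarrow> (complex^'m) \<times> (complex^'k) \<Rightarrow> _)"
proof
  show "\<exists>K. \<forall>a \<xi>. norm (real_pairing a \<xi>) \<le> norm a * norm \<xi> * K"
    using norm_real_pairing_le by (auto intro!: exI[of _ 1])
qed (auto simp: real_pairing_def prod_eq_iff vec_eq_iff inner_add_left inner_add_right)

lemma Re_bilinear_dot_conj: "Re (bilinear_dot \<xi> (conj_vec \<eta>)) = \<xi> \<bullet> \<eta>"
  by (simp add: bilinear_dot_def conj_vec_def inner_prod_def inner_vec_def inner_complex_def)

lemma powr_minus_one_mult: "0 \<le> (x::real) \<Longrightarrow> x powr (q - 1) * x = x powr q"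
  by (cases "x = 0") (auto simp: powr_diff)

text \<open>
  The vector \<open>\<xi> - \<eta> = \<zeta>\<close> is what remains of the gradient when the second argument is \<open>\<phi> \<nabla>(f / \<phi>)\<close>. The
  identity covers \<open>\<zeta> = 0\<close>, since then all terms with \<open>\<zeta>\<close> vanish.
\<close>

lemma C_p_expand:
  assumes "0 < p"
  shows "C_p p \<xi> (\<xi> - \<zeta>) = norm \<xi> powr p - (p * norm \<zeta> powr (p - 2) * (\<zeta> \<bullet> \<xi>) - (p - 1) * norm \<zeta> powr p)"
proof -
  have "norm \<zeta> powr (p - 2) * (\<zeta> \<bullet> \<zeta>) = norm \<zeta> powr p"
    using powr_minus_one_mult[of "norm \<zeta>" "p - 1"] powr_minus_one_mult[of "norm \<zeta>" p]
    by (simp add: power2_norm_eq_inner[symmetric] power2_eq_square mult.assoc[symmetric])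
  then show ?thesis
    by (simp add: C_p_def Re_bilinear_dot_conj inner_diff_right algebra_simps)
qed

section \<open>Products of powers\<close>

text \<open>
  A form of Young's inequality that needs no conjugate exponent: compare \<open>y\<close> with \<open>\<theta> x\<close>.
\<close>

lemma young_powr:
  fixes x y \<theta> p :: real
  assumes "0 \<le> x" "0 \<le> y" "0 < \<theta>" "1 < p"
  shows "x powr (p - 1) * y \<le> \<theta> * x powr p + \<theta> powr (1 - p) * y powr p"
proof (cases "y \<le> \<theta> * x")
  case True
  then have "x powr (p - 1) * y \<le> \<theta> * (x powr (p - 1) * x)"
    using mult_left_mono[OF True, of "x powr (p - 1)"] by (simp add: mult_ac)
  also have "\<dots> = \<theta> * x powr p" using assms powr_minus_one_mult by simp
  also have "\<dots> \<le> \<theta> * x powr p + \<theta> powr (1 - p) * y powr p" by simp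
  finally show ?thesis .
next
  case False
  then have "x \<le> y / \<theta>" using assms by (simp add: field_simps)
  then have "x powr (p - 1) \<le> (y / \<theta>) powr (p - 1)" using assms by (intro powr_mono2) auto
  then have "x powr (p - 1) * y \<le> (y / \<theta>) powr (p - 1) * y" using assms by (intro mult_right_mono)
  also have "(y / \<theta>) powr (p - 1) * y = \<theta> powr (1 - p) * (y powr (p - 1) * y)"
    using assms powr_minus_divide[of \<theta> "p - 1"] by (simp add: powr_divide)
  also have "\<dots> = \<theta> powr (1 - p) * y powr p" using assms powr_minus_one_mult by simp
  also have "\<dots> \<le> \<theta> * x powr p + \<theta> powr (1 - p) * y powr p" using assms by simp
  finally show ?thesis .
qed

text \<open>
  This replaces Hoelder's inequality: in Young's inequality the first term is made small by the choice
  of \<open>\<theta>\<close>, and then the second tends to 0.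
\<close>

lemma integral_mixed_power_tendsto_0:
  fixes B :: "'a \<Rightarrow> real" and d :: "nat \<Rightarrow> 'a \<Rightarrow> real"
  assumes p: "1 < p" and B: "B \<in> borel_measurable M" "\<And>z. 0 \<le> B z" "integrable M (\<lambda>z. B z powr p)"
    and d: "\<And>k. d k \<in> borel_measurable M" "\<And>k z. 0 \<le> d k z" "\<And>k. integrable M (\<lambda>z. d k z powr p)"
    and lim: "(\<lambda>k. LINT z|M. d k z powr p) \<longlonglongrightarrow> 0"
  shows "integrable M (\<lambda>z. B z powr (p - 1) * d k z)"
    and "(\<lambda>k. LINT z|M. B z powr (p - 1) * d k z) \<longlonglongrightarrow> 0"
proof -
  have dom: "integrable M (\<lambda>z. \<theta> * B z powr p + \<theta> powr (1 - p) * d k z powr p)" for \<theta> k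
    using B d by auto
  have int: "integrable M (\<lambda>z. B z powr (p - 1) * d k z)" for k
  proof (rule Bochner_Integration.integrable_bound[OF dom[of 1 k]])
    show "AE z in M. norm (B z powr (p - 1) * d k z) \<le> norm (1 * B z powr p + 1 powr (1 - p) * d k z powr p)"
      using young_powr[OF B(2) d(2) _ p, of 1] B(2) d(2) by (intro AE_I2) (auto simp: abs_mult)
  qed (use B d in measurable)
  then show "integrable M (\<lambda>z. B z powr (p - 1) * d k z)" for k .
  define I where "I = (LINT z|M. B z powr p)"
  have I: "0 \<le> I" unfolding I_def by (intro integral_nonneg_AE) auto
  show "(\<lambda>k. LINT z|M. B z powr (p - 1) * d k z) \<longlonglongrightarrow> 0"
  proof (rule tendstoI)
    fix e :: real assume e: "0 < e"
    \<comment> \<open>Adding 1 avoids a case distinction for \<open>I = 0\<close>.\<close>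
    define \<theta> where "\<theta> = e / (2 * (I + 1))"
    have \<theta>: "0 < \<theta>" using e I by (simp add: \<theta>_def)
    have "\<theta> * I = e / 2 * (I / (I + 1))" using I by (simp add: \<theta>_def field_simps)
    also have "\<dots> \<le> e / 2 * 1" using e I by (intro mult_left_mono) auto
    finally have "\<theta> * I \<le> e / 2" by simp
    have "(\<lambda>k. \<theta> powr (1 - p) * (LINT z|M. d k z powr p)) \<longlonglongrightarrow> 0"
      by (rule tendsto_mult_right_zero[OF lim])
    then have "\<forall>\<^sub>F k in sequentially. \<theta> powr (1 - p) * (LINT z|M. d k z powr p) < e / 2"
      by (rule order_tendstoD) (use e in simp)
    then show "\<forall>\<^sub>F k in sequentially. dist (LINT z|M. B z powr (p - 1) * d k z) 0 < e"
    proof eventually_elim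
      case (elim k)
      have "0 \<le> (LINT z|M. B z powr (p - 1) * d k z)"
        using B d by (intro integral_nonneg_AE) auto
      moreover have "(LINT z|M. B z powr (p - 1) * d k z) \<le> (LINT z|M. \<theta> * B z powr p + \<theta> powr (1 - p) * d k z powr p)"
        by (intro integral_mono int dom young_powr B d \<theta> p)
      moreover have "\<dots> = \<theta> * I + \<theta> powr (1 - p) * (LINT z|M. d k z powr p)"
        using B d by (simp add: I_def)
      ultimately show ?case using elim \<open>\<theta> * I \<le> e / 2\<close> by (simp add: dist_real_def)
    qed
  qed
qed

section \<open>Calculus for the classical Grushin gradient\<close>

lemma grushin_grad_continuous:
  assumes "0 \<le> \<gamma>" "\<And>e. e \<in> Basis \<Longrightarrow> continuous_on UNIV (partial_deriv e u)"
  shows "continuous_on UNIV (grushin_grad \<gamma> u)"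
  unfolding grushin_grad_def[abs_def] grushin_X_def grushin_Y_def
  using assms continuous_grushin_weight[OF assms(1)]
  by (intro continuous_on_Pair continuous_on_vec_lambda continuous_intros) auto

lemma grushin_grad_outside:
  assumes "\<And>e. partial_deriv e u z = 0"
  shows "grushin_grad \<gamma> u z = 0"
  using assms by (simp add: grushin_grad_def grushin_X_def grushin_Y_def prod_eq_iff vec_eq_iff)

lemma grushin_grad_compose_real:
  assumes "u differentiable (at z)" "(h has_real_derivative d) (at (u z))"
  shows "grushin_grad \<gamma> (\<lambda>z. h (u z)) z = d *\<^sub>R grushin_grad \<gamma> u z"
  using partial_deriv_compose_real(2)[OF assms]
  by (simp add: grushin_grad_def grushin_X_def grushin_Y_def prod_eq_iff vec_eq_iff)

lemma grushin_grad_scaleR_complex: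
  assumes "q differentiable (at z)" "f differentiable (at z)"
  shows "grushin_grad \<gamma> (\<lambda>z. q z *\<^sub>R f z) z = q z *\<^sub>R grushin_grad \<gamma> f z + complex_multiple (f z) (grushin_grad \<gamma> q z)"
  using partial_deriv_scaleR(2)[OF assms]
  by (simp add: grushin_grad_def grushin_X_def grushin_Y_def complex_multiple_def prod_eq_iff vec_eq_iff
      scaleR_right_distrib mult.commute)

lemma grushin_grad_mult:
  fixes q f :: "_ \<Rightarrow> real"
  assumes "q differentiable (at z)" "f differentiable (at z)"
  shows "grushin_grad \<gamma> (\<lambda>z. q z * f z) z = q z *\<^sub>R grushin_grad \<gamma> f z + f z *\<^sub>R grushin_grad \<gamma> q z"
  using partial_deriv_scaleR(2)[OF assms]
  by (simp add: grushin_grad_def grushin_X_def grushin_Y_def prod_eq_iff vec_eq_iff algebra_simps)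

lemma grushin_grad_norm_squared:
  fixes f :: "_ \<Rightarrow> complex"
  assumes "f differentiable (at z)"
  shows "(\<lambda>z. (norm (f z))\<^sup>2) differentiable (at z)"
    and "grushin_grad \<gamma> (\<lambda>z. (norm (f z))\<^sup>2) z = 2 *\<^sub>R real_pairing (f z) (grushin_grad \<gamma> f z)"
proof -
  obtain D where D: "(f has_derivative D) (at z)"
    using assms unfolding differentiable_def by blast
  have *: "((\<lambda>z. (norm (f z))\<^sup>2) has_derivative (\<lambda>v. 2 * (f z \<bullet> D v))) (at z)"
    unfolding power2_norm_eq_inner using has_derivative_inner[OF D D] by (simp add: inner_commute)
  show "(\<lambda>z. (norm (f z))\<^sup>2) differentiable (at z)" using * unfolding differentiable_def by blast
  have "partial_deriv e (\<lambda>z. (norm (f z))\<^sup>2) z = 2 * (f z \<bullet> partial_deriv e f z)" for e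
    using partial_deriv_eq[OF *] partial_deriv_eq[OF D] by simp
  then show "grushin_grad \<gamma> (\<lambda>z. (norm (f z))\<^sup>2) z = 2 *\<^sub>R real_pairing (f z) (grushin_grad \<gamma> f z)"
    by (simp add: grushin_grad_def grushin_X_def grushin_Y_def real_pairing_def prod_eq_iff vec_eq_iff)
qed

section \<open>The chain rule in the closure of the test functions\<close>

lemma integrable_powr_diff_bounded:
  fixes u w :: "'a \<Rightarrow> 'b::euclidean_space"
  assumes M: "finite_measure M" and p: "0 \<le> p"
    and w: "w \<in> borel_measurable M" and u: "u \<in> borel_measurable M" "integrable M (\<lambda>z. norm (u z) powr p)"
    and B: "\<And>z. norm (w z) \<le> B"
  shows "integrable M (\<lambda>z. norm (w z - u z) powr p)"
proof (rule Bochner_Integration.integrable_bound[where f="\<lambda>z. 2 powr p * (B powr p + norm (u z) powr p)"])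
  show "integrable M (\<lambda>z. 2 powr p * (B powr p + norm (u z) powr p))"
    using u(2) finite_measure.integrable_const[OF M, of "B powr p"]
    by (intro integrable_mult_right Bochner_Integration.integrable_add)
  show "AE z in M. norm (norm (w z - u z) powr p) \<le> norm (2 powr p * (B powr p + norm (u z) powr p))"
  proof (rule AE_I2)
    fix z
    have "norm (w z - u z) powr p \<le> (2 * max B (norm (u z))) powr p"
      using p B[of z] norm_triangle_ineq4[of "w z" "u z"] by (intro powr_mono2) auto
    also have "\<dots> = 2 powr p * max B (norm (u z)) powr p"
      by (simp add: powr_mult le_max_iff_disj)
    also have "\<dots> \<le> 2 powr p * (B powr p + norm (u z) powr p)"
      by (intro mult_left_mono) (auto simp: max_def)
    finally show "norm (norm (w z - u z) powr p) \<le> norm (2 powr p * (B powr p + norm (u z) powr p))" by simp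
  qed
qed (use w u(1) in measurable)

lemma set_integrable_lebesgue_on:
  fixes f :: "'a::euclidean_space \<Rightarrow> 'b::euclidean_space"
  shows "S \<in> sets lebesgue \<Longrightarrow> set_integrable lebesgue S f \<longleftrightarrow> integrable (lebesgue_on S) f"
  using integrable_restrict_space[of S lebesgue f] by (simp add: set_integrable_def)

lemma set_integral_lebesgue_on:
  fixes f :: "'a::euclidean_space \<Rightarrow> 'b::euclidean_space"
  shows "S \<in> sets lebesgue \<Longrightarrow> (LINT z:S|lebesgue. f z) = integral\<^sup>L (lebesgue_on S) f"
  using integral_restrict_space[of S lebesgue f] by (simp add: set_lebesgue_integral_def)

text \<open>
  Test functions \<open>\<psi>\<^sub>k\<close> converge to \<open>\<phi>\<close> almost everywhere and their gradients converge to \<open>G\<close> in the mean of order \<open>p\<close>.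
  This is all that the chain rule and the regularised equation use of an element of the closure of the test functions.
\<close>

locale grushin_approx =
  fixes \<gamma> p :: real and \<Omega> :: "((real^'m) \<times> (real^'k)) set"
    and \<phi> :: "(real^'m) \<times> (real^'k) \<Rightarrow> real" and G :: "(real^'m) \<times> (real^'k) \<Rightarrow> (real^'m) \<times> (real^'k)"
    and \<psi> :: "nat \<Rightarrow> (real^'m) \<times> (real^'k) \<Rightarrow> real"
  assumes \<gamma>: "0 \<le> \<gamma>" and p: "1 < p" and \<Omega>_open: "open \<Omega>" and \<Omega>_bounded: "bounded \<Omega>"
    and \<phi>_measurable: "\<phi> \<in> borel_measurable (lebesgue_on \<Omega>)"
    and G_measurable: "G \<in> borel_measurable (lebesgue_on \<Omega>)"
    and \<phi>_integrable: "integrable (lebesgue_on \<Omega>) (\<lambda>z. \<bar>\<phi> z\<bar> powr p)"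
    and G_integrable: "integrable (lebesgue_on \<Omega>) (\<lambda>z. norm (G z) powr p)"
    and \<psi>: "\<And>n. \<psi> n \<in> C0_infinity \<Omega>"
    and \<psi>_AE: "AE z in lebesgue_on \<Omega>. (\<lambda>n. \<psi> n z) \<longlonglongrightarrow> \<phi> z"
    and \<psi>_Lp: "(\<lambda>n. LINT z|lebesgue_on \<Omega>. norm (G z - grushin_grad \<gamma> (\<psi> n) z) powr p) \<longlonglongrightarrow> 0"
begin

abbreviation M where "M \<equiv> lebesgue_on \<Omega>"

lemma \<Omega>_lmeasurable: "\<Omega> \<in> lmeasurable"
  using \<Omega>_bounded \<Omega>_open by (rule lmeasurable_open)

lemma \<Omega>_sets: "\<Omega> \<in> sets lebesgue"
  using \<Omega>_lmeasurable by (rule fmeasurableD)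

lemmas set_integrable_M = set_integrable_lebesgue_on[OF \<Omega>_sets]
lemmas set_integral_M = set_integral_lebesgue_on[OF \<Omega>_sets]

lemma finite_M: "finite_measure M"
  using \<Omega>_lmeasurable by (rule finite_measure_lebesgue_on)

lemma integrable_const_M [simp, intro]: "integrable M (\<lambda>z. c :: 'b :: {banach,second_countable_topology})"
  using finite_measure.integrable_const[OF finite_M] .

lemma continuous_measurable_M:
  "continuous_on UNIV (w :: _ \<Rightarrow> 'b::euclidean_space) \<Longrightarrow> w \<in> borel_measurable M"
  by (intro measurable_restrict_space1 continuous_lebesgue_measurable)

lemma \<psi>_facts:
  "continuous_on UNIV (\<psi> k)" "e \<in> Basis \<Longrightarrow> continuous_on UNIV (partial_deriv e (\<psi> k))" "\<psi> k differentiable (at z)"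
  using \<psi>[of k] by (auto elim!: test_function_facts)

abbreviation D where "D k \<equiv> grushin_grad \<gamma> (\<psi> k)"

lemma D_continuous: "continuous_on UNIV (D k)"
  by (rule grushin_grad_continuous[OF \<gamma> \<psi>_facts(2)])

lemma D_measurable [measurable]: "D k \<in> borel_measurable M"
  by (rule continuous_measurable_M[OF D_continuous])

lemma \<psi>_measurable [measurable]: "\<psi> k \<in> borel_measurable M"
  by (rule continuous_measurable_M[OF \<psi>_facts(1)])

declare \<phi>_measurable [measurable] G_measurable [measurable]

lemma integrable_bounded_M:
  fixes w :: "_ \<Rightarrow> 'b::euclidean_space"
  assumes "w \<in> borel_measurable M" "\<And>z. norm (w z) \<le> C"
  shows "integrable M w"
proof (rule Bochner_Integration.integrable_bound[OF integrable_const_M[of C] assms(1)])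
  show "AE z in M. norm (w z) \<le> norm C"
    by (rule AE_I2) (metis assms(2) abs_ge_self order_trans real_norm_def)
qed

lemma D_bounded: obtains B where "\<And>z. norm (D k z) \<le> B"
proof -
  obtain K where K: "compact K" "\<And>z. z \<notin> K \<Longrightarrow> \<psi> k z = 0" "\<And>e z. z \<notin> K \<Longrightarrow> partial_deriv e (\<psi> k) z = 0"
    using \<psi>[of k] by (auto elim!: test_function_facts)
  show ?thesis
    using bounded_of_compact_support[OF D_continuous K(1), of k] grushin_grad_outside[OF K(3)] that by metis
qed

lemma D_error_integrable: "integrable M (\<lambda>z. norm (D k z - G z) powr p)"
proof -
  obtain B where "\<And>z. norm (D k z) \<le> B" using D_bounded by blast
  then show ?thesis
    using p by (intro integrable_powr_diff_bounded[OF finite_M _ _ G_measurable G_integrable]) auto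
qed

text \<open>
  The weight \<open>B\<^bsup>p-1\<^esup>\<close> belongs to the dual space; it will be the constant 1 or \<open>|G|\<^bsup>p-1\<^esup>\<close>.
\<close>

lemma D_error_weighted:
  assumes "B \<in> borel_measurable M" "\<And>z. 0 \<le> B z" "integrable M (\<lambda>z. B z powr p)"
  shows "integrable M (\<lambda>z. B z powr (p - 1) * norm (D k z - G z))"
    and "(\<lambda>k. LINT z|M. B z powr (p - 1) * norm (D k z - G z)) \<longlonglongrightarrow> 0"
  by (rule integral_mixed_power_tendsto_0[OF p assms];
      (use D_error_integrable \<psi>_Lp in \<open>simp add: norm_minus_commute\<close>)?)+

lemma D_error_L1:
  shows "integrable M (\<lambda>z. norm (D k z - G z))" "(\<lambda>k. LINT z|M. norm (D k z - G z)) \<longlonglongrightarrow> 0"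
  using D_error_weighted[of "\<lambda>z. 1"] by auto

lemma G_powr_integrable: "integrable M (\<lambda>z. norm (G z) powr (p - 1))" "integrable M (\<lambda>z. norm (G z))" "integrable M G"
proof -
  have dom: "integrable M (\<lambda>z. 1 + norm (G z) powr p)" using G_integrable by auto
  show "integrable M (\<lambda>z. norm (G z) powr (p - 1))"
    by (rule Bochner_Integration.integrable_bound[OF dom], measurable, rule AE_I2)
      (use young_powr[of "norm (G _)" 1 1 p] p in \<open>simp add: add.commute\<close>)
  show 1: "integrable M (\<lambda>z. norm (G z))"
    by (rule Bochner_Integration.integrable_bound[OF dom], measurable, rule AE_I2)
      (use young_powr[of 1 "norm (G _)" 1 p] p in \<open>simp add: add.commute\<close>)
  show "integrable M G" by (rule Bochner_Integration.integrable_bound[OF 1]) auto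
qed

text \<open>
  The functions \<open>h(\<psi>\<^sub>k) f\<close> are continuously differentiable, and
  \<open>\<nabla>(h(\<psi>\<^sub>k) f) = h(\<psi>\<^sub>k) \<nabla>f + h'(\<psi>\<^sub>k) f \<nabla>\<psi>\<^sub>k\<close>. The coefficients converge almost everywhere and are bounded,
  and \<open>\<nabla>\<psi>\<^sub>k \<rightarrow> G\<close> in the mean.
\<close>

proposition weak_grad_compose_times:
  fixes f :: "(real^'m) \<times> (real^'k) \<Rightarrow> complex" and h h' :: "real \<Rightarrow> real"
  assumes f: "f \<in> C0_infinity \<Omega>"
    and h: "\<And>t. (h has_real_derivative h' t) (at t)" "continuous_on UNIV h'"
    and hb: "\<And>t. \<bar>h t\<bar> \<le> C" "\<And>t. \<bar>h' t\<bar> \<le> C"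
  shows "weak_grushin_grad \<gamma> \<Omega> (\<lambda>z. h (\<phi> z) *\<^sub>R f z)
    (\<lambda>z. h (\<phi> z) *\<^sub>R grushin_grad \<gamma> f z + complex_multiple (h' (\<phi> z) *\<^sub>R f z) (G z))"
proof -
  obtain K where K: "compact K" "\<And>z. z \<notin> K \<Longrightarrow> f z = 0" "\<And>e z. z \<notin> K \<Longrightarrow> partial_deriv e f z = 0"
    "continuous_on UNIV f" "\<And>e. e \<in> Basis \<Longrightarrow> continuous_on UNIV (partial_deriv e f)" "\<And>z. f differentiable (at z)"
    using f by (auto elim!: test_function_facts)
  have cf: "continuous_on UNIV (grushin_grad \<gamma> f)" by (rule grushin_grad_continuous[OF \<gamma> K(5)])
  obtain B where B: "\<And>z. norm (f z) \<le> B" using bounded_of_compact_support[OF K(4,1,2)] by metis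
  obtain B' where B': "\<And>z. norm (grushin_grad \<gamma> f z) \<le> B'"
    using bounded_of_compact_support[OF cf K(1)] grushin_grad_outside[OF K(3)] by metis
  have C0: "0 \<le> C" using order_trans[OF abs_ge_zero hb(1)] .
  have B0: "0 \<le> B" using order_trans[OF norm_ge_zero B] .
  have ch: "continuous_on UNIV h"
    using h(1) by (auto intro!: continuous_at_imp_continuous_on DERIV_isCont)
  have hm [measurable]: "h \<in> borel_measurable borel" "h' \<in> borel_measurable borel"
    using ch h(2) by (auto intro: borel_measurable_continuous_onI)
  have fm [measurable]: "f \<in> borel_measurable M" "grushin_grad \<gamma> f \<in> borel_measurable M"
    using K(4) cf by (auto intro: continuous_measurable_M)
  have cm [measurable]: "(\<lambda>z. complex_multiple (a z) (X z)) \<in> borel_measurable M"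
    if [measurable]: "a \<in> borel_measurable M" "X \<in> borel_measurable M" for a X
    by (rule borel_measurable_continuous_Pair[OF that])
      (intro bounded_bilinear.continuous_on[OF bounded_bilinear_complex_multiple] continuous_intros)
  define w where "w k z = h (\<psi> k z) *\<^sub>R f z" for k z
  define V where "V z = h (\<phi> z) *\<^sub>R grushin_grad \<gamma> f z + complex_multiple (h' (\<phi> z) *\<^sub>R f z) (G z)" for z
  have hd: "(\<lambda>z. h (\<psi> k z)) differentiable (at z)" for k z
    by (rule partial_deriv_compose_real(1)[OF \<psi>_facts(3) h(1)])
  have hp: "partial_deriv e (\<lambda>z. h (\<psi> k z)) z = h' (\<psi> k z) * partial_deriv e (\<psi> k) z" for e k z
    by (rule partial_deriv_compose_real(2)[OF \<psi>_facts(3) h(1)])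
  have grad_w: "grushin_grad \<gamma> (w k) z = h (\<psi> k z) *\<^sub>R grushin_grad \<gamma> f z + complex_multiple (h' (\<psi> k z) *\<^sub>R f z) (D k z)" for k z
    unfolding w_def using grushin_grad_scaleR_complex[OF hd K(6), of \<gamma> k z]
    by (simp add: grushin_grad_compose_real[OF \<psi>_facts(3) h(1)] complex_multiple_linear)
  have wd: "w k differentiable (at z)" for k z
    unfolding w_def by (rule partial_deriv_scaleR(1)[OF hd K(6)])
  have cw: "continuous_on UNIV (partial_deriv e (w k))" if e: "e \<in> Basis" for e k
  proof -
    have "partial_deriv e (w k) = (\<lambda>z. h (\<psi> k z) *\<^sub>R partial_deriv e f z + (h' (\<psi> k z) * partial_deriv e (\<psi> k) z) *\<^sub>R f z)"
      unfolding w_def by (rule ext) (simp add: partial_deriv_scaleR(2)[OF hd K(6)] hp)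
    then show ?thesis
      using \<psi>_facts(1) \<psi>_facts(2)[OF e] K(4) K(5)[OF e]
      by (auto intro!: continuous_intros continuous_on_compose2[OF ch] continuous_on_compose2[OF h(2)])
  qed
  have wm: "w k \<in> borel_measurable M" for k unfolding w_def by measurable
  have wb: "norm (h t *\<^sub>R f z) \<le> C * B" for t z
    using mult_mono[OF hb(1) B C0 norm_ge_zero] by simp
  have um: "(\<lambda>z. h (\<phi> z) *\<^sub>R f z) \<in> borel_measurable M" by measurable
  have Vm: "V \<in> borel_measurable M" unfolding V_def by measurable
  have h't: "norm (h' t *\<^sub>R f z) \<le> C * B" for t z
    using mult_mono[OF hb(2) B C0 norm_ge_zero] by simp
  have h1: "norm (h t *\<^sub>R grushin_grad \<gamma> f z) \<le> C * B'" for t z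
    using mult_mono[OF hb(1) B' C0 norm_ge_zero] by simp
  have Vint: "integrable M V"
  proof (rule Bochner_Integration.integrable_bound[where f="\<lambda>z. C * B' + C * B * norm (G z)"])
    show "integrable M (\<lambda>z. C * B' + C * B * norm (G z))"
      using G_powr_integrable(2) by auto
    show "AE z in M. norm (V z) \<le> norm (C * B' + C * B * norm (G z))"
    proof (rule AE_I2)
      fix z
      have "norm (V z) \<le> norm (h (\<phi> z) *\<^sub>R grushin_grad \<gamma> f z) + norm (h' (\<phi> z) *\<^sub>R f z) * norm (G z)"
        unfolding V_def using norm_triangle_ineq[of "h (\<phi> z) *\<^sub>R grushin_grad \<gamma> f z"] by (simp only: norm_complex_multiple[symmetric])
      also have "\<dots> \<le> C * B' + C * B * norm (G z)"
        by (intro add_mono h1 mult_right_mono h't norm_ge_zero)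
      finally show "norm (V z) \<le> norm (C * B' + C * B * norm (G z))" by simp
    qed
  qed (rule Vm)
  have "(\<lambda>k. LINT z|M. norm (w k z - h (\<phi> z) *\<^sub>R f z)) \<longlonglongrightarrow> (LINT z|M. 0)"
  proof (rule integral_dominated_convergence[OF _ _ integrable_const_M[of "2 * (C * B)"]])
    show "AE z in M. (\<lambda>k. norm (w k z - h (\<phi> z) *\<^sub>R f z)) \<longlonglongrightarrow> 0"
      using \<psi>_AE
    proof eventually_elim
      case (elim z)
      have "(\<lambda>k. h (\<psi> k z)) \<longlonglongrightarrow> h (\<phi> z)"
        using continuous_on_tendsto_compose[OF ch elim] by simp
      then have "(\<lambda>k. w k z) \<longlonglongrightarrow> h (\<phi> z) *\<^sub>R f z" unfolding w_def by (intro tendsto_intros)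
      then show ?case by (intro tendsto_norm_zero LIM_zero)
    qed
    show "AE z in M. norm (norm (w k z - h (\<phi> z) *\<^sub>R f z)) \<le> 2 * (C * B)" for k
    proof (rule AE_I2)
      fix z
      show "norm (norm (w k z - h (\<phi> z) *\<^sub>R f z)) \<le> 2 * (C * B)"
        using norm_triangle_ineq4[of "w k z" "h (\<phi> z) *\<^sub>R f z"] wb[of "\<psi> k z" z] wb[of "\<phi> z" z]
        unfolding w_def real_norm_def abs_norm_cancel by linarith
    qed
  qed (use wm um in measurable)
  then have conv1: "(\<lambda>k. LINT z|M. norm (w k z - h (\<phi> z) *\<^sub>R f z)) \<longlonglongrightarrow> 0" by simp
  \<comment> \<open>The error that comes from the coefficients alone, with \<open>\<nabla>\<psi>\<^sub>k\<close> replaced by \<open>G\<close>.\<close>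
  define r where "r k z = norm (h (\<psi> k z) *\<^sub>R grushin_grad \<gamma> f z - h (\<phi> z) *\<^sub>R grushin_grad \<gamma> f z)
      + norm (h' (\<psi> k z) *\<^sub>R f z - h' (\<phi> z) *\<^sub>R f z) * norm (G z)" for k z
  have rm: "r k \<in> borel_measurable M" for k unfolding r_def by measurable
  have r_le: "norm (r k z) \<le> 2 * (C * B') + 2 * (C * B) * norm (G z)" for k z
  proof -
    have "norm (h (\<psi> k z) *\<^sub>R grushin_grad \<gamma> f z - h (\<phi> z) *\<^sub>R grushin_grad \<gamma> f z) \<le> 2 * (C * B')"
      using norm_triangle_ineq4[of "h (\<psi> k z) *\<^sub>R grushin_grad \<gamma> f z" "h (\<phi> z) *\<^sub>R grushin_grad \<gamma> f z"]
        h1[of "\<psi> k z" z] h1[of "\<phi> z" z] by linarith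
    moreover have "norm (h' (\<psi> k z) *\<^sub>R f z - h' (\<phi> z) *\<^sub>R f z) * norm (G z) \<le> 2 * (C * B) * norm (G z)"
      using norm_triangle_ineq4[of "h' (\<psi> k z) *\<^sub>R f z" "h' (\<phi> z) *\<^sub>R f z"] h't[of "\<psi> k z" z] h't[of "\<phi> z" z]
      by (intro mult_right_mono) auto
    moreover have "norm (r k z) = r k z" by (simp add: r_def)
    ultimately show ?thesis unfolding r_def by linarith
  qed
  have dom: "integrable M (\<lambda>z. 2 * (C * B') + 2 * (C * B) * norm (G z))"
    using G_powr_integrable(2) by auto
  have rint: "integrable M (r k)" for k
    by (rule Bochner_Integration.integrable_bound[OF dom rm]) (rule AE_I2, rule order_trans[OF r_le], simp)
  have "(\<lambda>k. LINT z|M. r k z) \<longlonglongrightarrow> (LINT z|M. 0)"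
  proof (rule integral_dominated_convergence[OF _ rm dom])
    show "AE z in M. (\<lambda>k. r k z) \<longlonglongrightarrow> 0"
      using \<psi>_AE
    proof eventually_elim
      case (elim z)
      have "(\<lambda>k. h (\<psi> k z)) \<longlonglongrightarrow> h (\<phi> z)" "(\<lambda>k. h' (\<psi> k z)) \<longlonglongrightarrow> h' (\<phi> z)"
        using continuous_on_tendsto_compose[OF ch elim] continuous_on_tendsto_compose[OF h(2) elim] by auto
      then have "(\<lambda>k. r k z) \<longlonglongrightarrow> norm (h (\<phi> z) *\<^sub>R grushin_grad \<gamma> f z - h (\<phi> z) *\<^sub>R grushin_grad \<gamma> f z)
          + norm (h' (\<phi> z) *\<^sub>R f z - h' (\<phi> z) *\<^sub>R f z) * norm (G z)"
        unfolding r_def by (intro tendsto_intros)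
      then show ?case by simp
    qed
  qed (use r_le in auto)
  then have r0: "(\<lambda>k. LINT z|M. r k z) \<longlonglongrightarrow> 0" by simp
  have diff_le: "norm (grushin_grad \<gamma> (w k) z - V z) \<le> r k z + C * B * norm (D k z - G z)" for k z
  proof -
    have eq: "grushin_grad \<gamma> (w k) z - V z
      = (h (\<psi> k z) *\<^sub>R grushin_grad \<gamma> f z - h (\<phi> z) *\<^sub>R grushin_grad \<gamma> f z)
        + complex_multiple (h' (\<psi> k z) *\<^sub>R f z - h' (\<phi> z) *\<^sub>R f z) (G z)
        + complex_multiple (h' (\<psi> k z) *\<^sub>R f z) (D k z - G z)"
      unfolding grad_w V_def complex_multiple_linear by simp
    have "norm (grushin_grad \<gamma> (w k) z - V z) \<le> r k z + norm (h' (\<psi> k z) *\<^sub>R f z) * norm (D k z - G z)"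
      unfolding eq r_def norm_complex_multiple[symmetric]
      by (rule order_trans[OF norm_triangle_ineq add_right_mono[OF norm_triangle_ineq]])
    also have "\<dots> \<le> r k z + C * B * norm (D k z - G z)"
      by (intro add_left_mono mult_right_mono h't norm_ge_zero)
    finally show ?thesis .
  qed
  have gm: "grushin_grad \<gamma> (w k) \<in> borel_measurable M" for k
    unfolding grad_w[abs_def] by measurable
  have eint: "integrable M (\<lambda>z. r k z + C * B * norm (D k z - G z))" for k
    using rint D_error_L1(1) by auto
  have dint: "integrable M (\<lambda>z. grushin_grad \<gamma> (w k) z - V z)" for k
  proof (rule Bochner_Integration.integrable_bound[OF eint[of k]])
    show "(\<lambda>z. grushin_grad \<gamma> (w k) z - V z) \<in> borel_measurable M" using gm Vm by measurable
    show "AE z in M. norm (grushin_grad \<gamma> (w k) z - V z) \<le> norm (r k z + C * B * norm (D k z - G z))"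
      using order_trans[OF diff_le abs_ge_self] by simp
  qed
  have gint: "integrable M (grushin_grad \<gamma> (w k))" for k
    using Bochner_Integration.integrable_add[OF dint[of k] Vint] by simp
  have conv2: "(\<lambda>k. LINT z|M. norm (grushin_grad \<gamma> (w k) z - V z)) \<longlonglongrightarrow> 0"
  proof (rule tendsto_sandwich[OF always_eventually always_eventually tendsto_const])
    show "\<forall>k. 0 \<le> (LINT z|M. norm (grushin_grad \<gamma> (w k) z - V z))"
      by (intro allI integral_nonneg_AE) auto
    show "\<forall>k. (LINT z|M. norm (grushin_grad \<gamma> (w k) z - V z)) \<le> (LINT z|M. r k z) + C * B * (LINT z|M. norm (D k z - G z))"
    proof
      fix k
      have "(LINT z|M. norm (grushin_grad \<gamma> (w k) z - V z)) \<le> (LINT z|M. r k z + C * B * norm (D k z - G z))"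
        by (intro integral_mono eint diff_le integrable_norm dint)
      then show "(LINT z|M. norm (grushin_grad \<gamma> (w k) z - V z)) \<le> (LINT z|M. r k z) + C * B * (LINT z|M. norm (D k z - G z))"
        using rint D_error_L1(1) by simp
    qed
    have "(\<lambda>k. (LINT z|M. r k z) + C * B * (LINT z|M. norm (D k z - G z))) \<longlonglongrightarrow> 0 + C * B * 0"
      by (intro tendsto_intros r0 D_error_L1(2))
    then show "(\<lambda>k. (LINT z|M. r k z) + C * B * (LINT z|M. norm (D k z - G z))) \<longlonglongrightarrow> 0" by simp
  qed
  have "weak_grushin_grad \<gamma> \<Omega> (\<lambda>z. h (\<phi> z) *\<^sub>R f z) V"
  proof (rule weak_grushin_grad_limit[OF \<gamma> \<Omega>_open wd cw]; (unfold set_integrable_M set_integral_M)?)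
    show "integrable M (w k)" for k
      by (rule integrable_bounded_M[OF wm, of _ "C * B"]) (simp only: w_def wb)
    show "integrable M (\<lambda>z. h (\<phi> z) *\<^sub>R f z)" by (rule integrable_bounded_M[OF um wb])
  qed (use gint Vint conv1 conv2 in auto)
  then show ?thesis by (simp add: V_def[abs_def])
qed

end

section \<open>The gradient of the quotient\<close>

text \<open>
  A bounded \<open>C\<^sup>1\<close> function with bounded derivative that equals \<open>1 / t\<close> for \<open>t \<ge> c\<close>. The exponential has value
  \<open>1 / c\<close> and slope \<open>-1 / c\<^sup>2\<close> at \<open>t = c\<close>, so the branches fit together.
\<close>

definition bounded_reciprocal :: "real \<Rightarrow> real \<Rightarrow> real" where
  "bounded_reciprocal c t = (if t \<le> c then (2 - exp ((t - c) / c)) / c else 1 / t)"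

definition bounded_reciprocal_deriv :: "real \<Rightarrow> real \<Rightarrow> real" where
  "bounded_reciprocal_deriv c t = (if t \<le> c then - exp ((t - c) / c) / c\<^sup>2 else - 1 / t\<^sup>2)"

lemma bounded_reciprocal_has_derivative:
  assumes c: "0 < c"
  shows "(bounded_reciprocal c has_real_derivative bounded_reciprocal_deriv c t) (at t)"
proof -
  have "((\<lambda>t. if t \<in> {..c} then (2 - exp ((t - c) / c)) / c else 1 / t) has_derivative
     (if t \<in> {..c} then \<lambda>v. (- exp ((t - c) / c) / c\<^sup>2) * v else (\<lambda>v. (- 1 / t\<^sup>2) * v))) (at t within {..c} \<union> {c<..})"
  proof (rule has_derivative_If_within_closures)
    have "((\<lambda>t. (2 - exp ((t - c) / c)) / c) has_real_derivative (- exp ((t - c) / c) / c\<^sup>2)) (at t)"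
      using c by (auto intro!: derivative_eq_intros simp: field_simps power2_eq_square)
    then show "((\<lambda>t. (2 - exp ((t - c) / c)) / c) has_derivative (\<lambda>v. (- exp ((t - c) / c) / c\<^sup>2) * v))
        (at t within {..c} \<union> (closure {..c} \<inter> closure {c<..}))"
      unfolding has_field_derivative_def by (rule has_derivative_at_withinI)
    show "((\<lambda>t. 1 / t) has_derivative (\<lambda>v. (- 1 / t\<^sup>2) * v))
        (at t within {c<..} \<union> (closure {..c} \<inter> closure {c<..}))"
      if "t \<in> {c<..} \<union> (closure {..c} \<inter> closure {c<..})"
    proof -
      have "0 < t" using that c by auto
      then have "((\<lambda>t. 1 / t) has_real_derivative (- 1 / t\<^sup>2)) (at t)"
        by (auto intro!: derivative_eq_intros simp: field_simps power2_eq_square)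
      then show ?thesis unfolding has_field_derivative_def by (rule has_derivative_at_withinI)
    qed
  qed (use c in \<open>auto simp: power2_eq_square\<close>)
  moreover have "{..c} \<union> {c<..} = UNIV" by auto
  moreover have "(\<lambda>t. if t \<in> {..c} then (2 - exp ((t - c) / c)) / c else 1 / t) = bounded_reciprocal c"
    by (auto simp: bounded_reciprocal_def)
  moreover have "(if t \<in> {..c} then \<lambda>v. (- exp ((t - c) / c) / c\<^sup>2) * v else (\<lambda>v. (- 1 / t\<^sup>2) * v))
      = (*) (bounded_reciprocal_deriv c t)"
    by (auto simp: bounded_reciprocal_deriv_def)
  ultimately show ?thesis by (simp add: has_field_derivative_def)
qed

lemma bounded_reciprocal_deriv_continuous:
  assumes c: "0 < c"
  shows "continuous_on UNIV (bounded_reciprocal_deriv c)"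
  unfolding bounded_reciprocal_deriv_def[abs_def]
  using c by (intro continuous_on_cases_le continuous_intros) auto

lemma bounded_reciprocal_bounds:
  assumes c: "0 < c"
  shows "\<bar>bounded_reciprocal c t\<bar> \<le> 2 / c + 1 / c\<^sup>2" "\<bar>bounded_reciprocal_deriv c t\<bar> \<le> 2 / c + 1 / c\<^sup>2"
proof -
  have e: "0 < exp ((t - c) / c)" "t \<le> c \<Longrightarrow> exp ((t - c) / c) \<le> 1"
    using c by (auto simp: field_simps)
  have "\<bar>bounded_reciprocal c t\<bar> \<le> 2 / c"
  proof (cases "t \<le> c")
    case True
    then have "bounded_reciprocal c t = (2 - exp ((t - c) / c)) / c" by (simp add: bounded_reciprocal_def)
    moreover have "0 \<le> (2 - exp ((t - c) / c)) / c"
      using e(2)[OF True] c by (intro divide_nonneg_pos) linarith+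
    moreover have "(2 - exp ((t - c) / c)) / c \<le> 2 / c" using e c by (intro divide_right_mono) auto
    ultimately show ?thesis by simp
  next
    case False
    then have "1 / t \<le> 1 / c" using c by (simp add: frac_le)
    also have "\<dots> \<le> 2 / c" using c by (simp add: divide_right_mono)
    finally show ?thesis using False c by (simp add: bounded_reciprocal_def)
  qed
  moreover have "0 \<le> 1 / c\<^sup>2" by simp
  ultimately show "\<bar>bounded_reciprocal c t\<bar> \<le> 2 / c + 1 / c\<^sup>2" by linarith
  have "\<bar>bounded_reciprocal_deriv c t\<bar> \<le> 1 / c\<^sup>2"
  proof (cases "t \<le> c")
    case True
    have "exp ((t - c) / c) / c\<^sup>2 \<le> 1 / c\<^sup>2" using e True by (intro divide_right_mono) auto
    then show ?thesis using True by (simp add: bounded_reciprocal_deriv_def)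
  next
    case False
    then have "c\<^sup>2 \<le> t\<^sup>2" using c by (intro power_mono) auto
    then have "1 / t\<^sup>2 \<le> 1 / c\<^sup>2" using c by (simp add: frac_le)
    then show ?thesis using False by (simp add: bounded_reciprocal_deriv_def)
  qed
  moreover have "0 \<le> 2 / c" using c by simp
  ultimately show "\<bar>bounded_reciprocal_deriv c t\<bar> \<le> 2 / c + 1 / c\<^sup>2" by linarith
qed

lemma bounded_reciprocal_above:
  assumes "0 < c" "c \<le> t"
  shows "bounded_reciprocal c t = 1 / t" "bounded_reciprocal_deriv c t = - (1 / t\<^sup>2)"
  using assms by (auto simp: bounded_reciprocal_def bounded_reciprocal_deriv_def)

text \<open>
  The pieces are the sets \<open>{\<phi> \<ge> 1 / (n + 1)}\<close>, which exhaust \<open>\<Omega>\<close> up to a null set since \<open>\<phi> > 0\<close>.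
\<close>

lemma (in grushin_approx) quotient_has_grushin_grad:
  assumes f: "f \<in> C0_infinity \<Omega>" and pos: "AE z in lebesgue_on \<Omega>. 0 < \<phi> z"
  shows "has_grushin_grad \<gamma> \<Omega> (\<lambda>z. f z / complex_of_real (\<phi> z))
    (\<lambda>z. (1 / \<phi> z) *\<^sub>R grushin_grad \<gamma> f z - complex_multiple ((1 / (\<phi> z)\<^sup>2) *\<^sub>R f z) (G z))"
proof -
  define c where "c n = 1 / real (Suc n)" for n
  have c: "0 < c n" for n by (simp add: c_def)
  define A where "A n = {z \<in> space (lebesgue_on \<Omega>). c n \<le> \<phi> z}" for n
  have AM: "A n \<in> sets (lebesgue_on \<Omega>)" for n unfolding A_def by measurable
  define v where "v n z = bounded_reciprocal (c n) (\<phi> z) *\<^sub>R f z" for n z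
  define V where "V n z = bounded_reciprocal (c n) (\<phi> z) *\<^sub>R grushin_grad \<gamma> f z
      + complex_multiple (bounded_reciprocal_deriv (c n) (\<phi> z) *\<^sub>R f z) (G z)" for n z
  have "A n \<in> sets lebesgue \<and> A n \<subseteq> \<Omega>" for n
    using AM[of n] \<Omega>_sets by (auto simp: sets_restrict_space_iff)
  moreover have "AE z in lebesgue. z \<in> \<Omega> \<longrightarrow> (\<exists>n. z \<in> A n)"
  proof -
    have "AE z in lebesgue_on \<Omega>. \<exists>n. c n \<le> \<phi> z"
      using pos
    proof eventually_elim
      case (elim z)
      then show ?case using reals_Archimedean[of "\<phi> z"] by (auto simp: c_def divide_inverse intro: less_imp_le)
    qed
    then have "AE z in lebesgue. z \<in> \<Omega> \<longrightarrow> (\<exists>n. c n \<le> \<phi> z)"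
      using \<Omega>_sets by (simp add: AE_restrict_space_iff)
    then show ?thesis by eventually_elim (auto simp: A_def)
  qed
  moreover have "weak_grushin_grad \<gamma> \<Omega> (v n) (V n)" for n
    unfolding v_def V_def
    by (rule weak_grad_compose_times[OF f bounded_reciprocal_has_derivative[OF c]
          bounded_reciprocal_deriv_continuous[OF c] bounded_reciprocal_bounds[OF c]])
  moreover have "f z / complex_of_real (\<phi> z) = v n z \<and>
      (1 / \<phi> z) *\<^sub>R grushin_grad \<gamma> f z - complex_multiple ((1 / (\<phi> z)\<^sup>2) *\<^sub>R f z) (G z) = V n z" if z: "z \<in> A n" for n z
  proof -
    have *: "c n \<le> \<phi> z" using z by (simp add: A_def)
    show ?thesis
      unfolding v_def V_def bounded_reciprocal_above[OF c *]
      by (simp add: complex_multiple_linear scaleR_conv_of_real divide_inverse mult.commute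
          bounded_bilinear.minus_left[OF bounded_bilinear_complex_multiple])
  qed
  ultimately show ?thesis
    unfolding has_grushin_grad_def by (intro exI[of _ A] exI[of _ v] exI[of _ V]) auto
qed

section \<open>Testing the equation with a regularised quotient\<close>

lemma power2_powr_half: "0 \<le> r \<Longrightarrow> (r\<^sup>2) powr (a / 2) = r powr a" for r a :: real
  by (cases "r = 0") (auto simp: powr_powr powr_realpow[symmetric] simp flip: powr_numeral)

text \<open>
  This bounds \<open>\<nabla>(|f|\<^sup>2 + \<delta>\<^sup>2)\<^bsup>p/2\<^esup>\<close> uniformly in \<open>\<delta>\<close>. For \<open>p < 2\<close> the power alone is unbounded near the zeros of \<open>f\<close>;
  the factor \<open>r = |f|\<close> compensates for it.
\<close>

lemma regularised_power_bound:
  fixes r B \<delta> p :: real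
  assumes "0 \<le> r" "r \<le> B" "0 < \<delta>" "\<delta> \<le> 1" "1 < p"
  shows "(r\<^sup>2 + \<delta>\<^sup>2) powr (p / 2 - 1) * r \<le> (B\<^sup>2 + 1) powr ((p - 1) / 2)"
proof -
  have pos: "0 < r\<^sup>2 + \<delta>\<^sup>2" using assms by (simp add: add_nonneg_pos)
  have "r = (r\<^sup>2) powr (1 / 2)" using assms power2_powr_half[of r 1] by simp
  also have "\<dots> \<le> (r\<^sup>2 + \<delta>\<^sup>2) powr (1 / 2)" by (intro powr_mono2) auto
  finally have "(r\<^sup>2 + \<delta>\<^sup>2) powr (p / 2 - 1) * r \<le> (r\<^sup>2 + \<delta>\<^sup>2) powr (p / 2 - 1) * (r\<^sup>2 + \<delta>\<^sup>2) powr (1 / 2)"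
    by (intro mult_left_mono) auto
  also have "\<dots> = (r\<^sup>2 + \<delta>\<^sup>2) powr ((p - 1) / 2)"
    using pos by (simp add: powr_add[symmetric] field_simps)
  also have "\<dots> \<le> (B\<^sup>2 + 1) powr ((p - 1) / 2)"
  proof (rule powr_mono2)
    have "r\<^sup>2 \<le> B\<^sup>2" "\<delta>\<^sup>2 \<le> 1" using assms by (auto intro!: power_mono power_le_one)
    then show "r\<^sup>2 + \<delta>\<^sup>2 \<le> B\<^sup>2 + 1" by simp
  qed (use assms in auto)
  finally show ?thesis .
qed

text \<open>
  A smooth approximation of \<open>(|t| + \<epsilon>)\<^bsup>1-p\<^esup>\<close>. The number \<open>\<delta>\<close> smooths the absolute value and tends to 0 first; a fixed
  \<open>\<epsilon>\<close> keeps the function bounded together with its derivative. Taking \<open>(t\<^sup>2 + \<epsilon>\<^sup>2)\<^bsup>(1-p)/2\<^esup>\<close> instead would leave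
  an extra factor \<open>\<phi> / sqrt(\<phi>\<^sup>2 + \<epsilon>\<^sup>2)\<close> in the term \<open>|\<zeta>|\<^sup>p\<close> and spoil the bound that is uniform in \<open>\<epsilon>\<close>.
\<close>

definition smooth_abs_reciprocal :: "real \<Rightarrow> real \<Rightarrow> real \<Rightarrow> real \<Rightarrow> real" where
  "smooth_abs_reciprocal p \<epsilon> \<delta> t = (sqrt (t\<^sup>2 + \<delta>\<^sup>2) + \<epsilon>) powr (1 - p)"

definition smooth_abs_reciprocal_deriv :: "real \<Rightarrow> real \<Rightarrow> real \<Rightarrow> real \<Rightarrow> real" where
  "smooth_abs_reciprocal_deriv p \<epsilon> \<delta> t = (1 - p) * (sqrt (t\<^sup>2 + \<delta>\<^sup>2) + \<epsilon>) powr (- p) * (t / sqrt (t\<^sup>2 + \<delta>\<^sup>2))"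

lemma smooth_abs_reciprocal_has_derivative:
  assumes "0 < \<delta>" "0 < \<epsilon>"
  shows "(smooth_abs_reciprocal p \<epsilon> \<delta> has_real_derivative smooth_abs_reciprocal_deriv p \<epsilon> \<delta> t) (at t)"
proof -
  have pos: "0 < t\<^sup>2 + \<delta>\<^sup>2" using assms by (simp add: add_nonneg_pos)
  have "((\<lambda>t. t\<^sup>2 + \<delta>\<^sup>2) has_real_derivative 2 * t) (at t)"
    by (auto intro!: derivative_eq_intros)
  from DERIV_chain2[OF DERIV_real_sqrt[OF pos] this]
  have "((\<lambda>t. sqrt (t\<^sup>2 + \<delta>\<^sup>2)) has_real_derivative inverse (sqrt (t\<^sup>2 + \<delta>\<^sup>2)) / 2 * (2 * t)) (at t)" .
  moreover have "inverse s / 2 * (2 * t) = t / s" for s :: real by (simp add: field_simps)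
  ultimately have "((\<lambda>t. sqrt (t\<^sup>2 + \<delta>\<^sup>2)) has_real_derivative t / sqrt (t\<^sup>2 + \<delta>\<^sup>2)) (at t)" by metis
  from DERIV_add[OF this DERIV_const[of \<epsilon>]]
  have "((\<lambda>t. sqrt (t\<^sup>2 + \<delta>\<^sup>2) + \<epsilon>) has_real_derivative t / sqrt (t\<^sup>2 + \<delta>\<^sup>2)) (at t)" by simp
  from DERIV_fun_powr[OF this, of "1 - p"] show ?thesis
    using assms by (simp add: smooth_abs_reciprocal_def[abs_def] smooth_abs_reciprocal_deriv_def add_nonneg_pos)
qed

lemma smooth_abs_reciprocal_bounds:
  assumes "0 < \<delta>" "0 < \<epsilon>" "1 < p"
  shows "\<bar>smooth_abs_reciprocal p \<epsilon> \<delta> t\<bar> \<le> \<epsilon> powr (1 - p)"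
    "\<bar>smooth_abs_reciprocal_deriv p \<epsilon> \<delta> t\<bar> \<le> (p - 1) * \<epsilon> powr (- p)"
proof -
  have pos: "0 < t\<^sup>2 + \<delta>\<^sup>2" using assms by (simp add: add_nonneg_pos)
  have le: "(sqrt (t\<^sup>2 + \<delta>\<^sup>2) + \<epsilon>) powr a \<le> \<epsilon> powr a" if "a \<le> 0" for a
    using that assms pos by (intro powr_mono2') auto
  show "\<bar>smooth_abs_reciprocal p \<epsilon> \<delta> t\<bar> \<le> \<epsilon> powr (1 - p)"
    using le[of "1 - p"] assms by (simp add: smooth_abs_reciprocal_def)
  have "\<bar>t\<bar> \<le> sqrt (t\<^sup>2 + \<delta>\<^sup>2)" by (rule real_le_rsqrt) simp
  then have "\<bar>t / sqrt (t\<^sup>2 + \<delta>\<^sup>2)\<bar> \<le> 1" using pos by (simp add: divide_le_eq)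
  then have "\<bar>(1 - p) * (sqrt (t\<^sup>2 + \<delta>\<^sup>2) + \<epsilon>) powr (- p)\<bar> * \<bar>t / sqrt (t\<^sup>2 + \<delta>\<^sup>2)\<bar> \<le> (p - 1) * \<epsilon> powr (- p) * 1"
    using le[of "- p"] assms by (intro mult_mono) (auto simp: abs_mult)
  then show "\<bar>smooth_abs_reciprocal_deriv p \<epsilon> \<delta> t\<bar> \<le> (p - 1) * \<epsilon> powr (- p)"
    by (simp only: smooth_abs_reciprocal_deriv_def abs_mult mult_1_right)
qed

lemma smooth_abs_reciprocal_tendsto:
  assumes t: "(t \<longlonglongrightarrow> x)" and \<delta>: "\<delta> \<longlonglongrightarrow> 0" and x: "0 < x" and \<epsilon>: "0 < \<epsilon>"
  shows "(\<lambda>k. smooth_abs_reciprocal p \<epsilon> (\<delta> k) (t k)) \<longlonglongrightarrow> (x + \<epsilon>) powr (1 - p)"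
    "(\<lambda>k. smooth_abs_reciprocal_deriv p \<epsilon> (\<delta> k) (t k)) \<longlonglongrightarrow> (1 - p) * (x + \<epsilon>) powr (- p)"
proof -
  have "(\<lambda>k. sqrt ((t k)\<^sup>2 + (\<delta> k)\<^sup>2)) \<longlonglongrightarrow> sqrt (x\<^sup>2 + 0\<^sup>2)"
    by (intro tendsto_intros t \<delta>)
  then have s: "(\<lambda>k. sqrt ((t k)\<^sup>2 + (\<delta> k)\<^sup>2)) \<longlonglongrightarrow> x" using x by simp
  show "(\<lambda>k. smooth_abs_reciprocal p \<epsilon> (\<delta> k) (t k)) \<longlonglongrightarrow> (x + \<epsilon>) powr (1 - p)"
    unfolding smooth_abs_reciprocal_def using x \<epsilon> by (intro tendsto_intros s) auto
  have "(\<lambda>k. smooth_abs_reciprocal_deriv p \<epsilon> (\<delta> k) (t k)) \<longlonglongrightarrow> (1 - p) * (x + \<epsilon>) powr (- p) * (x / x)"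
    unfolding smooth_abs_reciprocal_deriv_def using x \<epsilon> by (intro tendsto_intros s t) auto
  then show "(\<lambda>k. smooth_abs_reciprocal_deriv p \<epsilon> (\<delta> k) (t k)) \<longlonglongrightarrow> (1 - p) * (x + \<epsilon>) powr (- p)"
    using x by simp
qed

text \<open>
  A smooth substitute for \<open>|f|\<^sup>p\<close> as a function of \<open>r = |f|\<close>. Subtracting \<open>\<delta>\<^sup>p\<close> makes it vanish where \<open>f\<close> does, which
  keeps the support compact.
\<close>

definition regularised_power :: "real \<Rightarrow> real \<Rightarrow> real \<Rightarrow> real" where
  "regularised_power p \<delta> r = (r\<^sup>2 + \<delta>\<^sup>2) powr (p / 2) - \<delta> powr p"

lemma regularised_power_zero: "0 \<le> \<delta> \<Longrightarrow> regularised_power p \<delta> 0 = 0"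
  by (simp add: regularised_power_def power2_powr_half)

lemma regularised_power_bounds:
  assumes "0 \<le> r" "r \<le> B" "0 < \<delta>" "\<delta> \<le> 1" "1 < p"
  shows "\<bar>regularised_power p \<delta> r\<bar> \<le> (B\<^sup>2 + 1) powr (p / 2)"
proof -
  have "(\<delta>\<^sup>2) powr (p / 2) \<le> (r\<^sup>2 + \<delta>\<^sup>2) powr (p / 2)" using assms by (intro powr_mono2) auto
  then have "0 \<le> regularised_power p \<delta> r"
    using assms by (simp add: regularised_power_def power2_powr_half)
  moreover have "(r\<^sup>2 + \<delta>\<^sup>2) powr (p / 2) \<le> (B\<^sup>2 + 1) powr (p / 2)"
  proof (rule powr_mono2)
    have "r\<^sup>2 \<le> B\<^sup>2" "\<delta>\<^sup>2 \<le> 1" using assms by (auto intro!: power_mono power_le_one)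
    then show "r\<^sup>2 + \<delta>\<^sup>2 \<le> B\<^sup>2 + 1" by simp
  qed (use assms in auto)
  moreover have "0 \<le> \<delta> powr p" by simp
  ultimately show ?thesis unfolding regularised_power_def by linarith
qed

lemma regularised_power_tendsto:
  assumes "\<delta> \<longlonglongrightarrow> 0" "\<And>k. 0 < \<delta> k" "0 \<le> r" "1 < p"
  shows "(\<lambda>k. regularised_power p (\<delta> k) r) \<longlonglongrightarrow> r powr p"
proof -
  have "(\<lambda>k. regularised_power p (\<delta> k) r) \<longlonglongrightarrow> (r\<^sup>2 + 0\<^sup>2) powr (p / 2) - 0 powr p"
    unfolding regularised_power_def using assms
    by (intro tendsto_intros) (auto intro!: always_eventually less_imp_le)
  then show ?thesis using assms by (simp add: power2_powr_half)
qed

lemma (in grushin_approx) regularised_test_function: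
  fixes k :: nat
  assumes f: "f \<in> C0_infinity \<Omega>" and \<delta>: "0 < \<delta>" and \<epsilon>: "0 < \<epsilon>"
  defines "w \<equiv> \<lambda>z. regularised_power p \<delta> (norm (f z)) * smooth_abs_reciprocal p \<epsilon> \<delta> (\<psi> k z)"
  shows "w \<in> C0_infinity \<Omega>"
    and "grushin_grad \<gamma> w z
      = (smooth_abs_reciprocal p \<epsilon> \<delta> (\<psi> k z) * (p * ((norm (f z))\<^sup>2 + \<delta>\<^sup>2) powr (p / 2 - 1))) *\<^sub>R real_pairing (f z) (grushin_grad \<gamma> f z)
        + (regularised_power p \<delta> (norm (f z)) * smooth_abs_reciprocal_deriv p \<epsilon> \<delta> (\<psi> k z)) *\<^sub>R D k z"
proof -
  obtain K where K: "compact K" "K \<subseteq> \<Omega>" "\<And>z. z \<notin> K \<Longrightarrow> f z = 0" and fC: "\<And>n. C_k n f"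
    using C0_infinityE[OF f] by blast
  have \<psi>C: "\<And>n. C_k n (\<psi> k)" using \<psi>[of k] by (auto elim: C0_infinityE)
  have fd: "f differentiable (at z)" for z using C_k_continuous(3)[OF fC] .
  have re: "(\<lambda>z. Re (f z)) \<in> smooth_class" and im: "(\<lambda>z. Im (f z)) \<in> smooth_class"
    using C_k_bounded_linear[OF bounded_linear_Re fC] C_k_bounded_linear[OF bounded_linear_Im fC]
    by (auto intro: smooth_base)
  have w_eq: "w = (\<lambda>z. ((Re (f z) * Re (f z) + Im (f z) * Im (f z) + \<delta>\<^sup>2) powr (p / 2) + - (\<delta> powr p))
      * (((\<psi> k z * \<psi> k z + \<delta>\<^sup>2) powr (1 / 2) + \<epsilon>) powr (1 - p)))"
    by (rule ext) (simp add: w_def regularised_power_def smooth_abs_reciprocal_def cmod_power2 powr_half_sqrt flip: power2_eq_square)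
  have "w \<in> smooth_class"
    unfolding w_eq
    by (intro smooth_mult smooth_add smooth_powr smooth_const re im smooth_base[OF \<psi>C])
      (use \<delta> \<epsilon> in \<open>auto simp: add_nonneg_pos\<close>)
  then have "C_k n w" for n by (simp add: smooth_class_iff)
  then show "w \<in> C0_infinity \<Omega>"
    by (rule C0_infinityI[OF _ K(1,2)]) (use \<delta> in \<open>simp add: w_def K(3) regularised_power_zero\<close>)
  \<comment> \<open>Written through the squared modulus, which is differentiable also at the zeros of \<open>f\<close>.\<close>
  define q where "q r = (r + \<delta>\<^sup>2) powr (p / 2) - \<delta> powr p" for r
  have qd: "(q has_real_derivative (p / 2 * (r + \<delta>\<^sup>2) powr (p / 2 - 1))) (at r)" if "0 \<le> r" for r
  proof -
    have "0 < r + \<delta>\<^sup>2" using that \<delta> by (simp add: add_nonneg_pos)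
    moreover have "((\<lambda>r. r + \<delta>\<^sup>2) has_real_derivative 1) (at r)" by (auto intro!: derivative_eq_intros)
    ultimately have "((\<lambda>r. (r + \<delta>\<^sup>2) powr (p / 2)) has_real_derivative (p / 2 * (r + \<delta>\<^sup>2) powr (p / 2 - 1))) (at r)"
      using DERIV_fun_powr[of "\<lambda>r. r + \<delta>\<^sup>2" 1 r "p / 2"] by simp
    from DERIV_diff[OF this DERIV_const[of "\<delta> powr p"]] show ?thesis by (simp add: q_def[abs_def])
  qed
  have g_eq: "(\<lambda>z. regularised_power p \<delta> (norm (f z))) = (\<lambda>z. q ((norm (f z))\<^sup>2))"
    by (simp add: q_def regularised_power_def)
  have gd: "(\<lambda>z. regularised_power p \<delta> (norm (f z))) differentiable (at z)"
    unfolding g_eq by (rule partial_deriv_compose_real(1)[OF grushin_grad_norm_squared(1)[OF fd] qd]) simp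
  have gg: "grushin_grad \<gamma> (\<lambda>z. regularised_power p \<delta> (norm (f z))) z
      = (p * ((norm (f z))\<^sup>2 + \<delta>\<^sup>2) powr (p / 2 - 1)) *\<^sub>R real_pairing (f z) (grushin_grad \<gamma> f z)"
    unfolding g_eq
    by (subst grushin_grad_compose_real[OF grushin_grad_norm_squared(1)[OF fd] qd])
      (simp_all add: grushin_grad_norm_squared(2)[OF fd])
  note hd = smooth_abs_reciprocal_has_derivative[OF \<delta> \<epsilon>, of p]
  show "grushin_grad \<gamma> w z
      = (smooth_abs_reciprocal p \<epsilon> \<delta> (\<psi> k z) * (p * ((norm (f z))\<^sup>2 + \<delta>\<^sup>2) powr (p / 2 - 1))) *\<^sub>R real_pairing (f z) (grushin_grad \<gamma> f z)
        + (regularised_power p \<delta> (norm (f z)) * smooth_abs_reciprocal_deriv p \<epsilon> \<delta> (\<psi> k z)) *\<^sub>R D k z"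
    unfolding w_def grushin_grad_mult[OF gd partial_deriv_compose_real(1)[OF \<psi>_facts(3) hd]] gg
      grushin_grad_compose_real[OF \<psi>_facts(3) hd]
    by simp
qed


text \<open>
  The functions \<open>w\<^sub>k\<close>, built from \<open>\<psi>\<^sub>k\<close> and \<open>\<delta>\<^sub>k = 1 / (k + 1)\<close>, are test functions. In \<open>|G|\<^bsup>p-2\<^esup> G \<cdot> \<nabla>w\<^sub>k\<close> the gradient of
  \<open>\<psi>\<^sub>k\<close> is split as \<open>G + (\<nabla>\<psi>\<^sub>k - G)\<close>: the first part is treated by dominated convergence, and the second tends
  to 0 since \<open>|G|\<^bsup>p-1\<^esup>\<close> lies in the dual space.
\<close>

lemma (in grushin_approx) regularised_picone_equation:
  assumes eq: "weak_grushin_div \<gamma> \<Omega> (\<lambda>z. (norm (G z) powr (p - 2)) *\<^sub>R G z)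
      (\<lambda>z. - (\<mu> * (\<bar>\<phi> z\<bar> powr (p - 2) * \<phi> z)))"
    and pos: "AE z in lebesgue_on \<Omega>. 0 < \<phi> z" and f: "f \<in> C0_infinity \<Omega>" and \<epsilon>: "0 < \<epsilon>"
  shows "(LINT z|lebesgue_on \<Omega>.
       (\<phi> z + \<epsilon>) powr (1 - p) * (p * norm (f z) powr (p - 2))
           * ((norm (G z) powr (p - 2) *\<^sub>R G z) \<bullet> real_pairing (f z) (grushin_grad \<gamma> f z))
       + (norm (f z) powr p * ((1 - p) * (\<phi> z + \<epsilon>) powr (- p))) * norm (G z) powr p)
     = \<mu> * (LINT z|lebesgue_on \<Omega>. \<phi> z powr (p - 1) * (norm (f z) powr p * (\<phi> z + \<epsilon>) powr (1 - p)))"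
proof -
  obtain K where K: "compact K" "\<And>z. z \<notin> K \<Longrightarrow> f z = 0" "\<And>e z. z \<notin> K \<Longrightarrow> partial_deriv e f z = 0"
    "continuous_on UNIV f" "\<And>e. e \<in> Basis \<Longrightarrow> continuous_on UNIV (partial_deriv e f)"
    using f by (auto elim!: test_function_facts)
  have cf: "continuous_on UNIV (grushin_grad \<gamma> f)" by (rule grushin_grad_continuous[OF \<gamma> K(5)])
  obtain B where B: "\<And>z. norm (f z) \<le> B" using bounded_of_compact_support[OF K(4,1,2)] by metis
  obtain B' where B': "\<And>z. norm (grushin_grad \<gamma> f z) \<le> B'"
    using bounded_of_compact_support[OF cf K(1)] grushin_grad_outside[OF K(3)] by metis
  have [measurable]: "f \<in> borel_measurable M" "grushin_grad \<gamma> f \<in> borel_measurable M"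
    using K(4) cf by (auto intro: continuous_measurable_M)
  define N where "N z = real_pairing (f z) (grushin_grad \<gamma> f z)" for z
  have cN: "continuous_on UNIV N"
    unfolding N_def by (rule bounded_bilinear.continuous_on[OF bounded_bilinear_real_pairing K(4) cf])
  have [measurable]: "N \<in> borel_measurable M" using cN by (rule continuous_measurable_M)
  define F where "F z = norm (G z) powr (p - 2) *\<^sub>R G z" for z
  have [measurable]: "F \<in> borel_measurable M" unfolding F_def by measurable
  have nF: "norm (F z) = norm (G z) powr (p - 1)" for z
    using powr_minus_one_mult[of "norm (G z)" "p - 1"] by (simp add: F_def)
  have FG: "F z \<bullet> G z = norm (G z) powr p" for z
    using powr_minus_one_mult[of "norm (G z)" "p - 1"] powr_minus_one_mult[of "norm (G z)" p]
    by (simp add: F_def power2_norm_eq_inner[symmetric] power2_eq_square mult.assoc[symmetric])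
  define \<delta> where "\<delta> k = inverse (real (Suc k))" for k
  have \<delta>: "0 < \<delta> k" "\<delta> k \<le> 1" for k by (auto simp: \<delta>_def inverse_eq_divide)
  have \<delta>0: "\<delta> \<longlonglongrightarrow> 0" unfolding \<delta>_def[abs_def] by (rule LIMSEQ_inverse_real_of_nat)
  define g where "g k z = regularised_power p (\<delta> k) (norm (f z))" for k z
  define h where "h k z = smooth_abs_reciprocal p \<epsilon> (\<delta> k) (\<psi> k z)" for k z
  define h' where "h' k z = smooth_abs_reciprocal_deriv p \<epsilon> (\<delta> k) (\<psi> k z)" for k z
  define c where "c k z = p * ((norm (f z))\<^sup>2 + (\<delta> k)\<^sup>2) powr (p / 2 - 1)" for k z
  have [measurable]: "g k \<in> borel_measurable M" "h k \<in> borel_measurable M" "h' k \<in> borel_measurable M" "c k \<in> borel_measurable M" for k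
    unfolding g_def h_def h'_def c_def regularised_power_def smooth_abs_reciprocal_def smooth_abs_reciprocal_deriv_def
    by measurable
  define Cg where "Cg = (B\<^sup>2 + 1) powr (p / 2)"
  define Ch where "Ch = \<epsilon> powr (1 - p)"
  define Ch' where "Ch' = (p - 1) * \<epsilon> powr (- p)"
  define Cc where "Cc = p * ((B\<^sup>2 + 1) powr ((p - 1) / 2) * B')"
  have pos_const: "0 \<le> Cg" "0 \<le> Ch" "0 \<le> Ch'" using p by (auto simp: Cg_def Ch_def Ch'_def)
  have gb: "\<bar>g k z\<bar> \<le> Cg" for k z
    unfolding g_def Cg_def by (rule regularised_power_bounds[OF norm_ge_zero B \<delta> p])
  have hb: "\<bar>h k z\<bar> \<le> Ch" "\<bar>h' k z\<bar> \<le> Ch'" for k z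
    unfolding h_def h'_def Ch_def Ch'_def by (rule smooth_abs_reciprocal_bounds[OF \<delta>(1) \<epsilon> p])+
  have cN_le: "c k z * norm (N z) \<le> Cc" for k z
  proof -
    have "c k z * norm (N z) \<le> c k z * (norm (f z) * B')"
      using norm_real_pairing_le[of "f z" "grushin_grad \<gamma> f z"] mult_left_mono[OF B'[of z] norm_ge_zero[of "f z"]] p
      unfolding N_def c_def by (intro mult_left_mono) (auto intro: order_trans)
    also have "\<dots> = p * ((((norm (f z))\<^sup>2 + (\<delta> k)\<^sup>2) powr (p / 2 - 1) * norm (f z)) * B')"
      by (simp add: c_def)
    also have "\<dots> \<le> Cc"
      unfolding Cc_def using p order_trans[OF norm_ge_zero B']
      by (intro mult_left_mono mult_right_mono regularised_power_bound[OF norm_ge_zero B \<delta> p]) auto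
    finally show ?thesis .
  qed
  have Cc0: "0 \<le> Cc"
    unfolding Cc_def using p order_trans[OF norm_ge_zero B'] by auto
  define w where "w k z = g k z * h k z" for k z
  note test = regularised_test_function[OF f \<delta>(1) \<epsilon>]
  have wC: "w k \<in> C0_infinity \<Omega>" for k
    unfolding w_def g_def h_def by (rule test(1))
  have gw: "grushin_grad \<gamma> (w k) z = (h k z * c k z) *\<^sub>R N z + (g k z * h' k z) *\<^sub>R D k z" for k z
    unfolding w_def g_def h_def h'_def c_def N_def by (rule test(2))
  define T where "T z = (\<phi> z + \<epsilon>) powr (1 - p) * (p * norm (f z) powr (p - 2)) * (F z \<bullet> N z)
       + (norm (f z) powr p * ((1 - p) * (\<phi> z + \<epsilon>) powr (- p))) * norm (G z) powr p" for z
  define R where "R z = \<phi> z powr (p - 1) * (norm (f z) powr p * (\<phi> z + \<epsilon>) powr (1 - p))" for z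
  define P where "P k z = h k z * c k z * (F z \<bullet> N z) + g k z * h' k z * norm (G z) powr p" for k z
  define E where "E k z = g k z * h' k z * (F z \<bullet> (D k z - G z))" for k z
  have [measurable]: "T \<in> borel_measurable M" "R \<in> borel_measurable M" "P k \<in> borel_measurable M" "E k \<in> borel_measurable M" for k
    unfolding T_def R_def P_def E_def by measurable
  have split: "F z \<bullet> grushin_grad \<gamma> (w k) z = P k z + E k z" for k z
    by (simp add: gw P_def E_def inner_add_right inner_diff_right FG algebra_simps)
  have gh: "\<bar>g k z * h' k z\<bar> \<le> Cg * Ch'" for k z
    unfolding abs_mult by (intro mult_mono gb hb pos_const) auto
  have Pb: "norm (P k z) \<le> Ch * Cc * norm (G z) powr (p - 1) + Cg * Ch' * norm (G z) powr p" for k z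
  proof -
    have c0: "0 \<le> c k z" using p by (simp add: c_def)
    have "\<bar>h k z * c k z * (F z \<bullet> N z)\<bar> \<le> \<bar>h k z\<bar> * (c k z * (norm (F z) * norm (N z)))"
      using Cauchy_Schwarz_ineq2[of "F z" "N z"] c0
      by (auto simp: abs_mult mult.assoc intro!: mult_left_mono)
    also have "\<dots> = \<bar>h k z\<bar> * (c k z * norm (N z)) * norm (F z)" by simp
    also have "\<dots> \<le> Ch * Cc * norm (F z)"
      using c0 by (intro mult_right_mono mult_mono hb cN_le pos_const) auto
    finally have 1: "\<bar>h k z * c k z * (F z \<bullet> N z)\<bar> \<le> Ch * Cc * norm (G z) powr (p - 1)" by (simp add: nF)
    have 2: "\<bar>g k z * h' k z * norm (G z) powr p\<bar> \<le> Cg * Ch' * norm (G z) powr p"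
      using mult_right_mono[OF gh[of k z], of "norm (G z) powr p"] by (simp add: abs_mult)
    show ?thesis
      unfolding P_def real_norm_def using 1 2 by linarith
  qed
  have Pdom: "integrable M (\<lambda>z. Ch * Cc * norm (G z) powr (p - 1) + Cg * Ch' * norm (G z) powr p)"
    using G_powr_integrable(1) G_integrable by auto
  have lims: "AE z in M. (\<lambda>k. P k z) \<longlonglongrightarrow> T z \<and> (\<lambda>k. w k z) \<longlonglongrightarrow> norm (f z) powr p * (\<phi> z + \<epsilon>) powr (1 - p)"
    using \<psi>_AE pos
  proof eventually_elim
    case (elim z)
    note hl = smooth_abs_reciprocal_tendsto[OF elim(1) \<delta>0 elim(2) \<epsilon>, of p]
    have gl: "(\<lambda>k. g k z) \<longlonglongrightarrow> norm (f z) powr p"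
      unfolding g_def by (rule regularised_power_tendsto[OF \<delta>0 \<delta>(1) norm_ge_zero p])
    have cl: "(\<lambda>k. c k z * (F z \<bullet> N z)) \<longlonglongrightarrow> p * norm (f z) powr (p - 2) * (F z \<bullet> N z)"
    \<comment> \<open>For \<open>p < 2\<close> the coefficient diverges at zeros of \<open>f\<close>, but there the vector \<open>N z\<close> is zero.\<close>
    proof (cases "f z = 0")
      case True
      then have "N z = 0" using norm_real_pairing_le[of "f z" "grushin_grad \<gamma> f z"] by (simp add: N_def)
      then show ?thesis by simp
    next
      case False
      have "(\<lambda>k. c k z) \<longlonglongrightarrow> p * ((norm (f z))\<^sup>2 + 0\<^sup>2) powr (p / 2 - 1)"
        unfolding c_def using False by (intro tendsto_intros \<delta>0) auto
      moreover have "((norm (f z))\<^sup>2) powr (p / 2 - 1) = norm (f z) powr (p - 2)"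
        using power2_powr_half[of "norm (f z)" "p - 2"] by (simp add: diff_divide_distrib)
      ultimately show ?thesis by (intro tendsto_intros) simp
    qed
    have "(\<lambda>k. h k z * (c k z * (F z \<bullet> N z)) + g k z * h' k z * norm (G z) powr p) \<longlonglongrightarrow>
      (\<phi> z + \<epsilon>) powr (1 - p) * (p * norm (f z) powr (p - 2) * (F z \<bullet> N z))
       + (norm (f z) powr p * ((1 - p) * (\<phi> z + \<epsilon>) powr (- p))) * norm (G z) powr p"
      unfolding h_def h'_def by (intro tendsto_intros hl gl cl)
    then have "(\<lambda>k. P k z) \<longlonglongrightarrow> T z" by (simp add: P_def T_def mult.assoc)
    moreover have "(\<lambda>k. w k z) \<longlonglongrightarrow> norm (f z) powr p * (\<phi> z + \<epsilon>) powr (1 - p)"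
      unfolding w_def h_def by (intro tendsto_intros hl gl)
    ultimately show ?case by simp
  qed
  have Plim: "(\<lambda>k. LINT z|M. P k z) \<longlonglongrightarrow> (LINT z|M. T z)" and Pint: "\<And>k. integrable M (P k)"
  proof -
    show "(\<lambda>k. LINT z|M. P k z) \<longlonglongrightarrow> (LINT z|M. T z)"
      by (rule integral_dominated_convergence[OF _ _ Pdom]) (use lims Pb in \<open>auto intro!: AE_I2\<close>)
    show "integrable M (P k)" for k
      by (rule Bochner_Integration.integrable_bound[OF Pdom]) (measurable, rule AE_I2, rule order_trans[OF Pb], simp)
  qed
  note Derr = D_error_weighted[of "\<lambda>z. norm (G z)", OF _ norm_ge_zero G_integrable]
  have Eb: "norm (E k z) \<le> Cg * Ch' * (norm (G z) powr (p - 1) * norm (D k z - G z))" for k z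
  proof -
    have "norm (E k z) \<le> \<bar>g k z * h' k z\<bar> * (norm (F z) * norm (D k z - G z))"
      using Cauchy_Schwarz_ineq2[of "F z" "D k z - G z"]
      by (auto simp: E_def abs_mult[of "g k z * h' k z"] intro!: mult_left_mono)
    also have "\<dots> \<le> Cg * Ch' * (norm (F z) * norm (D k z - G z))"
      by (intro mult_right_mono gh) auto
    finally show ?thesis by (simp add: nF)
  qed
  have Edom: "integrable M (\<lambda>z. Cg * Ch' * (norm (G z) powr (p - 1) * norm (D k z - G z)))" for k
    by (intro integrable_mult_right Derr(1)) measurable
  have Eint: "integrable M (E k)" for k
    by (rule Bochner_Integration.integrable_bound[OF Edom[of k]]) (measurable, rule AE_I2, rule order_trans[OF Eb], simp)
  have Elim: "(\<lambda>k. LINT z|M. E k z) \<longlonglongrightarrow> 0"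
  proof (rule Lim_null_comparison)
    have "(\<lambda>k. Cg * Ch' * (LINT z|M. norm (G z) powr (p - 1) * norm (D k z - G z))) \<longlonglongrightarrow> Cg * Ch' * 0"
      by (intro tendsto_intros Derr(2)) measurable
    then show "(\<lambda>k. Cg * Ch' * (LINT z|M. norm (G z) powr (p - 1) * norm (D k z - G z))) \<longlonglongrightarrow> 0" by simp
    show "\<forall>\<^sub>F k in sequentially. norm (LINT z|M. E k z) \<le> Cg * Ch' * (LINT z|M. norm (G z) powr (p - 1) * norm (D k z - G z))"
    proof (rule always_eventually, rule allI)
      fix k
      have "norm (LINT z|M. E k z) \<le> (LINT z|M. Cg * Ch' * (norm (G z) powr (p - 1) * norm (D k z - G z)))"
        using Eb by (intro order_trans[OF integral_norm_bound] integral_mono integrable_norm Eint Edom)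
      then show "norm (LINT z|M. E k z) \<le> Cg * Ch' * (LINT z|M. norm (G z) powr (p - 1) * norm (D k z - G z))"
        by simp
    qed
  qed
  have "(LINT z|M. F z \<bullet> grushin_grad \<gamma> (w k) z) = \<mu> * (LINT z|M. \<bar>\<phi> z\<bar> powr (p - 2) * \<phi> z * w k z)" for k
    using eq wC[of k] unfolding weak_grushin_div_def set_integral_M F_def[symmetric]
    by (auto simp: mult.assoc)
  then have id: "(LINT z|M. P k z) + (LINT z|M. E k z) = \<mu> * (LINT z|M. \<bar>\<phi> z\<bar> powr (p - 2) * \<phi> z * w k z)" for k
    using Pint Eint by (simp add: split)
  have wm: "w k \<in> borel_measurable M" for k unfolding w_def by measurable
  have \<phi>_dom: "integrable M (\<lambda>z. Cg * Ch * (1 + \<bar>\<phi> z\<bar> powr p))"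
    using \<phi>_integrable by auto
  have "(\<lambda>k. LINT z|M. \<bar>\<phi> z\<bar> powr (p - 2) * \<phi> z * w k z) \<longlonglongrightarrow> (LINT z|M. R z)"
  proof (rule integral_dominated_convergence[OF _ _ \<phi>_dom])
    show "AE z in M. (\<lambda>k. \<bar>\<phi> z\<bar> powr (p - 2) * \<phi> z * w k z) \<longlonglongrightarrow> R z"
      using lims pos
    proof eventually_elim
      case (elim z)
      have "\<bar>\<phi> z\<bar> powr (p - 2) * \<phi> z = \<phi> z powr (p - 1)"
        using elim(2) powr_minus_one_mult[of "\<phi> z" "p - 1"] by simp
      then show ?case unfolding R_def using elim(1) by (auto intro!: tendsto_intros)
    qed
    show "AE z in M. norm (\<bar>\<phi> z\<bar> powr (p - 2) * \<phi> z * w k z) \<le> Cg * Ch * (1 + \<bar>\<phi> z\<bar> powr p)" for k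
    proof (rule AE_I2)
      fix z
      have 1: "\<bar>w k z\<bar> \<le> Cg * Ch" unfolding w_def abs_mult by (intro mult_mono gb hb pos_const) auto
      have "\<bar>\<phi> z\<bar> powr (p - 2) * \<bar>\<phi> z\<bar> = \<bar>\<phi> z\<bar> powr (p - 1)"
        using powr_minus_one_mult[of "\<bar>\<phi> z\<bar>" "p - 1"] by simp
      also have "\<dots> \<le> 1 + \<bar>\<phi> z\<bar> powr p"
        using young_powr[of "\<bar>\<phi> z\<bar>" 1 1 p] p by simp
      finally have 2: "\<bar>\<bar>\<phi> z\<bar> powr (p - 2) * \<phi> z\<bar> \<le> 1 + \<bar>\<phi> z\<bar> powr p" by (simp add: abs_mult)
      have "\<bar>\<bar>\<phi> z\<bar> powr (p - 2) * \<phi> z\<bar> * \<bar>w k z\<bar> \<le> (1 + \<bar>\<phi> z\<bar> powr p) * (Cg * Ch)"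
        by (intro mult_mono 1 2) auto
      then show "norm (\<bar>\<phi> z\<bar> powr (p - 2) * \<phi> z * w k z) \<le> Cg * Ch * (1 + \<bar>\<phi> z\<bar> powr p)"
        by (simp only: real_norm_def abs_mult mult.commute mult.left_commute)
    qed
  qed (use wm in measurable)
  then have "(\<lambda>k. (LINT z|M. P k z) + (LINT z|M. E k z)) \<longlonglongrightarrow> \<mu> * (LINT z|M. R z)"
    unfolding id by (intro tendsto_intros)
  moreover have "(\<lambda>k. (LINT z|M. P k z) + (LINT z|M. E k z)) \<longlonglongrightarrow> (LINT z|M. T z) + 0"
    by (intro tendsto_intros Plim Elim)
  ultimately have "(LINT z|M. T z) = \<mu> * (LINT z|M. R z)"
    using LIMSEQ_unique by fastforce
  then show ?thesis by (simp add: T_def R_def F_def N_def)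
qed

section \<open>Removing the regularisation\<close>

text \<open>
  In the regularised equation the mixed term is at most \<open>r\<^bsup>p-1\<^esup> |\<zeta>|\<^bsup>p-1\<^esup> |\<xi>|\<close> with \<open>r = \<phi> / (\<phi> + \<epsilon>)\<close>. By Young's
  inequality half of \<open>(p - 1) \<integral> (r |\<zeta>|)\<^sup>p\<close> absorbs it up to a multiple of \<open>\<integral> |\<xi>|\<^sup>p\<close>. Since \<open>r\<close> increases
  to 1 as \<open>\<epsilon>\<close> decreases to 0, first \<open>|\<zeta>|\<^sup>p\<close> is integrable and then the limit may be taken in every term.
\<close>

proposition (in grushin_approx) picone_equation:
  assumes eq: "weak_grushin_div \<gamma> \<Omega> (\<lambda>z. (norm (G z) powr (p - 2)) *\<^sub>R G z)
      (\<lambda>z. - (\<mu> * (\<bar>\<phi> z\<bar> powr (p - 2) * \<phi> z)))"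
    and pos: "AE z in lebesgue_on \<Omega>. 0 < \<phi> z" and f: "f \<in> C0_infinity \<Omega>"
  defines "\<zeta> \<equiv> \<lambda>z. complex_multiple ((1 / \<phi> z) *\<^sub>R f z) (G z)"
  defines "Q \<equiv> \<lambda>z. p * norm (\<zeta> z) powr (p - 2) * (\<zeta> z \<bullet> grushin_grad \<gamma> f z) - (p - 1) * norm (\<zeta> z) powr p"
  shows "integrable (lebesgue_on \<Omega>) Q"
    and "(LINT z|lebesgue_on \<Omega>. Q z) = \<mu> * (LINT z|lebesgue_on \<Omega>. norm (f z) powr p)"
    and "integrable (lebesgue_on \<Omega>) (\<lambda>z. norm (grushin_grad \<gamma> f z) powr p)"
    and "integrable (lebesgue_on \<Omega>) (\<lambda>z. norm (f z) powr p)"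
proof -
  obtain K where K: "compact K" "\<And>z. z \<notin> K \<Longrightarrow> f z = 0" "\<And>e z. z \<notin> K \<Longrightarrow> partial_deriv e f z = 0"
    "continuous_on UNIV f" "\<And>e. e \<in> Basis \<Longrightarrow> continuous_on UNIV (partial_deriv e f)"
    using f by (auto elim!: test_function_facts)
  define \<xi> where "\<xi> = grushin_grad \<gamma> f"
  have c\<xi>: "continuous_on UNIV \<xi>" unfolding \<xi>_def by (rule grushin_grad_continuous[OF \<gamma> K(5)])
  obtain B where B: "\<And>z. norm (f z) \<le> B" using bounded_of_compact_support[OF K(4,1,2)] by metis
  obtain B' where B': "\<And>z. norm (\<xi> z) \<le> B'"
    using bounded_of_compact_support[OF c\<xi> K(1)] grushin_grad_outside[OF K(3)] unfolding \<xi>_def by metis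
  have [measurable]: "f \<in> borel_measurable M" "\<xi> \<in> borel_measurable M"
    using K(4) c\<xi> by (auto intro: continuous_measurable_M)
  have [measurable]: "\<zeta> \<in> borel_measurable M"
    unfolding \<zeta>_def
    by (rule borel_measurable_continuous_Pair[where H=complex_multiple])
      (measurable, intro bounded_bilinear.continuous_on[OF bounded_bilinear_complex_multiple] continuous_intros)
  show \<xi>p: "integrable M (\<lambda>z. norm (grushin_grad \<gamma> f z) powr p)"
    unfolding \<xi>_def[symmetric]
  proof (rule integrable_bounded_M)
    show "norm (norm (\<xi> z) powr p) \<le> B' powr p" for z
      using p B'[of z] by (auto intro: powr_mono2)
  qed measurable
  show fp: "integrable M (\<lambda>z. norm (f z) powr p)"
  proof (rule integrable_bounded_M)
    show "norm (norm (f z) powr p) \<le> B powr p" for z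
      using p B[of z] by (auto intro: powr_mono2)
  qed measurable
  define J where "J z = norm (\<zeta> z) powr (p - 2) * (\<zeta> z \<bullet> \<xi> z)" for z
  define Z where "Z z = norm (\<zeta> z) powr p" for z
  define \<epsilon> where "\<epsilon> n = inverse (real (Suc n))" for n
  define r where "r n z = \<phi> z / (\<phi> z + \<epsilon> n)" for n z
  have [measurable]: "J \<in> borel_measurable M" "Z \<in> borel_measurable M" "r n \<in> borel_measurable M" for n
    unfolding J_def Z_def r_def by measurable
  have \<epsilon>: "0 < \<epsilon> n" for n by (simp add: \<epsilon>_def)
  have \<epsilon>0: "\<epsilon> \<longlonglongrightarrow> 0" unfolding \<epsilon>_def[abs_def] by (rule LIMSEQ_inverse_real_of_nat)
  have \<epsilon>_dec: "\<epsilon> (Suc n) \<le> \<epsilon> n" for n by (simp add: \<epsilon>_def)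
  have n\<zeta>: "norm (\<zeta> z) = norm (f z) * norm (G z) / \<phi> z" if "0 < \<phi> z" for z
    using that by (simp add: \<zeta>_def norm_complex_multiple)
  \<comment> \<open>In these variables the regularised equation differs from the desired one only by powers of \<open>r\<close>.\<close>
  have J_eq: "J z = \<phi> z powr (1 - p) * norm (f z) powr (p - 2) * ((norm (G z) powr (p - 2) *\<^sub>R G z) \<bullet> real_pairing (f z) (\<xi> z))"
    if \<phi>: "0 < \<phi> z" for z
  proof -
    have "\<zeta> z \<bullet> \<xi> z = (G z \<bullet> real_pairing (f z) (\<xi> z)) / \<phi> z"
      by (simp add: \<zeta>_def complex_multiple_linear complex_multiple_inner)
    moreover have "norm (\<zeta> z) powr (p - 2) = norm (f z) powr (p - 2) * norm (G z) powr (p - 2) * \<phi> z powr (2 - p)"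
      using \<phi> powr_minus_divide[of "\<phi> z" "p - 2"] by (simp add: n\<zeta> powr_divide powr_mult)
    moreover have "\<phi> z powr (2 - p) = \<phi> z powr (1 - p) * \<phi> z"
      using \<phi> powr_minus_one_mult[of "\<phi> z" "2 - p"] by simp
    ultimately show ?thesis using \<phi> by (simp add: J_def)
  qed
  have Z_eq: "Z z = \<phi> z powr (- p) * norm (f z) powr p * norm (G z) powr p" if \<phi>: "0 < \<phi> z" for z
    using \<phi> by (simp add: Z_def n\<zeta> powr_divide powr_mult powr_minus_divide)
  have r01: "0 < r n z" "r n z \<le> 1" if "0 < \<phi> z" for n z
    using that \<epsilon>[of n] by (auto simp: r_def)
  have r_powr: "r n z powr a * \<phi> z powr (- a) = (\<phi> z + \<epsilon> n) powr (- a)" if \<phi>: "0 < \<phi> z" for n z a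
  proof -
    have "r n z powr a = \<phi> z powr a / (\<phi> z + \<epsilon> n) powr a"
      using \<phi> \<epsilon>[of n] by (simp add: r_def powr_divide)
    then show ?thesis using \<phi> by (simp add: powr_minus divide_inverse)
  qed
  have lim_r: "(\<lambda>n. r n z powr a) \<longlonglongrightarrow> 1" if \<phi>: "0 < \<phi> z" for z a
  proof -
    have "(\<lambda>n. r n z powr a) \<longlonglongrightarrow> (\<phi> z / (\<phi> z + 0)) powr a"
      unfolding r_def using \<phi> by (intro tendsto_intros \<epsilon>0) auto
    then show ?thesis using \<phi> by simp
  qed
  have eq_n: "(LINT z|M. p * (r n z powr (p - 1) * J z) - (p - 1) * (r n z powr p * Z z))
      = \<mu> * (LINT z|M. r n z powr (p - 1) * norm (f z) powr p)" for n
  proof -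
    let ?l = "\<lambda>z. (\<phi> z + \<epsilon> n) powr (1 - p) * (p * norm (f z) powr (p - 2))
           * ((norm (G z) powr (p - 2) *\<^sub>R G z) \<bullet> real_pairing (f z) (grushin_grad \<gamma> f z))
       + (norm (f z) powr p * ((1 - p) * (\<phi> z + \<epsilon> n) powr (- p))) * norm (G z) powr p"
    have [measurable]: "(\<lambda>z. real_pairing (f z) (grushin_grad \<gamma> f z)) \<in> borel_measurable M"
      by (intro continuous_measurable_M bounded_bilinear.continuous_on[OF bounded_bilinear_real_pairing K(4)]
          c\<xi>[unfolded \<xi>_def])
    have "(LINT z|M. p * (r n z powr (p - 1) * J z) - (p - 1) * (r n z powr p * Z z)) = (LINT z|M. ?l z)"
    proof (rule integral_cong_AE)
      show "AE z in M. p * (r n z powr (p - 1) * J z) - (p - 1) * (r n z powr p * Z z) = ?l z"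
        using pos
      proof eventually_elim
        case (elim z)
        have a: "(\<phi> z + \<epsilon> n) powr (1 - p) = r n z powr (p - 1) * \<phi> z powr (1 - p)"
          using r_powr[OF elim, of n "p - 1"] by simp
        show ?case
          unfolding a J_eq[OF elim] Z_eq[OF elim] r_powr[OF elim, of n p, symmetric] \<xi>_def
          by (simp add: algebra_simps)
      qed
    qed measurable
    also have "\<dots> = \<mu> * (LINT z|M. \<phi> z powr (p - 1) * (norm (f z) powr p * (\<phi> z + \<epsilon> n) powr (1 - p)))"
      by (rule regularised_picone_equation[OF eq pos f \<epsilon>])
    also have "(LINT z|M. \<phi> z powr (p - 1) * (norm (f z) powr p * (\<phi> z + \<epsilon> n) powr (1 - p)))
        = (LINT z|M. r n z powr (p - 1) * norm (f z) powr p)"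
    proof (rule integral_cong_AE)
      show "AE z in M. \<phi> z powr (p - 1) * (norm (f z) powr p * (\<phi> z + \<epsilon> n) powr (1 - p))
          = r n z powr (p - 1) * norm (f z) powr p"
        using pos
      proof eventually_elim
        case (elim z)
        have "(\<phi> z + \<epsilon> n) powr (1 - p) = r n z powr (p - 1) * \<phi> z powr (- (p - 1))"
          using r_powr[OF elim, of n "p - 1"] by simp
        moreover have "\<phi> z powr (p - 1) * \<phi> z powr (- (p - 1)) = 1"
          using elim by (simp flip: powr_add)
        ultimately show ?case by (simp add: algebra_simps)
      qed
    qed measurable
    finally show ?thesis .
  qed
  have Jb: "\<bar>J z\<bar> \<le> norm (\<zeta> z) powr (p - 1) * norm (\<xi> z)" for z
  proof -
    have "\<bar>J z\<bar> \<le> norm (\<zeta> z) powr (p - 2) * (norm (\<zeta> z) * norm (\<xi> z))"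
      unfolding J_def abs_mult using Cauchy_Schwarz_ineq2[of "\<zeta> z" "\<xi> z"] by (auto intro!: mult_left_mono)
    then show ?thesis
      using powr_minus_one_mult[of "norm (\<zeta> z)" "p - 1"] by (simp add: mult.assoc[symmetric])
  qed
  have rJ: "\<bar>r n z powr (p - 1) * J z\<bar> \<le> \<theta> * (r n z powr p * Z z) + \<theta> powr (1 - p) * norm (\<xi> z) powr p"
    if \<phi>: "0 < \<phi> z" and \<theta>: "0 < \<theta>" for n z \<theta>
  proof -
    have "\<bar>r n z powr (p - 1) * J z\<bar> \<le> r n z powr (p - 1) * (norm (\<zeta> z) powr (p - 1) * norm (\<xi> z))"
      using Jb[of z] by (simp add: abs_mult mult_left_mono)
    also have "\<dots> = (r n z * norm (\<zeta> z)) powr (p - 1) * norm (\<xi> z)"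
      using r01[OF \<phi>, of n] by (simp add: powr_mult)
    also have "\<dots> \<le> \<theta> * (r n z * norm (\<zeta> z)) powr p + \<theta> powr (1 - p) * norm (\<xi> z) powr p"
      using r01[OF \<phi>, of n] \<theta> p by (intro young_powr) auto
    finally show ?thesis using r01[OF \<phi>, of n] by (simp add: powr_mult Z_def)
  qed
  have rZ_int: "integrable M (\<lambda>z. r n z powr p * Z z)" for n
  proof (rule Bochner_Integration.integrable_bound[where f="\<lambda>z. (B / \<epsilon> n) powr p * norm (G z) powr p"])
    show "AE z in M. norm (r n z powr p * Z z) \<le> norm ((B / \<epsilon> n) powr p * norm (G z) powr p)"
      using pos
    proof eventually_elim
      case (elim z)
      have B0: "0 \<le> B" using order_trans[OF norm_ge_zero B] .
      have "norm (f z) / (\<phi> z + \<epsilon> n) \<le> B / \<epsilon> n"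
        using elim B[of z] B0 \<epsilon>[of n] by (intro frac_le) auto
      then have "(norm (f z) / (\<phi> z + \<epsilon> n)) powr p \<le> (B / \<epsilon> n) powr p"
        using elim \<epsilon>[of n] p by (intro powr_mono2) auto
      moreover have "r n z powr p * Z z = (norm (f z) / (\<phi> z + \<epsilon> n)) powr p * norm (G z) powr p"
      proof -
        have "r n z powr p * Z z = (r n z powr p * \<phi> z powr (- p)) * (norm (f z) powr p * norm (G z) powr p)"
          by (simp only: Z_eq[OF elim] mult.assoc)
        also have "\<dots> = (\<phi> z + \<epsilon> n) powr (- p) * (norm (f z) powr p * norm (G z) powr p)"
          by (simp only: r_powr[OF elim])
        also have "\<dots> = (norm (f z) / (\<phi> z + \<epsilon> n)) powr p * norm (G z) powr p"
          using elim \<epsilon>[of n] by (simp add: powr_divide powr_minus_divide)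
        finally show ?thesis .
      qed
      ultimately show ?case
        by (simp add: abs_mult mult_right_mono)
    qed
  qed (use G_integrable in auto)
  have rJ_int: "integrable M (\<lambda>z. r n z powr (p - 1) * J z)" for n
  proof (rule Bochner_Integration.integrable_bound[where f="\<lambda>z. 1 * (r n z powr p * Z z) + 1 powr (1 - p) * norm (\<xi> z) powr p"])
    show "AE z in M. norm (r n z powr (p - 1) * J z) \<le> norm (1 * (r n z powr p * Z z) + 1 powr (1 - p) * norm (\<xi> z) powr p)"
      using pos
      by eventually_elim (rule order_trans[OF rJ[of _ 1, folded real_norm_def]], simp_all)
  qed (use rZ_int \<xi>p in \<open>auto simp: \<xi>_def\<close>)
  \<comment> \<open>The mixed term carries the factor \<open>p\<close>; this choice of \<open>\<theta>\<close> lets half of \<open>(p - 1) \<integral> (r |\<zeta>|)\<^sup>p\<close> absorb it.\<close>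
  define \<theta> where "\<theta> = (p - 1) / (2 * p)"
  have \<theta>: "0 < \<theta>" "p * \<theta> = (p - 1) / 2" using p by (auto simp: \<theta>_def)
  define I\<xi> where "I\<xi> = (LINT z|M. norm (\<xi> z) powr p)"
  define I_f where "I_f = (LINT z|M. norm (f z) powr p)"
  define b where "b = 2 / (p - 1) * (p * (\<theta> powr (1 - p) * I\<xi>) + \<bar>\<mu>\<bar> * I_f)"
  have bound: "(LINT z|M. r n z powr p * Z z) \<le> b" for n
  proof -
    let ?IZ = "LINT z|M. r n z powr p * Z z"
    let ?IJ = "LINT z|M. r n z powr (p - 1) * J z"
    let ?IR = "LINT z|M. r n z powr (p - 1) * norm (f z) powr p"
    have 1: "p * ?IJ - (p - 1) * ?IZ = \<mu> * ?IR"
      using eq_n[of n] rJ_int[of n] rZ_int[of n] by simp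
    have "?IJ \<le> (LINT z|M. \<theta> * (r n z powr p * Z z) + \<theta> powr (1 - p) * norm (\<xi> z) powr p)"
    proof (rule integral_mono_AE[OF rJ_int])
      show "AE z in M. r n z powr (p - 1) * J z \<le> \<theta> * (r n z powr p * Z z) + \<theta> powr (1 - p) * norm (\<xi> z) powr p"
        using pos by eventually_elim (rule order_trans[OF abs_ge_self rJ], simp_all add: \<theta>)
    qed (use rZ_int \<xi>p in \<open>auto simp: \<xi>_def\<close>)
    also have "\<dots> = \<theta> * ?IZ + \<theta> powr (1 - p) * I\<xi>"
      using rZ_int \<xi>p by (simp add: I\<xi>_def \<xi>_def)
    finally have "p * ?IJ \<le> p * (\<theta> * ?IZ + \<theta> powr (1 - p) * I\<xi>)"
      using p by (intro mult_left_mono) auto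
    then have 2: "p * ?IJ \<le> (p - 1) / 2 * ?IZ + p * (\<theta> powr (1 - p) * I\<xi>)"
      using \<theta>(2) by (simp add: distrib_left mult.assoc[symmetric])
    have rf: "AE z in M. r n z powr (p - 1) * norm (f z) powr p \<le> norm (f z) powr p"
      using pos
    proof eventually_elim
      case (elim z)
      have "r n z powr (p - 1) \<le> 1" using r01[OF elim, of n] p by (intro powr_le1) auto
      then show ?case by (simp add: mult_left_le_one_le)
    qed
    have rf_int: "integrable M (\<lambda>z. r n z powr (p - 1) * norm (f z) powr p)"
      by (rule Bochner_Integration.integrable_bound[OF fp]) (use rf in auto)
    have IR: "0 \<le> ?IR" "?IR \<le> I_f"
      unfolding I_f_def using rf by (auto intro!: integral_nonneg_AE integral_mono_AE rf_int fp)
    have "\<bar>\<mu> * ?IR\<bar> \<le> \<bar>\<mu>\<bar> * I_f"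
      using IR by (simp add: abs_mult mult_left_mono)
    with 1 2 have "(p - 1) / 2 * ?IZ \<le> p * (\<theta> powr (1 - p) * I\<xi>) + \<bar>\<mu>\<bar> * I_f"
      by (simp add: algebra_simps) (simp add: field_simps)
    then show ?thesis using p by (simp add: b_def field_simps)
  qed
  have mono: "r n z powr p * Z z \<le> r (Suc n) z powr p * Z z" if \<phi>: "0 < \<phi> z" for n z
  proof -
    have "r n z \<le> r (Suc n) z"
      unfolding r_def using \<phi> \<epsilon>[of "Suc n"] \<epsilon>_dec[of n] by (intro divide_left_mono mult_pos_pos) auto
    then show ?thesis
      using r01[OF \<phi>, of n] p by (intro mult_right_mono powr_mono2) (auto simp: Z_def)
  qed
  have "incseq (\<lambda>n. LINT z|M. r n z powr p * Z z)"
    by (rule incseq_SucI, rule integral_mono_AE[OF rZ_int rZ_int]) (use pos mono in auto)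
  then obtain L where L: "(\<lambda>n. LINT z|M. r n z powr p * Z z) \<longlonglongrightarrow> L"
    using incseq_convergent[of _ b] bound by blast
  have Zint: "integrable M Z"
  proof (rule integrable_monotone_convergence[OF rZ_int _ _ L])
    show "AE z in M. mono (\<lambda>n. r n z powr p * Z z)"
      using pos by eventually_elim (auto intro!: incseq_SucI mono)
    show "AE z in M. (\<lambda>n. r n z powr p * Z z) \<longlonglongrightarrow> Z z"
      using pos by eventually_elim (use tendsto_mult_right[OF lim_r] in fastforce)
  qed measurable
  have Jint: "integrable M J"
  proof (rule Bochner_Integration.integrable_bound[where f="\<lambda>z. Z z + norm (\<xi> z) powr p"])
    show "AE z in M. norm (J z) \<le> norm (Z z + norm (\<xi> z) powr p)"
    proof (rule AE_I2)
      fix z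
      have "norm (\<zeta> z) powr (p - 1) * norm (\<xi> z) \<le> 1 * Z z + 1 powr (1 - p) * norm (\<xi> z) powr p"
        unfolding Z_def using p by (intro young_powr) auto
      then show "norm (J z) \<le> norm (Z z + norm (\<xi> z) powr p)" using Jb[of z] by simp
    qed
  qed (use Zint \<xi>p in \<open>auto simp: \<xi>_def\<close>)
  have Q_eq: "Q z = p * J z - (p - 1) * Z z" for z
    by (simp add: Q_def J_def Z_def \<xi>_def)
  show "integrable M Q" unfolding Q_eq[abs_def] using Jint Zint by auto
  have "(\<lambda>n. LINT z|M. p * (r n z powr (p - 1) * J z) - (p - 1) * (r n z powr p * Z z)) \<longlonglongrightarrow> (LINT z|M. Q z)"
  proof (rule integral_dominated_convergence[where w="\<lambda>z. p * \<bar>J z\<bar> + (p - 1) * Z z"])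
    show "AE z in M. (\<lambda>n. p * (r n z powr (p - 1) * J z) - (p - 1) * (r n z powr p * Z z)) \<longlonglongrightarrow> Q z"
      using pos
    proof eventually_elim
      case (elim z)
      have "(\<lambda>n. p * (r n z powr (p - 1) * J z) - (p - 1) * (r n z powr p * Z z)) \<longlonglongrightarrow> p * (1 * J z) - (p - 1) * (1 * Z z)"
        by (intro tendsto_intros lim_r[OF elim])
      then show ?case by (simp add: Q_eq)
    qed
    show "AE z in M. norm (p * (r n z powr (p - 1) * J z) - (p - 1) * (r n z powr p * Z z)) \<le> p * \<bar>J z\<bar> + (p - 1) * Z z" for n
      using pos
    proof eventually_elim
      case (elim z)
      have le1: "r n z powr (p - 1) \<le> 1" "r n z powr p \<le> 1" using r01[OF elim, of n] p by (auto intro!: powr_le1)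
      have "\<bar>p * (r n z powr (p - 1) * J z)\<bar> \<le> p * \<bar>J z\<bar>"
        using le1(1) p by (simp add: abs_mult mult_left_le_one_le)
      moreover have "\<bar>(p - 1) * (r n z powr p * Z z)\<bar> \<le> (p - 1) * Z z"
        using le1(2) p by (simp add: abs_mult mult_left_le_one_le Z_def)
      ultimately show ?case unfolding real_norm_def by linarith
    qed
    show "Q \<in> borel_measurable M" unfolding Q_eq[abs_def] by measurable
    show "integrable M (\<lambda>z. p * \<bar>J z\<bar> + (p - 1) * Z z)" using Jint Zint by auto
  qed measurable
  moreover have "(\<lambda>n. \<mu> * (LINT z|M. r n z powr (p - 1) * norm (f z) powr p)) \<longlonglongrightarrow> \<mu> * (LINT z|M. norm (f z) powr p)"
  proof (intro tendsto_intros integral_dominated_convergence[OF _ _ fp])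
    show "AE z in M. (\<lambda>n. r n z powr (p - 1) * norm (f z) powr p) \<longlonglongrightarrow> norm (f z) powr p"
      using pos
    proof eventually_elim
      case (elim z)
      show ?case using tendsto_mult_right[OF lim_r[OF elim, of "p - 1"], of "norm (f z) powr p"] by simp
    qed
    show "AE z in M. norm (r n z powr (p - 1) * norm (f z) powr p) \<le> norm (f z) powr p" for n
      using pos
    proof eventually_elim
      case (elim z)
      have "r n z powr (p - 1) \<le> 1" using r01[OF elim, of n] p by (intro powr_le1) auto
      then show ?case by (simp add: mult_left_le_one_le)
    qed
  qed measurable
  ultimately show "(LINT z|M. Q z) = \<mu> * (LINT z|M. norm (f z) powr p)"
    unfolding eq_n by (rule LIMSEQ_unique)
qed

text \<open>
  Convergence in the mean of order \<open>p\<close> gives convergence almost everywhere along a subsequence.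
\<close>

lemma grushin_W0_imp_approx:
  fixes \<Omega> :: "((real^'m) \<times> (real^'k)) set"
  assumes \<gamma>: "0 \<le> \<gamma>" and p: "1 < p" and \<Omega>: "open \<Omega>" "bounded \<Omega>" and W: "grushin_W0 \<gamma> p \<Omega> \<phi> G"
  obtains \<psi> where "grushin_approx \<gamma> p \<Omega> \<phi> G \<psi>"
proof -
  let ?M = "lebesgue_on \<Omega>"
  have \<Omega>m: "\<Omega> \<in> lmeasurable" using \<Omega> by (simp add: lmeasurable_open)
  then have \<Omega>s: "\<Omega> \<in> sets lebesgue" by (rule fmeasurableD)
  have fin: "finite_measure ?M" using \<Omega>m by (rule finite_measure_lebesgue_on)
  note si = set_integrable_lebesgue_on[OF \<Omega>s] and sI = set_integral_lebesgue_on[OF \<Omega>s]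
  have meas: "locally_integrable_on \<Omega> u \<Longrightarrow> u \<in> borel_measurable ?M" for u :: "_ \<Rightarrow> 'c::euclidean_space"
    using locally_integrable_measurable[of \<Omega> u] \<Omega>(1) \<Omega>s by (simp add: borel_measurable_restrict_space_iff)
  have \<phi>m [measurable]: "\<phi> \<in> borel_measurable ?M" and Gm: "G \<in> borel_measurable ?M"
    using W meas by (auto simp: grushin_W0_def weak_grushin_grad_def)
  have \<phi>p: "integrable ?M (\<lambda>z. \<bar>\<phi> z\<bar> powr p)" and Gp: "integrable ?M (\<lambda>z. norm (G z) powr p)"
    using W by (auto simp: grushin_W0_def si)
  obtain \<psi> where \<psi>: "\<And>n::nat. \<psi> n \<in> C0_infinity \<Omega>"
    "(\<lambda>n. LINT z|?M. \<bar>\<phi> z - \<psi> n z\<bar> powr p) \<longlonglongrightarrow> 0"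
    "(\<lambda>n. LINT z|?M. norm (G z - grushin_grad \<gamma> (\<psi> n) z) powr p) \<longlonglongrightarrow> 0"
    using W by (auto simp: grushin_W0_def sI)
  have int: "integrable ?M (\<lambda>z. \<bar>\<phi> z - \<psi> n z\<bar> powr p)" for n
  proof -
    obtain K where K: "compact K" "\<And>z. z \<notin> K \<Longrightarrow> \<psi> n z = 0" "continuous_on UNIV (\<psi> n)"
      using \<psi>(1)[of n] by (auto elim!: test_function_facts)
    obtain B where B: "\<And>z. norm (\<psi> n z) \<le> B" using bounded_of_compact_support[OF K(3,1,2)] by metis
    have "\<psi> n \<in> borel_measurable ?M"
      using K(3) by (intro measurable_restrict_space1 continuous_lebesgue_measurable)
    from integrable_powr_diff_bounded[OF fin _ this \<phi>m _ B, of p] show ?thesis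
      using p \<phi>p by (simp add: abs_minus_commute)
  qed
  have "(\<lambda>n. LINT z|?M. norm (\<bar>\<phi> z - \<psi> n z\<bar> powr p)) \<longlonglongrightarrow> 0" using \<psi>(2) by simp
  from tendsto_L1_AE_subseq[OF int this]
  obtain s where s: "strict_mono s" "AE z in ?M. (\<lambda>n. \<bar>\<phi> z - \<psi> (s n) z\<bar> powr p) \<longlonglongrightarrow> 0" by blast
  have ae: "AE z in ?M. (\<lambda>n. \<psi> (s n) z) \<longlonglongrightarrow> \<phi> z"
    using s(2)
  proof eventually_elim
    case (elim z)
    have "(\<lambda>n. (\<bar>\<phi> z - \<psi> (s n) z\<bar> powr p) powr (1 / p)) \<longlonglongrightarrow> 0 powr (1 / p)"
      using p by (intro tendsto_intros elim) auto
    then have "(\<lambda>n. \<bar>\<phi> z - \<psi> (s n) z\<bar>) \<longlonglongrightarrow> 0"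
      using p by (simp add: powr_powr)
    then have "(\<lambda>n. \<phi> z - \<psi> (s n) z) \<longlonglongrightarrow> 0" by (simp add: tendsto_rabs_zero_iff)
    from tendsto_diff[OF tendsto_const[of "\<phi> z"] this] show ?case by simp
  qed
  have "grushin_approx \<gamma> p \<Omega> \<phi> G (\<lambda>n. \<psi> (s n))"
  proof
    show "(\<lambda>n. LINT z|?M. norm (G z - grushin_grad \<gamma> (\<psi> (s n)) z) powr p) \<longlonglongrightarrow> 0"
      using LIMSEQ_subseq_LIMSEQ[OF \<psi>(3) s(1)] by (simp add: o_def)
  qed (use \<gamma> p \<Omega> \<phi>m Gm \<phi>p Gp \<psi>(1) ae in auto)
  then show ?thesis by (rule that)
qed

text \<open>
  Lebesgue measure is complete, so \<open>v\<close> inherits measurability from \<open>u\<close>. This is needed because an arbitrary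
  gradient of the quotient is only known up to null sets.
\<close>

lemma lebesgue_on_integrable_cong_AE:
  fixes u v :: "'a::euclidean_space \<Rightarrow> real"
  assumes S: "S \<in> sets lebesgue" and u: "integrable (lebesgue_on S) u" and ae: "AE z in lebesgue_on S. u z = v z"
  shows "integrable (lebesgue_on S) v" "integral\<^sup>L (lebesgue_on S) v = integral\<^sup>L (lebesgue_on S) u"
proof -
  have "(\<lambda>z. indicator S z *\<^sub>R u z) \<in> borel_measurable lebesgue"
    using borel_measurable_integrable[OF u] S by (simp add: borel_measurable_restrict_space_iff)
  moreover have "AE z in lebesgue. indicator S z *\<^sub>R u z = indicator S z *\<^sub>R v z"
    using ae S by (auto simp: AE_restrict_space_iff indicator_def elim!: eventually_mono)
  ultimately have "(\<lambda>z. indicator S z *\<^sub>R v z) \<in> borel_measurable lebesgue"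
    by (rule borel_measurable_AE)
  then have v: "v \<in> borel_measurable (lebesgue_on S)"
    using S by (simp add: borel_measurable_restrict_space_iff)
  show "integrable (lebesgue_on S) v" by (rule integrable_cong_AE_imp[OF u v ae])
  show "integral\<^sup>L (lebesgue_on S) v = integral\<^sup>L (lebesgue_on S) u"
    using ae by (intro integral_cong_AE v borel_measurable_integrable[OF u]) (auto elim!: eventually_mono)
qed

theorem corollary3p5:
  fixes \<gamma> p lam1 :: real
    and \<Omega> :: "((real^'m) \<times> (real^'k)) set"
    and \<phi>1 :: "(real^'m) \<times> (real^'k) \<Rightarrow> real"
    and f :: "(real^'m) \<times> (real^'k) \<Rightarrow> complex"
  assumes "0 \<le> \<gamma>" and "1 < p"
    and "open \<Omega>" and "bounded \<Omega>"
    and "first_dirichlet_eigenfunction \<gamma> p \<Omega> lam1 \<phi>1"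
    and "AE z in lebesgue. z \<in> \<Omega> \<longrightarrow> 0 < \<phi>1 z"
    and "f \<in> C0_infinity \<Omega>"
  shows "(\<exists>H. has_grushin_grad \<gamma> \<Omega> (\<lambda>z. f z / complex_of_real (\<phi>1 z)) H) \<and>
    (\<forall>H. has_grushin_grad \<gamma> \<Omega> (\<lambda>z. f z / complex_of_real (\<phi>1 z)) H \<longrightarrow>
       set_integrable lebesgue \<Omega> (\<lambda>z. norm (grushin_grad \<gamma> f z) powr p) \<and>
       set_integrable lebesgue \<Omega> (\<lambda>z. norm (f z) powr p) \<and>
       set_integrable lebesgue \<Omega> (\<lambda>z. C_p p (grushin_grad \<gamma> f z) (\<phi>1 z *\<^sub>R H z)) \<and>
       (LINT z:\<Omega>|lebesgue. norm (grushin_grad \<gamma> f z) powr p)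
         = lam1 * (LINT z:\<Omega>|lebesgue. norm (f z) powr p)
           + (LINT z:\<Omega>|lebesgue. C_p p (grushin_grad \<gamma> f z) (\<phi>1 z *\<^sub>R H z)))"
proof -
  obtain G where W: "grushin_W0 \<gamma> p \<Omega> \<phi>1 G"
    and eq: "weak_grushin_div \<gamma> \<Omega> (\<lambda>z. (norm (G z) powr (p - 2)) *\<^sub>R G z)
      (\<lambda>z. - (lam1 * (\<bar>\<phi>1 z\<bar> powr (p - 2) * \<phi>1 z)))"
    using assms(5) by (auto simp: first_dirichlet_eigenfunction_def dirichlet_eigenfunction_def)
  obtain \<psi> where "grushin_approx \<gamma> p \<Omega> \<phi>1 G \<psi>"
    using grushin_W0_imp_approx[OF assms(1-4) W] .
  then interpret grushin_approx \<gamma> p \<Omega> \<phi>1 G \<psi> .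
  have pos: "AE z in lebesgue_on \<Omega>. 0 < \<phi>1 z"
    using assms(6) \<Omega>_sets by (simp add: AE_restrict_space_iff)
  note f = \<open>f \<in> C0_infinity \<Omega>\<close>
  let ?\<xi> = "grushin_grad \<gamma> f"
  define \<zeta> where "\<zeta> z = complex_multiple ((1 / \<phi>1 z) *\<^sub>R f z) (G z)" for z
  define Q where "Q z = p * norm (\<zeta> z) powr (p - 2) * (\<zeta> z \<bullet> ?\<xi> z) - (p - 1) * norm (\<zeta> z) powr p" for z
  note picone = picone_equation[OF eq pos f, folded \<zeta>_def, folded Q_def]
  define H0 where "H0 z = (1 / \<phi>1 z) *\<^sub>R ?\<xi> z - complex_multiple ((1 / (\<phi>1 z)\<^sup>2) *\<^sub>R f z) (G z)" for z
  have H0: "has_grushin_grad \<gamma> \<Omega> (\<lambda>z. f z / complex_of_real (\<phi>1 z)) H0"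
    unfolding H0_def by (rule quotient_has_grushin_grad[OF f pos])
  show ?thesis
  proof (intro conjI exI[of _ H0] allI impI H0; (unfold set_integrable_M set_integral_M)?)
    fix H assume H: "has_grushin_grad \<gamma> \<Omega> (\<lambda>z. f z / complex_of_real (\<phi>1 z)) H"
    show "integrable M (\<lambda>z. norm (?\<xi> z) powr p)" "integrable M (\<lambda>z. norm (f z) powr p)" by (rule picone)+
    have "AE z in M. H z = H0 z"
      using has_grushin_grad_unique[OF H H0 \<open>0 \<le> \<gamma>\<close> \<open>open \<Omega>\<close>] \<Omega>_sets by (simp add: AE_restrict_space_iff)
    then have ae: "AE z in M. norm (?\<xi> z) powr p - Q z = C_p p (?\<xi> z) (\<phi>1 z *\<^sub>R H z)"
      using pos
    proof eventually_elim
      case (elim z)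
      have "\<phi>1 z *\<^sub>R H z = ?\<xi> z - \<zeta> z"
        using elim by (simp add: H0_def \<zeta>_def complex_multiple_linear scaleR_right_diff_distrib power2_eq_square)
      then show ?case using C_p_expand[of p "?\<xi> z" "\<zeta> z"] \<open>1 < p\<close> by (simp add: Q_def)
    qed
    have "integrable M (\<lambda>z. norm (?\<xi> z) powr p - Q z)" using picone by auto
    note C = lebesgue_on_integrable_cong_AE[OF \<Omega>_sets this ae]
    show "integrable M (\<lambda>z. C_p p (?\<xi> z) (\<phi>1 z *\<^sub>R H z))" by (rule C(1))
    show "(LINT z|M. norm (?\<xi> z) powr p) = lam1 * (LINT z|M. norm (f z) powr p)
        + (LINT z|M. C_p p (?\<xi> z) (\<phi>1 z *\<^sub>R H z))"
      unfolding C(2) using picone by simp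
  qed
qed

end
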